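(* Let $N\ge1$, $p_1,\dots,p_N\in(0,1)$, $\beta\ge0$, and let $L_\beta(N,N)$ be the last passage time from $(1,1)$ to $(N,N)$ on the antidiagonally symmetric random weight array with parameters $p_1,\dots,p_N,\beta$ described in the context. Let $$c_\beta=\prod_{1\le i<j\le N}\frac1{1-p_ip_j}\prod_{1\le j\le N}\frac{1+\beta p_j}{1-p_j^2}.$$ For $u\in\frac12\mathbb{Z}_{\ge0}$, the following quantities are equal: $$A=c_\beta\cdot\mathbb{P}\big(L_\beta(N,N)\le 2u\big),$$ $$B=\sum_{\mu\subseteq(2u)^N}\beta^{\mathrm{oddrows}\,\mu}\cdot \mathrm{s}^{(N)}_\mu(p_1,\dots,p_N),$$ $$C=\Big[\prod_{i=1}^N p_i\Big]^u\,\mathrm{s}^{\mathrm{CB}}_{u^N}(p_1,\dots,p_N;\beta),$$ $$D=\Big[\prod_{i=1}^N p_i\Big]^u\sum_{\lambda\subseteq u^{N-n}}\mathrm{s}^{\mathrm{CB}}_{(u^{2n-N},\lambda)}(p_1,\dots,p_n;\beta)\cdot \mathrm{s}^{\mathrm{CB}}_{\lambda}(p_{n+1},\dots,p_N;\beta),$$ where the expression $D$ is valid for any integer $n$ with $\lceil N/2\rceil\le n\le N$.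
   Context: Last passage percolation: $\{W_{i,j}:1\le i,j\le N\}$ is an array of random variables symmetric about the antidiagonal, $W_{i,j}=W_{N-j+1,N-i+1}$, such that the weights with $i+j\le N+1$ are independent and, for $k\in\mathbb{Z}_{\ge0}$, $\mathbb{P}(W_{i,j}=k)=(1-p_{N-i+1}p_j)(p_{N-i+1}p_j)^k$ if $i+j<N+1$, and $\mathbb{P}(W_{i,j}=k)=\frac{1-p_j^2}{1+\beta p_j}\beta^{k\bmod 2}p_j^k$ if $i+j=N+1$ (with $0^0=1$). $L_\beta(N,N)=\max_\pi\sum_{(i,j)\in\pi}W_{i,j}$, the maximum being over directed paths $\pi$ from $(1,1)$ to $(N,N)$, i.e. paths with steps $(1,0)$ or $(0,1)$. Partitions: a half-integer is an element of $\frac12+\mathbb{Z}$. An $m$-partition (resp. $m$-half-partition) is an $m$-tuple $\lambda_1\ge\dots\ge\lambda_m\ge0$ of integers (resp. half-integers). $u^m=(u,\dots,u)$ ($m$ times), and $(a,b)$ denotes concatenation of tuples. A sum over $\lambda\subseteq u^m$ is over all $m$-partitions (if $u$ is an integer) or all $m$-half-partitions (if $u$ is a half-integer) with $\lambda_1\le u$; for $m=0$ it consists of the empty tuple only. $\mathrm{oddrows}\,\mu$ is the number of odd parts of $\mu$. Schur polynomials: $\mathrm{s}^{(N)}_\mu(x_1,\dots,x_N)$ is the usual Schur polynomial, $\mathrm{s}^{(N)}_\mu(x)=\det(x_j^{\mu_i+N-i})_{1\le i,j\le N}/\det(x_j^{N-i})_{1\le i,j\le N}$. CB-interpolating Schur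 polynomials: a split orthogonal pattern of height $2n$ is an array $z=(z_{i,j})_{1\le i\le 2n,\,1\le j\le\lceil i/2\rceil}$ such that $z_{i+1,j+1}\le z_{i,j}\le z_{i+1,j}$ (each inequality whenever both entries exist), the odd ends $z_{2i-1,i}$ ($1\le i\le n$) lie in $\frac12\mathbb{Z}_{\ge0}$, and the other entries lie either all in $\mathbb{Z}_{\ge0}$ or all in $\frac12+\mathbb{Z}_{\ge0}$. Its shape is its last row $(z_{2n,1},\dots,z_{2n,n})$; $\mathrm{type}(z)_i=\sum_{j=1}^{\lceil i/2\rceil}z_{i,j}-\sum_{j=1}^{\lceil(i-1)/2\rceil}z_{i-1,j}$. If $z_{2n,1}$ is an integer (resp. half-integer), its atypical entries are its half-integer (resp. integer) entries; $|\mathfrak a(z)|$ is their number. For an $n$-partition or $n$-half-partition $\lambda$, $$\mathrm{s}^{\mathrm{CB}}_\lambda(x_1,\dots,x_n;\beta)=\sum_{z}\beta^{|\mathfrak a(z)|}\prod_{i=1}^n x_i^{\mathrm{type}(z)_{2i}-\mathrm{type}(z)_{2i-1}},$$ the sum being over split orthogonal patterns of height $2n$ and shape $\lambda$; for $n=0$ it equals $1$. *)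

theory Defs
  imports
    "HOL-Probability.Probability"
    "HOL-Library.Poly_Mapping"
    "Jordan_Normal_Form.Determinant"
begin

text \<open>
  All indices are 1-based, except for positions in lists: the tuple
  \<open>(lam\<^sub>1, \<dots>, lam\<^sub>m)\<close> is a list, and \<open>lam\<^sub>i\<close> is \<open>lam ! (i - 1)\<close>.  Parameter sequences
  \<open>x\<^sub>1, x\<^sub>2, \<dots>\<close> are functions on \<open>nat\<close>; only the values at positive indices matter.
\<close>

section \<open>Last passage percolation\<close>

text \<open>On the antidiagonal, \<open>\<beta> ^ (k mod 2)\<close> is a power with natural exponent, so \<open>0 ^ 0 = 1\<close>.\<close>

definition antidiag_sym_weights ::
  "'a measure \<Rightarrow> nat \<Rightarrow> (nat \<Rightarrow> real) \<Rightarrow> real \<Rightarrow> (nat \<Rightarrow> nat \<Rightarrow> 'a \<Rightarrow> nat) \<Rightarrow> bool" where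
  "antidiag_sym_weights M N p \<beta> W \<longleftrightarrow>
     prob_space M \<and>
     (\<forall>i\<in>{1..N}. \<forall>j\<in>{1..N}. \<forall>\<omega>\<in>space M. W i j \<omega> = W (N - j + 1) (N - i + 1) \<omega>) \<and>
     prob_space.indep_vars M (\<lambda>_. count_space UNIV) (\<lambda>(i, j). W i j)
       {(i, j). i \<in> {1..N} \<and> j \<in> {1..N} \<and> i + j \<le> N + 1} \<and>
     (\<forall>i\<in>{1..N}. \<forall>j\<in>{1..N}. \<forall>k.
        (i + j < N + 1 \<longrightarrow>
           measure M {\<omega> \<in> space M. W i j \<omega> = k} =
             (1 - p (N - i + 1) * p j) * (p (N - i + 1) * p j) ^ k) \<and>
        (i + j = N + 1 \<longrightarrow>
           measure M {\<omega> \<in> space M. W i j \<omega> = k} =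
             (1 - (p j)\<^sup>2) / (1 + \<beta> * p j) * \<beta> ^ (k mod 2) * p j ^ k))"

definition directed_paths :: "nat \<Rightarrow> (nat \<times> nat) list set" where
  "directed_paths N =
     {\<pi>. \<pi> \<noteq> [] \<and> hd \<pi> = (1, 1) \<and> last \<pi> = (N, N) \<and>
         successively (\<lambda>(i, j) s. s = (i + 1, j) \<or> s = (i, j + 1)) \<pi>}"

definition last_passage :: "nat \<Rightarrow> (nat \<Rightarrow> nat \<Rightarrow> nat) \<Rightarrow> nat" where
  "last_passage N w = Max ((\<lambda>\<pi>. \<Sum>(i, j)\<in>set \<pi>. w i j) ` directed_paths N)"

section \<open>Partitions and half-partitions\<close>

definition is_half_integer :: "real \<Rightarrow> bool" where
  "is_half_integer x \<longleftrightarrow> x - 1 / 2 \<in> \<int>"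

definition is_partition :: "nat \<Rightarrow> real list \<Rightarrow> bool" where
  "is_partition m lam \<longleftrightarrow>
     length lam = m \<and> sorted_wrt (\<ge>) lam \<and> (\<forall>a\<in>set lam. 0 \<le> a \<and> a \<in> \<int>)"

definition is_half_partition :: "nat \<Rightarrow> real list \<Rightarrow> bool" where
  "is_half_partition m lam \<longleftrightarrow>
     length lam = m \<and> sorted_wrt (\<ge>) lam \<and> (\<forall>a\<in>set lam. 0 \<le> a \<and> is_half_integer a)"

text \<open>The index set of a sum over \<open>lam \<subseteq> u\<^sup>m\<close>; for \<open>m = 0\<close> it is \<open>{[]}\<close>.\<close>

definition box_partitions :: "real \<Rightarrow> nat \<Rightarrow> real list set" where
  "box_partitions u m =
     {lam. (u \<in> \<int> \<and> is_partition m lam \<or> is_half_integer u \<and> is_half_partition m lam) \<and>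
         (lam \<noteq> [] \<longrightarrow> hd lam \<le> u)}"

definition oddrows :: "nat list \<Rightarrow> nat" where
  "oddrows \<mu> = length (filter odd \<mu>)"

section \<open>Schur polynomials\<close>

text \<open>
  The quotient of alternants is an exact division in the polynomial ring
  \<open>\<real>[X\<^sub>1, \<dots>, X\<^sub>N]\<close>, followed by evaluation.  Dividing the two determinants as real numbers would
  give \<open>0 / 0\<close> whenever two of the arguments coincide.
\<close>

type_synonym real_mpoly = "(nat \<Rightarrow>\<^sub>0 nat) \<Rightarrow>\<^sub>0 real"

definition X_var :: "nat \<Rightarrow> real_mpoly" where
  "X_var j = Poly_Mapping.single (Poly_Mapping.single j 1) 1"

definition mpoly_eval :: "(nat \<Rightarrow> real) \<Rightarrow> real_mpoly \<Rightarrow> real" where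
  "mpoly_eval x P =
     (\<Sum>m\<in>Poly_Mapping.keys P.
        Poly_Mapping.lookup P m * (\<Prod>j\<in>Poly_Mapping.keys m. x j ^ Poly_Mapping.lookup m j))"

text \<open>\<open>det(X\<^sub>j\<^bsup>e\<^sub>i\<^esup>)\<close> for \<open>1 \<le> i, j \<le> N\<close>; matrix entries are indexed from 0.\<close>

definition alternant :: "nat \<Rightarrow> (nat \<Rightarrow> nat) \<Rightarrow> real_mpoly" where
  "alternant N e = Determinant.det (Matrix.mat N N (\<lambda>(i, j). X_var (j + 1) ^ e (i + 1)))"

definition schur_poly :: "nat \<Rightarrow> nat list \<Rightarrow> real_mpoly" where
  "schur_poly N \<mu> =
     (THE S. S * alternant N (\<lambda>i. N - i) = alternant N (\<lambda>i. \<mu> ! (i - 1) + N - i))"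

definition schur :: "nat \<Rightarrow> nat list \<Rightarrow> (nat \<Rightarrow> real) \<Rightarrow> real" where
  "schur N \<mu> x = mpoly_eval x (schur_poly N \<mu>)"

section \<open>CB-interpolating Schur polynomials\<close>

text \<open>Row \<open>i\<close> of a pattern has \<open>\<lceil>i/2\<rceil> = (i + 1) div 2\<close> entries.\<close>

definition pattern_index :: "nat \<Rightarrow> (nat \<times> nat) set" where
  "pattern_index n = {(i, j). 1 \<le> i \<and> i \<le> 2 * n \<and> 1 \<le> j \<and> j \<le> (i + 1) div 2}"

definition odd_ends :: "nat \<Rightarrow> (nat \<times> nat) set" where
  "odd_ends n = {(2 * i - 1, i) | i. i \<in> {1..n}}"

text \<open>
  A pattern is a function vanishing off its index set, so that each array is represented by
  exactly one function.
\<close>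

definition split_orthogonal_pattern :: "nat \<Rightarrow> (nat \<Rightarrow> nat \<Rightarrow> real) \<Rightarrow> bool" where
  "split_orthogonal_pattern n z \<longleftrightarrow>
     (\<forall>i j. (i, j) \<notin> pattern_index n \<longrightarrow> z i j = 0) \<and>
     (\<forall>i j. (i, j) \<in> pattern_index n \<and> (i + 1, j + 1) \<in> pattern_index n \<longrightarrow>
        z (i + 1) (j + 1) \<le> z i j) \<and>
     (\<forall>i j. (i, j) \<in> pattern_index n \<and> (i + 1, j) \<in> pattern_index n \<longrightarrow>
        z i j \<le> z (i + 1) j) \<and>
     (\<forall>(i, j)\<in>odd_ends n. 2 * z i j \<in> \<nat>) \<and>
     ((\<forall>(i, j)\<in>pattern_index n - odd_ends n. z i j \<in> \<nat>) \<or>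
      (\<forall>(i, j)\<in>pattern_index n - odd_ends n. z i j - 1 / 2 \<in> \<nat>))"

text \<open>For \<open>i \<ge> 1\<close>; note \<open>\<lceil>(i - 1)/2\<rceil> = i div 2\<close>.\<close>

definition pattern_type :: "(nat \<Rightarrow> nat \<Rightarrow> real) \<Rightarrow> nat \<Rightarrow> real" where
  "pattern_type z i = (\<Sum>j=1..(i + 1) div 2. z i j) - (\<Sum>j=1..i div 2. z (i - 1) j)"

definition atypical :: "nat \<Rightarrow> (nat \<Rightarrow> nat \<Rightarrow> real) \<Rightarrow> (nat \<times> nat) set" where
  "atypical n z =
     {(i, j) \<in> pattern_index n.
        if z (2 * n) 1 \<in> \<int> then is_half_integer (z i j) else z i j \<in> \<int>}"

definition patterns_of_shape :: "nat \<Rightarrow> real list \<Rightarrow> (nat \<Rightarrow> nat \<Rightarrow> real) set" where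
  "patterns_of_shape n lam =
     {z. split_orthogonal_pattern n z \<and> (\<forall>j\<in>{1..n}. z (2 * n) j = lam ! (j - 1))}"

text \<open>
  The exponents may be half-integers, hence \<open>powr\<close>; the definition is meant for positive \<open>x\<^sub>i\<close>.
  For \<open>n = 0\<close> the only pattern is the zero function and the value is \<open>1\<close>.
\<close>

definition schur_CB :: "nat \<Rightarrow> real list \<Rightarrow> (nat \<Rightarrow> real) \<Rightarrow> real \<Rightarrow> real" where
  "schur_CB n lam x \<beta> =
     (\<Sum>z\<in>patterns_of_shape n lam.
        \<beta> ^ card (atypical n z) *
        (\<Prod>i=1..n. x i powr (pattern_type z (2 * i) - pattern_type z (2 * i - 1))))"

end

theory Submission
  imports Defs
begin

text \<open>
  All four quantities are compared with the polynomial \<open>cb\<close>, a two-row recursion that encodes split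
  orthogonal patterns by tuples of natural numbers.

  For \<open>B = C\<close>: telescoping the sums over interlacing rows gives a Weyl type determinantal formula for
  \<open>cb\<close>. It implies symmetry in the variables and, for a rectangle, an expansion over the sign
  changes of the variables. As functions of \<open>m = 2u\<close>, this expansion and the bounded sum of Schur
  polynomials satisfy the same recursion, by Laplace expansion of the alternant on one side
  and a partial fraction identity on the other. The determinants require distinct variables; the general
  case follows by continuity.

  For \<open>C = D\<close>: in a pattern of rectangular shape, the entries of the top rows are frozen except the last ones.
  Peeling off the top \<open>2(N - n)\<close> rows leaves a pattern of shape \<open>(u\<^bsup>2n-N\<^esup>, lam)\<close>, and the free entries of the
  removed rows form a pattern of shape \<open>lam\<close> in the remaining variables in reverse order; symmetry
  restores the order.

  For \<open>A = C\<close>: by antidiagonal symmetry, \<open>L \<le> 2u\<close> holds iff at every antidiagonal cell twice the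
  maximal path weight before the cell plus the weight \<open>w\<close> of the cell is at most \<open>2u\<close>. Writing \<open>w = 2a + e\<close>
  with \<open>e \<in> {0, 1}\<close> reduces this to a bound on the last passage times in the staircase with antidiagonal weights
  \<open>a\<close>. Local Robinson-Schensted-Knuth moves map the staircase arrays bijectively to chains of
  interlacing partitions on the antidiagonal whose first parts are these last passage times;
  complementing the parts in \<open>u\<close> turns the chains into the rows of the patterns.
\<close>

section \<open>Determinants\<close>

text \<open>Integer and half-integer u are interpolated differently: for m = 2u odd every odd end
  may be rounded either way, so a factor \<Prod>(1 + \<beta> x_i) splits off and leaves \<beta> = 0
  at m - 1. The recursion in m therefore alternates between two forms, and its two kinds of step are
  the instances with parameters (\<beta>, 1) and (1, \<beta>) of a single partial fraction identity.
  The same dichotomy appears for the percolation model. On the antidiagonal the two parameters of a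
  cell coincide, so the even part 2a of a weight contributes (p_j p_j)^a, like the weight a of any
  other cell, and the odd part e contributes \<beta> p_j. An odd weight fits for free under an odd
  bound 2u, and under an even one only if the passage time with the halved weights stays below u.
  Complementing in u turns this slack into a positive odd end, which is exactly the condition under
  which an integer shape admits both roundings.\<close>

definition dt :: "nat \<Rightarrow> (nat \<Rightarrow> nat \<Rightarrow> 'a::comm_ring_1) \<Rightarrow> 'a" where
  "dt n f = Determinant.det (Matrix.mat n n (\<lambda>(i, j). f i j))"

lemma dt_leibniz:
  "dt n f = (\<Sum>p | p permutes {0..<n}. of_int (sign p) * (\<Prod>i<n. f i (p i)))"
proof -
  have "(\<Prod>i = 0..<n. Matrix.mat n n (\<lambda>(i, j). f i j) $$ (i, p i)) = (\<Prod>i<n. f i (p i))"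
    if "p permutes {0..<n}" for p
  proof (rule prod.cong)
    fix i assume "i \<in> {..<n}"
    then have "p i < n" using permutes_in_image[OF that, of i] by simp
    with \<open>i \<in> {..<n}\<close> show "Matrix.mat n n (\<lambda>(i, j). f i j) $$ (i, p i) = f i (p i)" by simp
  qed auto
  then show ?thesis
    unfolding dt_def by (subst det_def'[of _ n]) (auto intro!: sum.cong)
qed

lemma dt_cong:
  assumes "\<And>i j. i < n \<Longrightarrow> j < n \<Longrightarrow> f i j = g i j"
  shows "dt n f = dt n g"
  unfolding dt_def by (rule arg_cong[of _ _ Determinant.det]) (use assms in \<open>auto intro!: cong_mat\<close>)

lemma dt_0 [simp]: "dt 0 f = 1"
  by (simp add: dt_def)

lemma dt_transpose: "dt n (\<lambda>i j. f j i) = dt n f"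
proof -
  have "Matrix.mat n n (\<lambda>(i, j). f j i) = transpose_mat (Matrix.mat n n (\<lambda>(i, j). f i j))"
    by (rule eq_matI) auto
  then show ?thesis
    unfolding dt_def by (metis det_transpose mat_carrier)
qed

lemma dt_mult: "dt n (\<lambda>i j. \<Sum>k<n. f i k * g k j) = dt n f * dt n g"
proof -
  let ?F = "Matrix.mat n n (\<lambda>(i, j). f i j)" and ?G = "Matrix.mat n n (\<lambda>(i, j). g i j)"
  have "Matrix.mat n n (\<lambda>(i, j). \<Sum>k<n. f i k * g k j) = ?F * ?G"
    by (rule eq_matI) (auto simp: scalar_prod_def atLeast0LessThan)
  then show ?thesis
    unfolding dt_def using det_mult[of ?F n ?G] by simp
qed

lemma dt_scale_rows: "dt n (\<lambda>i j. c i * f i j) = (\<Prod>i<n. c i) * dt n f"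
  by (simp add: dt_leibniz prod.distrib sum_distrib_left mult_ac)

lemma dt_scale_columns: "dt n (\<lambda>i j. c j * f i j) = (\<Prod>j<n. c j) * dt n f"
  using dt_scale_rows[of n c "\<lambda>i j. f j i"] dt_transpose[of n f]
    dt_transpose[of n "\<lambda>i j. c j * f i j"] by simp

text \<open>Multilinearity in the rows. The entries of an interlacing row range over independent
  intervals, so a sum of determinants over such rows moves into the matrix entries.\<close>

lemma dt_sum_rows:
  assumes "\<And>i. finite (A i)"
  shows "(\<Sum>g\<in>PiE {..<n} A. (\<Prod>i<n. w i (g i)) * dt n (\<lambda>i j. h i (g i) j)) =
    dt n (\<lambda>i j. \<Sum>r\<in>A i. w i r * h i r j)"
proof -
  have "dt n (\<lambda>i j. \<Sum>r\<in>A i. w i r * h i r j) =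
      (\<Sum>p | p permutes {0..<n}. \<Sum>g\<in>PiE {..<n} A.
        of_int (sign p) * (\<Prod>i<n. w i (g i) * h i (g i) (p i)))"
    using assms by (simp add: dt_leibniz prod_sum_PiE sum_distrib_left)
  also have "\<dots> = (\<Sum>g\<in>PiE {..<n} A. (\<Prod>i<n. w i (g i)) * dt n (\<lambda>i j. h i (g i) j))"
    by (subst sum.swap) (simp add: dt_leibniz prod.distrib sum_distrib_left mult_ac)
  finally show ?thesis by simp
qed

lemma dt_permute_columns:
  assumes "p permutes {0..<n}"
  shows "dt n (\<lambda>i j. f i (p j)) = of_int (sign p) * dt n f"
proof -
  have "dt n (\<lambda>i j. f j (p i)) = of_int (sign p) * dt n (\<lambda>i j. f j i)"
  proof -
    have "Matrix.mat n n (\<lambda>(i, j). Matrix.mat n n (\<lambda>(i, j). f j i) $$ (p i, j)) =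
        Matrix.mat n n (\<lambda>(i, j). f j (p i))"
      by (rule eq_matI) (use permutes_in_image[OF assms] in auto)
    then show ?thesis
      using det_permute_rows[OF _ assms, of "Matrix.mat n n (\<lambda>(i, j). f j i)"] by (simp add: dt_def)
  qed
  then show ?thesis using dt_transpose[of n f] dt_transpose[of n "\<lambda>i j. f i (p j)"] by simp
qed

lemma dt_last_row:
  assumes "\<And>j. j < n \<Longrightarrow> f n j = 0"
  shows "dt (Suc n) f = f n n * dt n f"
proof -
  let ?A = "Matrix.mat (Suc n) (Suc n) (\<lambda>(i, j). f i j)"
  have "mat_delete ?A n n = Matrix.mat n n (\<lambda>(i, j). f i j)"
    by (rule eq_matI) (auto simp: mat_delete_def)
  then have c: "cofactor ?A n n = dt n f"
    by (simp add: cofactor_def dt_def flip: mult_2)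
  have "dt (Suc n) f = (\<Sum>j<Suc n. ?A $$ (n, j) * cofactor ?A n j)"
    unfolding dt_def by (rule laplace_expansion_row) auto
  also have "\<dots> = f n n * dt n f"
    using assms by (simp add: c)
  finally show ?thesis .
qed

lemma dt_last_column:
  assumes "\<And>i. i < n \<Longrightarrow> f i n = 0"
  shows "dt (Suc n) f = f n n * dt n f"
  using dt_last_row[of n "\<lambda>i j. f j i"] assms dt_transpose[of n f] dt_transpose[of "Suc n" f] by simp

lemma dt_combine_last_row:
  "dt (Suc n) (\<lambda>i j. if i < n then f i j else a * g j + b * h j) =
    a * dt (Suc n) (\<lambda>i j. if i < n then f i j else g j) + b * dt (Suc n) (\<lambda>i j. if i < n then f i j else h j)"
proof -
  have *: "(\<Prod>i<n. if i < n then f i (p i) else q i) = (\<Prod>i<n. f i (p i))" for p and q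
    by (rule prod.cong) auto
  show ?thesis
    unfolding dt_leibniz sum_distrib_left sum.distrib[symmetric]
    by (rule sum.cong) (simp_all add: * algebra_simps)
qed

lemma dt_combine_last_column:
  "dt (Suc n) (\<lambda>i j. if j < n then f i j else a * g i + b * h i) =
    a * dt (Suc n) (\<lambda>i j. if j < n then f i j else g i) + b * dt (Suc n) (\<lambda>i j. if j < n then f i j else h i)"
  using dt_combine_last_row[of n "\<lambda>i j. f j i" a g b h]
    dt_transpose[of "Suc n" "\<lambda>i j. if j < n then f i j else a * g i + b * h i"]
    dt_transpose[of "Suc n" "\<lambda>i j. if j < n then f i j else g i"]
    dt_transpose[of "Suc n" "\<lambda>i j. if j < n then f i j else h i"]
  by simp

text \<open>The modified matrix is the original one multiplied from the left by a bidiagonal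
  unitriangular matrix. The value \<open>c = 1\<close> serves telescoping sums,
  \<open>c = x n\<close> the Vandermonde determinant.\<close>

lemma dt_row_differences:
  "dt (Suc n) (\<lambda>i j. if i < n then f i j - c * f (Suc i) j else f i j) = dt (Suc n) f"
proof -
  define U :: "nat \<Rightarrow> nat \<Rightarrow> 'a" where "U i k = (if k = i then 1 else if k = Suc i then - c else 0)" for i k
  have *: "(if i < n then f i j - c * f (Suc i) j else f i j) = (\<Sum>k<Suc n. U i k * f k j)" if "i < Suc n" for i j
  proof -
    have "(\<Sum>k<Suc n. U i k * f k j) = (\<Sum>k\<in>(if i < n then {i, Suc i} else {i}). U i k * f k j)"
      using that by (intro sum.mono_neutral_right) (auto simp: U_def)
    then show ?thesis using that by (auto simp: U_def)
  qed
  have "dt (Suc n) (\<lambda>i j. if i < n then f i j - c * f (Suc i) j else f i j) =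
      dt (Suc n) (\<lambda>i j. \<Sum>k<Suc n. U i k * f k j)"
    by (intro dt_cong *)
  also have "\<dots> = dt (Suc n) U * dt (Suc n) f"
    by (rule dt_mult)
  also have "dt (Suc n) U = 1"
  proof -
    have "dt m U = 1" for m
    proof (induction m)
      case (Suc m)
      have "dt (Suc m) U = U m m * dt m U" by (rule dt_last_row) (simp add: U_def)
      then show ?case using Suc by (simp add: U_def[of m m])
    qed simp
    then show ?thesis .
  qed
  finally show ?thesis by simp
qed

lemma dt_add_last_column:
  "dt (Suc n) (\<lambda>i j. if j < n then f i j + c j * g i else g i) = dt (Suc n) (\<lambda>i j. if j < n then f i j else g i)"
proof -
  define U :: "nat \<Rightarrow> nat \<Rightarrow> 'a" where "U k j = (if k = j then 1 else if k = n then c j else 0)" for k j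
  have *: "(if j < n then f i j + c j * g i else g i) = (\<Sum>k<Suc n. (if k < n then f i k else g i) * U k j)"
    if "j < Suc n" for i j
  proof -
    have "(\<Sum>k<Suc n. (if k < n then f i k else g i) * U k j) =
        (\<Sum>k\<in>{j, n}. (if k < n then f i k else g i) * U k j)"
      using that by (intro sum.mono_neutral_right) (auto simp: U_def)
    then show ?thesis using that by (cases "j = n") (auto simp: U_def mult.commute)
  qed
  have "dt (Suc n) (\<lambda>i j. if j < n then f i j + c j * g i else g i) =
      dt (Suc n) (\<lambda>i j. \<Sum>k<Suc n. (if k < n then f i k else g i) * U k j)"
    by (intro dt_cong *)
  also have "\<dots> = dt (Suc n) (\<lambda>i j. if j < n then f i j else g i) * dt (Suc n) U"
    by (rule dt_mult)
  also have "dt (Suc n) U = 1"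
  proof -
    have "dt m U = 1" if "m \<le> n" for m
      using that
    proof (induction m)
      case (Suc m)
      have "dt (Suc m) U = U m m * dt m U" by (rule dt_last_row) (use Suc.prems in \<open>simp add: U_def\<close>)
      then show ?case using Suc by (simp add: U_def[of m m])
    qed simp
    moreover have "dt (Suc n) U = U n n * dt n U" by (rule dt_last_column) (simp add: U_def)
    ultimately show ?thesis by (simp add: U_def[of n n])
  qed
  finally show ?thesis by simp
qed

text \<open>Taking row differences turns the bordering column of ones into the last unit vector, and
  expanding along that column removes the border.\<close>

lemma dt_differences:
  "dt n (\<lambda>i j. f i j - f (Suc i) j) = dt (Suc n) (\<lambda>i j. if j < n then f i j else 1)"
proof -
  let ?g = "\<lambda>i j. if j < n then f i j else 1"
  have "dt (Suc n) ?g = dt (Suc n) (\<lambda>i j. if i < n then ?g i j - ?g (Suc i) j else ?g i j)"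
    by (rule dt_row_differences[of n ?g 1, unfolded mult_1, symmetric])
  also have "\<dots> = dt n (\<lambda>i j. f i j - f (Suc i) j)"
    by (subst dt_last_column) (simp_all cong: dt_cong)
  finally show ?thesis by simp
qed

section \<open>A recursion for the CB-interpolating Schur polynomials\<close>

text \<open>This is the shape produced by the sum over odd rows: all rows but the last telescope,
  while the last one carries a factor \<open>a\<close> and a correction \<open>c\<close> in the last
  column. After splitting the last row, row operations undo the differences in both summands, and
  the results differ only in their last columns, where they are recombined.\<close>

lemma dt_telescope:
  "dt (Suc n) (\<lambda>i j. if i < n then T i j - T (Suc i) j else a * T i j - c * (if j < n then 0 else 1)) =
    dt (Suc n) (\<lambda>i j. if j < n then T i j else a * T i n - c)"
proof -
  let ?D = "\<lambda>i j. T i j - T (Suc i) j" and ?e = "\<lambda>j. if j < n then 0 else 1"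
  have "dt (Suc n) (\<lambda>i j. if i < n then ?D i j else a * T i j - c * ?e j) =
      dt (Suc n) (\<lambda>i j. if i < n then ?D i j else a * T n j + (- c) * ?e j)"
    by (rule dt_cong) (auto simp: less_Suc_eq)
  also have "\<dots> = a * dt (Suc n) (\<lambda>i j. if i < n then ?D i j else T n j) +
      (- c) * dt (Suc n) (\<lambda>i j. if i < n then ?D i j else ?e j)"
    by (rule dt_combine_last_row)
  also have "dt (Suc n) (\<lambda>i j. if i < n then ?D i j else T n j) =
      dt (Suc n) (\<lambda>i j. if i < n then ?D i j else T i j)"
    by (rule dt_cong) (auto simp: less_Suc_eq)
  also have "\<dots> = dt (Suc n) (\<lambda>i j. if j < n then T i j else T i n)"
    unfolding dt_row_differences[of n T 1, unfolded mult_1]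
    by (rule dt_cong) (auto simp: less_Suc_eq)
  also have "dt (Suc n) (\<lambda>i j. if i < n then ?D i j else ?e j) = dt n ?D"
    by (subst dt_last_row) (simp_all cong: dt_cong)
  also have "\<dots> = dt (Suc n) (\<lambda>i j. if j < n then T i j else 1)"
    by (rule dt_differences)
  also have "a * dt (Suc n) (\<lambda>i j. if j < n then T i j else T i n) + (- c) * \<dots> =
      dt (Suc n) (\<lambda>i j. if j < n then T i j else a * T i n + (- c) * 1)"
    by (rule dt_combine_last_column[symmetric])
  finally show ?thesis by (simp only: mult_1_right diff_conv_add_uminus mult_minus_left)
qed

text \<open>The default \<open>0\<close> is the only lower bound of the last entry, which stands for
  the odd end.\<close>

definition odd_rows :: "nat list \<Rightarrow> nat list set" where
  "odd_rows lam = {rho. length rho = length lam \<and>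
     (\<forall>i<length lam. (if Suc i < length lam then lam ! Suc i else 0) \<le> rho ! i \<and> rho ! i \<le> lam ! i)}"

definition even_rows :: "nat list \<Rightarrow> nat list set" where
  "even_rows rho = {nu. length nu = length rho - 1 \<and>
     (\<forall>i<length rho - 1. rho ! Suc i \<le> nu ! i \<and> nu ! i \<le> rho ! i)}"

text \<open>
  The tuples \<open>lam\<close>, \<open>rho\<close>, \<open>nu\<close> are the integer parts of the rows \<open>2n + 2\<close>, \<open>2n + 1\<close>, \<open>2n\<close> of a pattern, with the
  odd end rounded up. The two roundings of the odd end contribute the factor \<open>1 + b x\<close>. For half-integer shapes this factor
  is present without restriction and is split off globally, which leaves \<open>b = 0\<close>.
\<close>

fun cb :: "real \<Rightarrow> (nat \<Rightarrow> real) \<Rightarrow> nat \<Rightarrow> nat list \<Rightarrow> real" where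
  "cb b x 0 lam = 1"
| "cb b x (Suc n) lam = (\<Sum>rho\<in>odd_rows lam. \<Sum>nu\<in>even_rows rho.
     (if 0 < rho ! n then 1 + b * x n else 1) *
     x n powi (int (sum_list lam) + int (sum_list nu) - 2 * int (sum_list rho)) * cb b x n nu)"

lemma cb_cong:
  assumes "\<And>j. j < n \<Longrightarrow> x j = y j"
  shows "cb b x n lam = cb b y n lam"
  using assms
proof (induction n arbitrary: lam)
  case (Suc n)
  have *: "cb b x n nu = cb b y n nu" for nu using Suc by simp
  show ?case unfolding cb.simps * Suc.prems[OF lessI] ..
qed simp

lemma bij_betw_lists_PiE:
  "bij_betw (\<lambda>g. map g [0..<n]) (PiE {..<n} A) {xs. length xs = n \<and> (\<forall>i<n. xs ! i \<in> A i)}"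
proof (rule bij_betwI[where g = "\<lambda>xs. restrict (\<lambda>i. xs ! i) {..<n}"])
  show "restrict (\<lambda>i. map g [0..<n] ! i) {..<n} = g" if "g \<in> PiE {..<n} A" for g
  proof
    fix i show "restrict (\<lambda>i. map g [0..<n] ! i) {..<n} i = g i"
      using PiE_arb[OF that, of i] by (cases "i < n") simp_all
  qed
  show "map (restrict (\<lambda>i. xs ! i) {..<n}) [0..<n] = xs"
    if "xs \<in> {xs. length xs = n \<and> (\<forall>i<n. xs ! i \<in> A i)}" for xs
  proof (rule nth_equalityI)
    fix i assume "i < length (map (restrict ((!) xs) {..<n}) [0..<n])"
    then have "i < n" by simp
    then show "map (restrict ((!) xs) {..<n}) [0..<n] ! i = xs ! i" by simp
  qed (use that in simp)
  show "(\<lambda>g. map g [0..<n]) \<in> PiE {..<n} A \<rightarrow> {xs. length xs = n \<and> (\<forall>i<n. xs ! i \<in> A i)}"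
    by (intro funcsetI) (simp add: PiE_mem[where S="{..<n}"])
  show "(\<lambda>xs. restrict (\<lambda>i. xs ! i) {..<n}) \<in> {xs. length xs = n \<and> (\<forall>i<n. xs ! i \<in> A i)} \<rightarrow> PiE {..<n} A"
    by (intro funcsetI restrict_PiE_iff[THEN iffD2]) simp
qed

lemma sum_lists_PiE:
  "(\<Sum>xs | length xs = n \<and> (\<forall>i<n. xs ! i \<in> A i). f xs) = (\<Sum>g\<in>PiE {..<n} A. f (map g [0..<n]))"
  by (rule sum.reindex_bij_betw[OF bij_betw_lists_PiE, symmetric])

lemma odd_rows_conv:
  "length lam = n \<Longrightarrow> odd_rows lam = {xs. length xs = n \<and>
     (\<forall>i<n. xs ! i \<in> {(if Suc i < n then lam ! Suc i else 0)..lam ! i})}"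
  by (auto simp: odd_rows_def)

lemma even_rows_conv:
  "length rho = Suc n \<Longrightarrow> even_rows rho = {xs. length xs = n \<and> (\<forall>i<n. xs ! i \<in> {rho ! Suc i..rho ! i})}"
  by (auto simp: even_rows_def)

lemma finite_odd_rows [simp]: "finite (odd_rows lam)"
proof -
  have "finite (PiE {..<length lam} (\<lambda>i. {(if Suc i < length lam then lam ! Suc i else 0)..lam ! i}))"
    by (intro finite_PiE) auto
  from bij_betw_finite[OF bij_betw_lists_PiE, THEN iffD1, OF this] show ?thesis
    by (simp add: odd_rows_conv)
qed

lemma finite_even_rows [simp]: "finite (even_rows rho)"
proof (cases "rho = []")
  case False
  then obtain n where n: "length rho = Suc n" by (cases rho) auto
  have "finite (PiE {..<n} (\<lambda>i. {rho ! Suc i..rho ! i}))"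
    by (intro finite_PiE) auto
  from bij_betw_finite[OF bij_betw_lists_PiE, THEN iffD1, OF this] show ?thesis
    by (simp add: even_rows_conv[OF n])
qed (simp add: even_rows_def)

text \<open>The character of highest weight \<open>l\<close> in one variable: for
  \<open>b = 0\<close> that of sp(2), for \<open>b = 1\<close> that of so(3), with the recurrence of
  the Chebyshev polynomials. The closed form is \<open>cb_one_closed\<close>.\<close>

fun cb_one :: "real \<Rightarrow> nat \<Rightarrow> real \<Rightarrow> real" where
  "cb_one b 0 y = 1"
| "cb_one b (Suc 0) y = y + 1 / y + b"
| "cb_one b (Suc (Suc l)) y = (y + 1 / y) * cb_one b (Suc l) y - cb_one b l y"

lemma cb_one_step:
  assumes "y \<noteq> 0"
  shows "cb_one b (Suc l) y - y * cb_one b l y = (1 + b * y) * (1 / y) ^ Suc l"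
proof (induction l)
  case 0
  then show ?case using assms by (simp add: field_simps)
next
  case (Suc l)
  have "cb_one b (Suc (Suc l)) y - y * cb_one b (Suc l) y = (1 / y) * (cb_one b (Suc l) y - y * cb_one b l y)"
    using assms by (simp add: field_simps)
  then show ?case using Suc by simp
qed

text \<open>This is the pattern sum for one variable: every \<open>r\<close> has the factor
  \<open>1 + b * y\<close> except \<open>r = 0\<close>, hence the subtracted \<open>b * y\<close>.
  The increment in \<open>l\<close> is given by \<open>cb_one_step\<close>.\<close>

lemma cb_one_sum:
  assumes "y \<noteq> 0"
  shows "(1 + b * y) * (\<Sum>r\<le>l. (1 / y) ^ (2 * r)) - b * y = (1 / y) ^ l * cb_one b l y"
proof (induction l)
  case (Suc l)
  have y: "(1 / y) ^ Suc l * y = (1 / y) ^ l"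
    using assms by simp
  have "(1 / y) ^ Suc l * cb_one b (Suc l) y =
      (1 / y) ^ l * cb_one b l y + (1 / y) ^ Suc l * (cb_one b (Suc l) y - y * cb_one b l y)"
    by (simp only: right_diff_distrib mult.assoc[symmetric] y)
  also have "\<dots> = (1 + b * y) * (\<Sum>r\<le>Suc l. (1 / y) ^ (2 * r)) - b * y"
  proof -
    have *: "(1 + b * y) * (\<Sum>r\<le>Suc l. (1 / y) ^ (2 * r)) =
        (1 + b * y) * (\<Sum>r\<le>l. (1 / y) ^ (2 * r)) + (1 / y) ^ Suc l * ((1 + b * y) * (1 / y) ^ Suc l)"
      unfolding sum.atMost_Suc mult_2 power_add by (simp only: algebra_simps)
    show ?thesis
      unfolding * cb_one_step[OF assms] Suc[symmetric] by simp
  qed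
  finally show ?case by simp
qed simp

text \<open>A Christoffel-Darboux type identity: by the three-term recurrence each summand,
  multiplied by the difference of \<open>x + 1 / x\<close> and \<open>y + 1 / y\<close>,
  telescopes.\<close>

lemma cb_one_divided_difference_aux:
  assumes "y \<noteq> 0"
  shows "(x + 1 / x - (y + 1 / y)) * (\<Sum>k<Suc r. y ^ k * cb_one b k x) =
    y ^ r * (cb_one b (Suc r) x - cb_one b (Suc r) y) - y ^ Suc r * (cb_one b r x - cb_one b r y)"
proof (induction r)
  case (Suc r)
  let ?t = "x + 1 / x" and ?s = "y + 1 / y" and ?W = "\<lambda>l. cb_one b l x - cb_one b l y"
  have "(?t - ?s) * (\<Sum>k<Suc (Suc r). y ^ k * cb_one b k x) =
      y ^ r * ?W (Suc r) - y ^ Suc r * ?W r + y ^ Suc r * ((?t - ?s) * cb_one b (Suc r) x)"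
    by (simp only: sum.lessThan_Suc[of _ "Suc r"] distrib_left Suc) (simp add: algebra_simps)
  also have "(?t - ?s) * cb_one b (Suc r) x = ?W (Suc (Suc r)) + ?W r - ?s * ?W (Suc r)"
    by (simp add: algebra_simps)
  also have "y ^ r * ?W (Suc r) - y ^ Suc r * ?W r +
      y ^ Suc r * (?W (Suc (Suc r)) + ?W r - ?s * ?W (Suc r)) =
      y ^ Suc r * ?W (Suc (Suc r)) - y ^ Suc (Suc r) * ?W (Suc r)"
  proof -
    have "y * ?s = y * y + 1" using assms by (simp add: field_simps)
    then have *: "y ^ Suc r * ?s = y ^ r * (y * y + 1)" by simp
    have "y ^ Suc r * (?s * ?W (Suc r)) = y ^ r * (y * y + 1) * ?W (Suc r)"
      by (simp only: mult.assoc[symmetric] *)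
    then show ?thesis
      by (simp only: right_diff_distrib distrib_left) (simp add: algebra_simps)
  qed
  finally show ?case .
qed (simp add: algebra_simps)

text \<open>The double sum is the matrix entry that arises from summing first over the even row
  \<open>nu\<close> and then over the odd row \<open>rho\<close>. Up to a power of \<open>y\<close>
  it is a divided difference in the variable x + 1/x.\<close>

lemma cb_one_divided_difference:
  assumes "y \<noteq> 0"
  shows "(x + 1 / x - (y + 1 / y)) * (\<Sum>r\<le>l. (1 / y) ^ (2 * r) * (\<Sum>k<r. y ^ k * cb_one b k x)) =
    (1 / y) ^ Suc l * (cb_one b l x - cb_one b l y)"
proof (induction l)
  case (Suc l)
  let ?W = "\<lambda>l. cb_one b l x - cb_one b l y" and ?D = "x + 1 / x - (y + 1 / y)"
  have "?D * (\<Sum>r\<le>Suc l. (1 / y) ^ (2 * r) * (\<Sum>k<r. y ^ k * cb_one b k x)) =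
    (1 / y) ^ Suc l * ?W l + (1 / y) ^ (2 * Suc l) * (?D * (\<Sum>k<Suc l. y ^ k * cb_one b k x))"
    by (simp only: sum.atMost_Suc distrib_left Suc) (simp only: mult_ac)
  also have "\<dots> = (1 / y) ^ Suc l * ?W l +
      (1 / y) ^ (2 * Suc l) * (y ^ l * ?W (Suc l) - y ^ Suc l * ?W l)"
    by (simp only: cb_one_divided_difference_aux[OF assms])
  also have "\<dots> = (1 / y) ^ Suc (Suc l) * ?W (Suc l)"
  proof -
    have "(1 / y) ^ (2 * Suc l) * y ^ l = (1 / y) ^ Suc (Suc l)"
      "(1 / y) ^ (2 * Suc l) * y ^ Suc l = (1 / y) ^ Suc l"
      using assms by (simp_all add: power_divide power_add mult_2 divide_simps)
    then show ?thesis
      by (simp only: right_diff_distrib mult.assoc[symmetric])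
  qed
  finally show ?case .
qed simp

section \<open>The Weyl type formula\<close>

lemma power_sum_list_map_upt: "(y::'a::comm_monoid_mult) ^ sum_list (map g [0..<n]) = (\<Prod>i<n. y ^ g i)"
  by (simp add: power_sum[symmetric] sum_list_distinct_conv_sum_set lessThan_atLeast0)

lemma sum_shift_power:
  fixes y z :: real
  assumes "z * y = 1" and "a \<le> c"
  shows "(\<Sum>r=a..c. y ^ r * f (r + m)) = z ^ m * ((\<Sum>k<c + Suc m. y ^ k * f k) - (\<Sum>k<a + m. y ^ k * f k))"
proof -
  have "(\<Sum>k<c + Suc m. y ^ k * f k) - (\<Sum>k<a + m. y ^ k * f k) = (\<Sum>k=a + m..<c + Suc m. y ^ k * f k)"
    using assms(2) sum.atLeastLessThan_concat[of 0 "a + m" "c + Suc m" "\<lambda>k. y ^ k * f k"]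
    by (simp add: lessThan_atLeast0 algebra_simps)
  also have "\<dots> = (\<Sum>r=a..c. y ^ (r + m) * f (r + m))"
    using sum.shift_bounds_nat_ivl[of "\<lambda>k. y ^ k * f k" a m "Suc c"]
    by (simp add: atLeastLessThanSuc_atLeastAtMost)
  finally have *: "(\<Sum>k<c + Suc m. y ^ k * f k) - (\<Sum>k<a + m. y ^ k * f k) = (\<Sum>r=a..c. y ^ (r + m) * f (r + m))" .
  have **: "z ^ m * (y ^ (r + m) * f (r + m)) = y ^ r * f (r + m)" for r
  proof -
    have "z ^ m * y ^ m = 1" using assms(1) by (simp add: power_mult_distrib[symmetric])
    then have "z ^ m * y ^ m * (y ^ r * f (r + m)) = y ^ r * f (r + m)" by simp
    then show ?thesis by (simp add: power_add mult_ac)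
  qed
  show ?thesis by (simp only: * sum_distrib_left **)
qed

text \<open>After the shift by \<open>n - Suc i\<close> the summation ranges of consecutive rows
  abut, so each entry is a difference of two partial sums belonging to neighbouring rows, and
  \<open>dt_differences\<close> applies.\<close>

lemma even_rows_det:
  fixes b y z :: real and x :: "nat \<Rightarrow> real"
  assumes len: "length rho = Suc n" and dec: "\<And>i. i < n \<Longrightarrow> rho ! Suc i \<le> rho ! i" and zy: "z * y = 1"
  shows "(\<Sum>nu\<in>even_rows rho. y ^ sum_list nu * dt n (\<lambda>i j. cb_one b (nu ! i + (n - Suc i)) (x j))) =
    (\<Prod>i<n. z ^ (n - Suc i)) *
    dt (Suc n) (\<lambda>i j. if j < n then \<Sum>k<rho ! i + (n - i). y ^ k * cb_one b k (x j) else 1)"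
proof -
  let ?F = "\<lambda>i j. \<Sum>k<rho ! i + (n - i). y ^ k * cb_one b k (x j)"
  have "(\<Sum>nu\<in>even_rows rho. y ^ sum_list nu * dt n (\<lambda>i j. cb_one b (nu ! i + (n - Suc i)) (x j))) =
    (\<Sum>g\<in>PiE {..<n} (\<lambda>i. {rho ! Suc i..rho ! i}). (\<Prod>i<n. y ^ g i) *
      dt n (\<lambda>i j. cb_one b (g i + (n - Suc i)) (x j)))"
    unfolding even_rows_conv[OF len] sum_lists_PiE power_sum_list_map_upt
    by (intro sum.cong refl arg_cong2[of _ _ _ _ "(*)"] dt_cong) simp
  also have "\<dots> = dt n (\<lambda>i j. \<Sum>r=rho ! Suc i..rho ! i. y ^ r * cb_one b (r + (n - Suc i)) (x j))"
    by (rule dt_sum_rows) simp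
  also have "\<dots> = dt n (\<lambda>i j. z ^ (n - Suc i) * (?F i j - ?F (Suc i) j))"
  proof (rule dt_cong)
    fix i j assume "i < n"
    then have eq: "n - i = Suc (n - Suc i)" by simp
    show "(\<Sum>r=rho ! Suc i..rho ! i. y ^ r * cb_one b (r + (n - Suc i)) (x j)) =
        z ^ (n - Suc i) * (?F i j - ?F (Suc i) j)"
      unfolding eq by (rule sum_shift_power[OF zy dec[OF \<open>i < n\<close>]])
  qed
  finally show ?thesis
    by (simp only: dt_scale_rows dt_differences[of n ?F])
qed

lemma sum_shift_inverse_power:
  fixes y z :: real
  assumes "z * y = 1" and "a \<le> c"
  shows "(\<Sum>r=a..c. z ^ (2 * r) * f (r + Suc m)) =
    y ^ (2 * Suc m) * ((\<Sum>k\<le>c + Suc m. z ^ (2 * k) * f k) - (\<Sum>k\<le>a + m. z ^ (2 * k) * f k))"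
proof -
  have "y\<^sup>2 * z\<^sup>2 = 1"
    using assms(1) by (simp add: power_mult_distrib[symmetric] mult.commute)
  from sum_shift_power[OF this assms(2), of f "Suc m"] show ?thesis
    by (simp only: power_mult lessThan_Suc_atMost[symmetric] add_Suc_right)
qed

text \<open>The premises on \<open>G 0\<close> say that for a zero odd end the last row vanishes
  outside the last column. The term \<open>b * y\<close>, which is missing exactly when the odd end
  is zero, is therefore a correction of the last column alone, as \<open>dt_telescope\<close>
  requires.\<close>

lemma odd_rows_det:
  fixes b y z :: real and x :: "nat \<Rightarrow> real" and G :: "nat \<Rightarrow> nat \<Rightarrow> real"
  assumes len: "length lam = Suc n" and dec: "\<And>i. i < n \<Longrightarrow> lam ! Suc i \<le> lam ! i" and zy: "z * y = 1"
    and G0: "\<And>j. j < n \<Longrightarrow> G 0 j = 0" "G 0 n = 1"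
  defines "T \<equiv> \<lambda>i j. \<Sum>k\<le>lam ! i + (n - i). z ^ (2 * k) * G k j"
  shows "(\<Sum>rho\<in>odd_rows lam. (if 0 < rho ! n then 1 + b * y else 1) * z ^ (2 * sum_list rho) *
      dt (Suc n) (\<lambda>i j. G (rho ! i + (n - i)) j)) =
    (\<Prod>i<n. y ^ (2 * (n - i))) * dt (Suc n) (\<lambda>i j. if j < n then T i j else (1 + b * y) * T i n - b * y)"
proof -
  define A where "A i = {(if Suc i < Suc n then lam ! Suc i else 0)..lam ! i}" for i
  define w where "w i r = (if i = n \<and> 0 < r then 1 + b * y else 1) * z ^ (2 * r)" for i r
  have prod_w: "(\<Prod>i<Suc n. w i (g i)) = (if 0 < g n then 1 + b * y else 1) * z ^ (2 * sum_list (map g [0..<Suc n]))" for g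
  proof -
    have "(\<Prod>i<Suc n. w i (g i)) = (\<Prod>i<Suc n. if i = n \<and> 0 < g i then 1 + b * y else 1) * (\<Prod>i<Suc n. (z\<^sup>2) ^ g i)"
      by (simp only: w_def prod.distrib power_mult)
    also have "(\<Prod>i<Suc n. if i = n \<and> 0 < g i then 1 + b * y else 1) = (if 0 < g n then 1 + b * y else 1)"
    proof -
      have "(\<Prod>i<n. if i = n \<and> 0 < g i then 1 + b * y else 1) = 1"
        by (rule prod.neutral) auto
      then show ?thesis by simp
    qed
    also have "(\<Prod>i<Suc n. (z\<^sup>2) ^ g i) = z ^ (2 * sum_list (map g [0..<Suc n]))"
      by (simp only: power_sum_list_map_upt[symmetric] power_mult)
    finally show ?thesis .
  qed
  have "(\<Sum>rho\<in>odd_rows lam. (if 0 < rho ! n then 1 + b * y else 1) * z ^ (2 * sum_list rho) *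
      dt (Suc n) (\<lambda>i j. G (rho ! i + (n - i)) j)) =
    (\<Sum>g\<in>PiE {..<Suc n} A. (\<Prod>i<Suc n. w i (g i)) * dt (Suc n) (\<lambda>i j. G (g i + (n - i)) j))"
    unfolding odd_rows_conv[OF len] A_def[symmetric] sum_lists_PiE prod_w
    by (intro sum.cong refl arg_cong2[of _ _ _ _ "(*)"] dt_cong) (simp_all del: upt_Suc)
  also have "\<dots> = dt (Suc n) (\<lambda>i j. \<Sum>r\<in>A i. w i r * G (r + (n - i)) j)"
    by (rule dt_sum_rows) (simp add: A_def)
  also have "\<dots> = dt (Suc n) (\<lambda>i j. y ^ (2 * (n - i)) *
      (if i < n then T i j - T (Suc i) j else (1 + b * y) * T i j - b * y * (if j < n then 0 else 1)))"
  proof (rule dt_cong)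
    fix i j assume ij: "i < Suc n" "j < Suc n"
    show "(\<Sum>r\<in>A i. w i r * G (r + (n - i)) j) = y ^ (2 * (n - i)) *
      (if i < n then T i j - T (Suc i) j else (1 + b * y) * T i j - b * y * (if j < n then 0 else 1))"
    proof (cases "i < n")
      case True
      then have eq: "n - i = Suc (n - Suc i)" by simp
      have "(\<Sum>r\<in>A i. w i r * G (r + (n - i)) j) =
          (\<Sum>r=lam ! Suc i..lam ! i. z ^ (2 * r) * G (r + Suc (n - Suc i)) j)"
        by (intro sum.cong) (use True in \<open>simp_all add: A_def w_def eq\<close>)
      also have "\<dots> = y ^ (2 * (n - i)) * (T i j - T (Suc i) j)"
        unfolding T_def eq by (rule sum_shift_inverse_power[OF zy dec[OF True]])
      finally show ?thesis using True by simp
    next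
      case False
      with ij have i: "i = n" by simp
      have "(\<Sum>r\<in>A n. w n r * G r j) = (\<Sum>r\<le>lam ! n. (1 + b * y) * (z ^ (2 * r) * G r j) - (if r = 0 then b * y * G 0 j else 0))"
        by (intro sum.cong) (auto simp: A_def w_def algebra_simps)
      also have "\<dots> = (1 + b * y) * T n j - b * y * G 0 j"
        by (simp add: sum_subtractf T_def sum_distrib_left)
      finally show ?thesis using G0 ij i by (auto simp: less_Suc_eq)
    qed
  qed
  also have "\<dots> = (\<Prod>i<n. y ^ (2 * (n - i))) * dt (Suc n) (\<lambda>i j. if j < n then T i j else (1 + b * y) * T i n - b * y)"
    unfolding dt_scale_rows dt_telescope by simp
  finally show ?thesis .
qed

text \<open>The sign convention fits decreasing exponents, see
  \<open>dt_vandermonde\<close>.\<close>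

definition vand :: "nat \<Rightarrow> (nat \<Rightarrow> 'a::comm_ring_1) \<Rightarrow> 'a" where
  "vand n t = (\<Prod>i<n. \<Prod>j<i. t j - t i)"

lemma vand_Suc: "vand (Suc n) t = vand n t * (\<Prod>j<n. t j - t n)"
  by (simp add: vand_def)

lemma vand_0 [simp]: "vand 0 t = 1"
  by (simp add: vand_def)

lemma odd_rows_decreasing:
  assumes "rho \<in> odd_rows lam" and "Suc i < length rho"
  shows "rho ! Suc i \<le> rho ! i"
proof -
  have "rho ! Suc i \<le> lam ! Suc i" "lam ! Suc i \<le> rho ! i"
    using assms by (auto simp: odd_rows_def split: if_splits)
  then show ?thesis by simp
qed

lemma even_rows_decreasing:
  assumes "nu \<in> even_rows rho" and "Suc i < length nu"
  shows "nu ! Suc i \<le> nu ! i"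
proof -
  have "nu ! Suc i \<le> rho ! Suc i" "rho ! Suc i \<le> nu ! i"
    using assms by (auto simp: even_rows_def)
  then show ?thesis by simp
qed

lemma powi_split:
  assumes "z * y = (1::real)"
  shows "y powi (int a + int c - 2 * int d) = y ^ a * y ^ c * z ^ (2 * d)"
proof -
  have y: "y \<noteq> 0" using assms by auto
  then have z: "z = 1 / y" using assms by (simp add: eq_divide_eq)
  have "y powi (int a + int c - int (2 * d)) = y ^ a * y ^ c / y ^ (2 * d)"
    using y by (simp add: power_int_diff power_int_add del: of_nat_mult)
  then show ?thesis by (simp add: z power_divide)
qed

text \<open>Written as a product, the formula remains meaningful when values of x + 1/x coincide. In
  the induction step the new Vandermonde factors \<open>t j - t n\<close> are multiplied into the
  columns, where they clear the denominators of the divided differences from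
  \<open>cb_one_divided_difference\<close>.\<close>

theorem cb_det:
  assumes "\<And>j. j < n \<Longrightarrow> x j \<noteq> 0" and "length lam = n" and "\<And>i. Suc i < n \<Longrightarrow> lam ! Suc i \<le> lam ! i"
  shows "cb b x n lam * vand n (\<lambda>j. x j + 1 / x j) = dt n (\<lambda>i j. cb_one b (lam ! i + (n - Suc i)) (x j))"
  using assms
proof (induction n arbitrary: lam)
  case (Suc n)
  define y z where "y = x n" and "z = 1 / y"
  define t where "t = (\<lambda>j. x j + 1 / x j)"
  have y: "y \<noteq> 0" using Suc.prems(1)[of n] by (simp add: y_def)
  have zy: "z * y = 1" using y by (simp add: z_def)
  define P where "P = (\<Prod>j<n. t j - t n)"
  define G where "G = (\<lambda>r j. if j < n then \<Sum>k<r. y ^ k * cb_one b k (x j) else 1)"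
  define T where "T = (\<lambda>i j. \<Sum>k\<le>lam ! i + (n - i). z ^ (2 * k) * G k j)"
  define h where "h = (\<lambda>r::nat. if 0 < r then 1 + b * y else 1)"
  define K where "K = (\<Prod>i<n. z ^ (n - Suc i))"
  have "cb b x (Suc n) lam * vand (Suc n) t =
      y ^ sum_list lam * P * (\<Sum>rho\<in>odd_rows lam. h (rho ! n) * z ^ (2 * sum_list rho) *
        (\<Sum>nu\<in>even_rows rho. y ^ sum_list nu * (cb b x n nu * vand n t)))"
    unfolding cb.simps y_def[symmetric] powi_split[OF zy] vand_Suc P_def[symmetric] h_def
    by (simp add: sum_distrib_left sum_distrib_right mult_ac)
  also have "(\<Sum>rho\<in>odd_rows lam. h (rho ! n) * z ^ (2 * sum_list rho) *
        (\<Sum>nu\<in>even_rows rho. y ^ sum_list nu * (cb b x n nu * vand n t))) =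
      (\<Sum>rho\<in>odd_rows lam. h (rho ! n) * z ^ (2 * sum_list rho) *
        (K * dt (Suc n) (\<lambda>i j. G (rho ! i + (n - i)) j)))"
  proof (intro sum.cong refl arg_cong2[of _ _ _ _ "(*)"])
    fix rho assume rho: "rho \<in> odd_rows lam"
    then have len: "length rho = Suc n" using Suc.prems by (simp add: odd_rows_def)
    have "(\<Sum>nu\<in>even_rows rho. y ^ sum_list nu * (cb b x n nu * vand n t)) =
       (\<Sum>nu\<in>even_rows rho. y ^ sum_list nu * dt n (\<lambda>i j. cb_one b (nu ! i + (n - Suc i)) (x j)))"
    proof (intro sum.cong refl arg_cong2[of _ _ _ _ "(*)"])
      fix nu assume nu: "nu \<in> even_rows rho"
      then have "length nu = n" using len by (simp add: even_rows_def)
      then show "cb b x n nu * vand n t = dt n (\<lambda>i j. cb_one b (nu ! i + (n - Suc i)) (x j))"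
        unfolding t_def using even_rows_decreasing[OF nu] Suc.prems(1) by (intro Suc.IH) auto
    qed
    also have "\<dots> = K * dt (Suc n) (\<lambda>i j. G (rho ! i + (n - i)) j)"
      unfolding K_def G_def using odd_rows_decreasing[OF rho] len zy by (intro even_rows_det) auto
    finally show "(\<Sum>nu\<in>even_rows rho. y ^ sum_list nu * (cb b x n nu * vand n t)) = \<dots>" .
  qed
  also have "\<dots> = K * (\<Sum>rho\<in>odd_rows lam. h (rho ! n) * z ^ (2 * sum_list rho) *
        dt (Suc n) (\<lambda>i j. G (rho ! i + (n - i)) j))"
    by (simp add: sum_distrib_left mult_ac)
  also have "\<dots> = K * ((\<Prod>i<n. y ^ (2 * (n - i))) *
      dt (Suc n) (\<lambda>i j. if j < n then T i j else (1 + b * y) * T i n - b * y))"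
    unfolding h_def T_def by (subst odd_rows_det[OF _ _ zy]) (use Suc.prems in \<open>auto simp: G_def\<close>)
  finally have *: "cb b x (Suc n) lam * vand (Suc n) t =
    K * (\<Prod>i<n. y ^ (2 * (n - i))) * (y ^ sum_list lam * P *
      dt (Suc n) (\<lambda>i j. if j < n then T i j else (1 + b * y) * T i n - b * y))"
    by (simp add: mult_ac)
  \<comment> \<open>The power of \<open>y\<close> is distributed over the rows and \<open>P\<close>
    over the first \<open>n\<close> columns.\<close>
  have "y ^ sum_list lam * P * dt (Suc n) (\<lambda>i j. if j < n then T i j else (1 + b * y) * T i n - b * y) =
    dt (Suc n) (\<lambda>i j. (if j < n then t j - t n else 1) *
      (y ^ (lam ! i) * (if j < n then T i j else (1 + b * y) * T i n - b * y)))"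
  proof -
    have "y ^ sum_list lam = (\<Prod>i<Suc n. y ^ (lam ! i))"
      using power_sum_list_map_upt[of y "\<lambda>i. lam ! i" "Suc n"] Suc.prems(2) map_nth[of lam] by (simp del: upt_Suc)
    moreover have "P = (\<Prod>j<Suc n. if j < n then t j - t n else 1)"
      by (simp add: P_def)
    ultimately show ?thesis
      by (simp only: dt_scale_rows dt_scale_columns mult_ac)
  qed
  \<comment> \<open>Each of the first \<open>n\<close> columns is now a character column minus the
    last column, and adding the last column back leaves the determinant of the characters.\<close>
  also have "\<dots> = dt (Suc n) (\<lambda>i j. z ^ (n - i) * ((if j < n then z else 1) *
      (if j < n then cb_one b (lam ! i + (n - i)) (x j) + (- 1) * cb_one b (lam ! i + (n - i)) y
       else cb_one b (lam ! i + (n - i)) y)))"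
  proof (rule dt_cong)
    fix i j assume ij: "i < Suc n" "j < Suc n"
    let ?l = "lam ! i + (n - i)"
    have yz: "y ^ (lam ! i) * z ^ ?l = z ^ (n - i)"
    proof -
      have "y ^ (lam ! i) * z ^ (lam ! i) = 1" using zy by (simp add: power_mult_distrib[symmetric] mult.commute)
      then show ?thesis by (simp add: power_add mult.assoc[symmetric])
    qed
    show "(if j < n then t j - t n else 1) * (y ^ (lam ! i) * (if j < n then T i j else (1 + b * y) * T i n - b * y)) =
      z ^ (n - i) * ((if j < n then z else 1) *
        (if j < n then cb_one b ?l (x j) + (- 1) * cb_one b ?l y else cb_one b ?l y))"
    proof (cases "j < n")
      case True
      have "(t j - t n) * T i j = z ^ Suc ?l * (cb_one b ?l (x j) - cb_one b ?l y)"
        using cb_one_divided_difference[OF y, of "x j" b ?l] True by (simp add: T_def G_def t_def z_def y_def)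
      then have "(t j - t n) * (y ^ (lam ! i) * T i j) =
          (y ^ (lam ! i) * z ^ ?l) * z * (cb_one b ?l (x j) - cb_one b ?l y)"
        by (simp add: mult_ac)
      with True show ?thesis by (simp add: yz mult_ac)
    next
      case False
      have "(1 + b * y) * T i n - b * y = z ^ ?l * cb_one b ?l y"
        using cb_one_sum[OF y, of b ?l] by (simp add: T_def G_def z_def)
      then have "y ^ (lam ! i) * ((1 + b * y) * T i n - b * y) = (y ^ (lam ! i) * z ^ ?l) * cb_one b ?l y"
        by (simp only: mult.assoc)
      with False show ?thesis by (simp add: yz)
    qed
  qed
  also have "\<dots> = (\<Prod>i<n. z ^ (n - i)) * (z ^ n * dt (Suc n) (\<lambda>i j.
      if j < n then cb_one b (lam ! i + (n - i)) (x j) else cb_one b (lam ! i + (n - i)) y))"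
    unfolding dt_scale_rows dt_scale_columns dt_add_last_column by simp
  also have "dt (Suc n) (\<lambda>i j. if j < n then cb_one b (lam ! i + (n - i)) (x j) else cb_one b (lam ! i + (n - i)) y) =
     dt (Suc n) (\<lambda>i j. cb_one b (lam ! i + (Suc n - Suc i)) (x j))"
    by (rule dt_cong) (auto simp: y_def less_Suc_eq)
  finally have **: "y ^ sum_list lam * P * dt (Suc n) (\<lambda>i j. if j < n then T i j else (1 + b * y) * T i n - b * y) =
    (\<Prod>i<n. z ^ (n - i)) * (z ^ n * dt (Suc n) (\<lambda>i j. cb_one b (lam ! i + (Suc n - Suc i)) (x j)))" .
  \<comment> \<open>All powers pulled out of rows and columns cancel. With m = n - Suc i, row
    \<open>i\<close> contributes z^m y^(2(m + 1)) z^(m + 1) z, which has as many factors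
    \<open>z\<close> as \<open>y\<close>.\<close>
  have "K * (\<Prod>i<n. y ^ (2 * (n - i))) * ((\<Prod>i<n. z ^ (n - i)) * z ^ n) = 1"
  proof -
    have "K * (\<Prod>i<n. y ^ (2 * (n - i))) * ((\<Prod>i<n. z ^ (n - i)) * z ^ n) =
        (\<Prod>i<n. z ^ (n - Suc i) * y ^ (2 * (n - i)) * z ^ (n - i) * z)"
      by (simp add: K_def prod.distrib)
    also have "\<dots> = 1"
    proof (rule prod.neutral, rule ballI)
      fix i assume "i \<in> {..<n}"
      then obtain m where "n - i = Suc m" by (metis Suc_diff_Suc lessThan_iff)
      then have m: "n - i = Suc m" "n - Suc i = m" by auto
      have "z ^ m * y ^ (2 * Suc m) * z ^ Suc m * z = (z * y) ^ (2 * Suc m)"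
      proof -
        have "z ^ m * y ^ (2 * Suc m) * z ^ Suc m * z = (z ^ m * z ^ Suc m * z) * y ^ (2 * Suc m)"
          by (simp only: mult_ac)
        also have "z ^ m * z ^ Suc m * z = z ^ (2 * Suc m)" by (simp add: mult_2 power_add)
        finally show ?thesis by (simp only: power_mult_distrib)
      qed
      then show "z ^ (n - Suc i) * y ^ (2 * (n - i)) * z ^ (n - i) * z = 1"
        by (simp only: m zy power_one)
    qed
    finally show ?thesis .
  qed
  then show ?case unfolding t_def[symmetric] * ** by (simp add: mult.assoc[symmetric])
qed simp

section \<open>Symmetry and rectangular shapes\<close>

lemma dt_vandermonde: "dt n (\<lambda>i j. x j ^ (n - Suc i)) = vand n x"
proof (induction n)
  case (Suc n)
  have "dt (Suc n) (\<lambda>i j. x j ^ (n - i)) =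
      dt (Suc n) (\<lambda>i j. if i < n then x j ^ (n - i) - x n * x j ^ (n - Suc i) else x j ^ (n - i))"
    by (rule dt_row_differences[symmetric])
  also have "\<dots> = dt (Suc n) (\<lambda>i j. if i < n then (x j - x n) * x j ^ (n - Suc i) else 1)"
  proof (rule dt_cong)
    fix i j assume "i < Suc n"
    show "(if i < n then x j ^ (n - i) - x n * x j ^ (n - Suc i) else x j ^ (n - i)) =
        (if i < n then (x j - x n) * x j ^ (n - Suc i) else 1)"
    proof (cases "i < n")
      case True
      then have "n - i = Suc (n - Suc i)" by simp
      then have "x j ^ (n - i) = x j * x j ^ (n - Suc i)" by (simp only: power_Suc)
      then show ?thesis using True by (simp add: algebra_simps)
    qed (use \<open>i < Suc n\<close> in simp)
  qed
  also have "\<dots> = dt n (\<lambda>i j. (x j - x n) * x j ^ (n - Suc i))"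
    by (subst dt_last_column) (simp_all cong: dt_cong)
  finally show ?case by (simp add: dt_scale_columns Suc vand_Suc mult.commute)
qed simp

lemma vand_nonzero:
  fixes t :: "nat \<Rightarrow> 'a::idom"
  assumes "inj_on t {..<n}"
  shows "vand n t \<noteq> 0"
  using assms by (auto simp: vand_def inj_on_def)

lemma plus_inverse_eq_iff:
  fixes u v :: real
  assumes "0 < u" "u < 1" "0 < v" "v < 1"
  shows "u + 1 / u = v + 1 / v \<longleftrightarrow> u = v"
proof
  assume "u + 1 / u = v + 1 / v"
  then have "(u - v) * (1 - u * v) = 0" using assms by (simp add: field_simps)
  moreover have "u * v < 1 * 1" using assms by (intro mult_strict_mono) auto
  ultimately show "u = v" by simp
qed simp

lemma inj_on_plus_inverse:
  fixes x :: "nat \<Rightarrow> real"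
  assumes "inj_on x S" "\<And>j. j \<in> S \<Longrightarrow> 0 < x j \<and> x j < 1"
  shows "inj_on (\<lambda>j. x j + 1 / x j) S"
  using assms plus_inverse_eq_iff unfolding inj_on_def by metis

section \<open>Reduction to distinct variables by continuity\<close>

lemma tendsto_cb:
  assumes "\<And>j. j < n \<Longrightarrow> ((\<lambda>e. X e j) \<longlongrightarrow> x j) F" and "\<And>j. j < n \<Longrightarrow> 0 < x j"
  shows "((\<lambda>e. cb b (X e) n lam) \<longlongrightarrow> cb b x n lam) F"
  using assms
proof (induction n arbitrary: lam)
  case (Suc n)
  have *: "((\<lambda>e. if 0 < (r::nat) then 1 + b * X e n else 1) \<longlongrightarrow> (if 0 < r then 1 + b * x n else 1)) F" for r
    using Suc.prems(1)[of n] by (auto intro!: tendsto_intros)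
  show ?case unfolding cb.simps
  proof (intro tendsto_sum tendsto_mult * tendsto_power_int)
    show "((\<lambda>e. X e n) \<longlongrightarrow> x n) F" "x n \<noteq> 0"
      using Suc.prems(1)[of n] Suc.prems(2)[of n] by auto
    show "((\<lambda>e. cb b (X e) n nu) \<longlongrightarrow> cb b x n nu) F" for nu
      using Suc.prems by (intro Suc.IH) auto
  qed
qed simp

text \<open>Different variables move with different speeds: equal values separate for every
  \<open>e > 0\<close>, while distinct values stay apart and the open bounds stay valid for small
  \<open>e\<close>.\<close>

lemma eventually_perturbation_generic:
  fixes x :: "nat \<Rightarrow> real"
  assumes "finite S" "\<And>j. j \<in> S \<Longrightarrow> 0 < x j \<and> x j < 1"
  shows "\<forall>\<^sub>F e in at_right 0. inj_on (\<lambda>j. x j - e * real j) S \<and>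
    (\<forall>j\<in>S. 0 < x j - e * real j \<and> x j - e * real j < 1)"
proof -
  have lim: "((\<lambda>e. x j - e * real j) \<longlongrightarrow> x j) (at_right 0)" for j
    by (auto intro!: tendsto_eq_intros)
  have "\<forall>\<^sub>F e in at_right 0. x i - e * real i \<noteq> x j - e * real j" if "i \<noteq> j" for i j
  proof (cases "x i = x j")
    case True
    show ?thesis
      using eventually_at_right_less[of "0::real"] by eventually_elim (use True that in auto)
  next
    case False
    have "((\<lambda>e. (x i - e * real i) - (x j - e * real j)) \<longlongrightarrow> x i - x j) (at_right 0)"
      by (intro tendsto_diff lim)
    from tendsto_imp_eventually_ne[OF this, of 0] False show ?thesis
      by (auto elim: eventually_mono)
  qed
  then have "\<forall>\<^sub>F e in at_right 0. \<forall>i\<in>S. \<forall>j\<in>S - {i}. x i - e * real i \<noteq> x j - e * real j"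
    using assms(1) by (intro eventually_ball_finite ballI) auto
  moreover have "\<forall>\<^sub>F e in at_right 0. \<forall>j\<in>S. 0 < x j - e * real j \<and> x j - e * real j < 1"
  proof (intro eventually_ball_finite[OF assms(1)] ballI eventually_conj)
    fix j assume "j \<in> S"
    then show "\<forall>\<^sub>F e in at_right 0. 0 < x j - e * real j" "\<forall>\<^sub>F e in at_right 0. x j - e * real j < 1"
      using assms(2) order_tendstoD[OF lim[of j]] by blast+
  qed
  ultimately show ?thesis
    by eventually_elim (auto simp: inj_on_def)
qed

text \<open>The premises on \<open>f\<close> and \<open>g\<close> express continuity at \<open>x\<close>, which reduces the identity to distinct arguments.\<close>

lemma generic_eqI:
  fixes f g :: "(nat \<Rightarrow> real) \<Rightarrow> real"
  assumes "finite S" "\<And>j. j \<in> S \<Longrightarrow> 0 < x j \<and> x j < 1"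
    and f: "\<And>X. (\<And>j. ((\<lambda>e. X e j) \<longlongrightarrow> x j) (at_right (0::real))) \<Longrightarrow> ((\<lambda>e. f (X e)) \<longlongrightarrow> f x) (at_right 0)"
    and g: "\<And>X. (\<And>j. ((\<lambda>e. X e j) \<longlongrightarrow> x j) (at_right (0::real))) \<Longrightarrow> ((\<lambda>e. g (X e)) \<longlongrightarrow> g x) (at_right 0)"
    and eq: "\<And>y. inj_on y S \<Longrightarrow> (\<And>j. j \<in> S \<Longrightarrow> 0 < y j \<and> y j < 1) \<Longrightarrow> f y = g y"
  shows "f x = g x"
proof -
  let ?X = "\<lambda>e j. x j - e * real j"
  have lim: "((\<lambda>e. ?X e j) \<longlongrightarrow> x j) (at_right 0)" for j
    by (auto intro!: tendsto_eq_intros)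
  have "\<forall>\<^sub>F e in at_right 0. f (?X e) = g (?X e)"
  proof (rule eventually_mono)
    show "\<forall>\<^sub>F e in at_right 0. inj_on (?X e) S \<and> (\<forall>j\<in>S. 0 < ?X e j \<and> ?X e j < 1)"
      using assms(1,2) by (rule eventually_perturbation_generic)
  qed (intro eq, auto)
  then have G: "((\<lambda>e. f (?X e)) \<longlongrightarrow> g x) (at_right 0)"
    using g[of ?X] lim by (simp add: tendsto_cong)
  have F: "((\<lambda>e. f (?X e)) \<longlongrightarrow> f x) (at_right 0)"
    using f[of ?X] lim by simp
  show ?thesis
    by (rule tendsto_unique[OF trivial_limit_at_right_real F G])
qed

lemma cb_zero: "cb b x n (replicate n 0) = 1"
proof (induction n)
  case (Suc n)
  have zero: "xs = replicate m 0" if "length xs = m" "\<And>i. i < m \<Longrightarrow> xs ! i \<le> 0" for xs :: "nat list" and m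
  proof (rule nth_equalityI)
    fix i assume "i < length xs"
    then show "xs ! i = replicate m 0 ! i" using that(2)[of i] that(1) by simp
  qed (use that in simp)
  have odd: "odd_rows (replicate (Suc n) 0) = {replicate (Suc n) 0}"
    by (auto simp: odd_rows_def simp del: replicate_Suc intro!: zero)
  have even: "even_rows (replicate (Suc n) 0) = {replicate n 0}"
    by (auto simp: even_rows_def simp del: replicate_Suc intro!: zero)
  show ?case
    unfolding cb.simps odd by (simp add: even Suc sum_list_replicate del: replicate_Suc)
qed simp

text \<open>The recursion singles out an order of the variables, but in the Weyl type formula a
  permutation of them only produces a sign in the numerator and the same sign in the denominator.
  The sign of the denominator is read off from the zero shape, for which \<open>cb_zero\<close>
  makes the numerator equal to it.\<close>

theorem cb_symmetric:
  assumes p: "p permutes {..<n}" and x: "\<And>j. j < n \<Longrightarrow> 0 < x j \<and> x j < 1"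
    and lam: "length lam = n" "\<And>i. Suc i < n \<Longrightarrow> lam ! Suc i \<le> lam ! i"
  shows "cb b (x \<circ> p) n lam = cb b x n lam"
proof (rule generic_eqI[where S = "{..<n}" and x = x and f = "\<lambda>x. cb b (x \<circ> p) n lam" and g = "\<lambda>x. cb b x n lam"])
  have pn: "p j < n" if "j < n" for j
    using permutes_in_image[OF p, of j] that by simp
  show "((\<lambda>e. cb b (X e \<circ> p) n lam) \<longlongrightarrow> cb b (x \<circ> p) n lam) (at_right 0)"
    if "\<And>j. ((\<lambda>e. X e j) \<longlongrightarrow> x j) (at_right 0)" for X
    using that x pn by (intro tendsto_cb) auto
  show "((\<lambda>e. cb b (X e) n lam) \<longlongrightarrow> cb b x n lam) (at_right 0)"
    if "\<And>j. ((\<lambda>e. X e j) \<longlongrightarrow> x j) (at_right 0)" for X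
    using that x by (intro tendsto_cb) auto
  show "cb b (y \<circ> p) n lam = cb b y n lam"
    if "inj_on y {..<n}" and y: "\<And>j. j \<in> {..<n} \<Longrightarrow> 0 < y j \<and> y j < 1" for y
  proof -
    have p0: "p permutes {0..<n}" using p by (simp add: lessThan_atLeast0)
    let ?d = "\<lambda>y lam. dt n (\<lambda>i j. cb_one b (lam ! i + (n - Suc i)) (y j))"
    let ?v = "\<lambda>y. vand n (\<lambda>j. y j + 1 / y j)"
    have perm: "?d (y \<circ> p) mu = of_int (sign p) * ?d y mu" for mu
      using dt_permute_columns[OF p0, of "\<lambda>i j. cb_one b (mu ! i + (n - Suc i)) (y j)"] by simp
    have nz: "y j \<noteq> 0" "(y \<circ> p) j \<noteq> 0" if "j < n" for j
      using y that pn[OF that] by fastforce+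
    have "?v y \<noteq> 0"
      using that by (intro vand_nonzero inj_on_plus_inverse) auto
    moreover have v: "?v z = ?d z (replicate n 0)" if "\<And>j. j < n \<Longrightarrow> z j \<noteq> 0" for z
      using cb_det[of n z "replicate n 0" b] that by (simp add: cb_zero)
    moreover have "cb b (y \<circ> p) n lam * ?v (y \<circ> p) = of_int (sign p) * (cb b y n lam * ?v y)"
      using cb_det[of n "y \<circ> p" lam b] cb_det[of n y lam b] lam nz perm by simp
    moreover have "?v (y \<circ> p) = of_int (sign p) * ?v y"
      using v[of y] v[of "y \<circ> p"] nz perm by simp
    moreover have "of_int (sign p) \<noteq> (0::real)"
      by (simp add: sign_def)
    ultimately show ?thesis by simp
  qed
qed (use x in auto)

section \<open>Rectangular characters as sums over sign changes\<close>

lemma dt_column_expansion: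
  "dt n (\<lambda>i j. a j * f i j + c j * g i j) =
    (\<Sum>E\<in>Pow {..<n}. (\<Prod>j\<in>E. a j) * (\<Prod>j\<in>{..<n} - E. c j) * dt n (\<lambda>i j. if j \<in> E then f i j else g i j))"
proof -
  have split: "(\<Prod>j\<in>E. a j) * (\<Prod>j\<in>{..<n} - E. c j) * (\<Prod>j<n. if j \<in> E then f (p j) j else g (p j) j) =
      (\<Prod>j\<in>E. a j * f (p j) j) * (\<Prod>j\<in>{..<n} - E. c j * g (p j) j)" if "E \<in> Pow {..<n}" for E p
  proof -
    have fin: "finite E" using that finite_subset by auto
    have "(\<Prod>j<n. if j \<in> E then f (p j) j else g (p j) j) =
        (\<Prod>j\<in>E. if j \<in> E then f (p j) j else g (p j) j) * (\<Prod>j\<in>{..<n} - E. if j \<in> E then f (p j) j else g (p j) j)"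
      using that by (subst prod.subset_diff[of E]) (auto simp: mult.commute)
    then show ?thesis by (simp add: prod.distrib mult_ac)
  qed
  have "dt n (\<lambda>i j. a j * f i j + c j * g i j) = dt n (\<lambda>j i. a j * f i j + c j * g i j)"
    by (rule dt_transpose[symmetric])
  also have "\<dots> = (\<Sum>p | p permutes {0..<n}. of_int (sign p) * (\<Sum>E\<in>Pow {..<n}.
      (\<Prod>j\<in>E. a j * f (p j) j) * (\<Prod>j\<in>{..<n} - E. c j * g (p j) j)))"
    by (simp add: dt_leibniz prod_add)
  also have "\<dots> = (\<Sum>E\<in>Pow {..<n}. (\<Prod>j\<in>E. a j) * (\<Prod>j\<in>{..<n} - E. c j) *
      dt n (\<lambda>j i. if j \<in> E then f i j else g i j))"
    unfolding dt_leibniz sum_distrib_left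
    by (subst sum.swap, intro sum.cong refl) (simp add: split[symmetric] mult_ac)
  also have "\<dots> = (\<Sum>E\<in>Pow {..<n}. (\<Prod>j\<in>E. a j) * (\<Prod>j\<in>{..<n} - E. c j) *
      dt n (\<lambda>i j. if j \<in> E then f i j else g i j))"
    by (intro sum.cong refl arg_cong2[of _ _ _ _ "(*)"] dt_transpose)
  finally show ?thesis .
qed

text \<open>Weyl character formula in one variable: the powers of x and of 1/x both solve the
  recurrence of \<open>cb_one\<close>.\<close>

lemma cb_one_closed:
  assumes "x \<noteq> 0"
  shows "(x - 1 / x) * cb_one b l x = (x ^ Suc l + b * x ^ l) - ((1 / x) ^ Suc l + b * (1 / x) ^ l)"
proof (induction l rule: induct_nat_012)
  case 1
  then show ?case using assms by (simp add: field_simps)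
next
  case (ge2 l)
  have "(x + 1 / x) * x ^ Suc k = x ^ Suc (Suc k) + (x * (1 / x)) * x ^ k"
    "(x + 1 / x) * (1 / x) ^ Suc k = (1 / x) ^ Suc (Suc k) + (x * (1 / x)) * (1 / x) ^ k" for k
    by (simp_all only: power_Suc algebra_simps)
  then have xz: "(x + 1 / x) * x ^ Suc k = x ^ Suc (Suc k) + x ^ k"
    "(x + 1 / x) * (1 / x) ^ Suc k = (1 / x) ^ Suc (Suc k) + (1 / x) ^ k" for k
    using assms by simp_all
  have "(x - 1 / x) * cb_one b (Suc (Suc l)) x =
      (x + 1 / x) * ((x - 1 / x) * cb_one b (Suc l) x) - (x - 1 / x) * cb_one b l x"
    by (simp only: cb_one.simps algebra_simps)
  also have "\<dots> = ((x + 1 / x) * x ^ Suc (Suc l) + b * ((x + 1 / x) * x ^ Suc l)) -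
      ((x + 1 / x) * (1 / x) ^ Suc (Suc l) + b * ((x + 1 / x) * (1 / x) ^ Suc l)) -
      ((x ^ Suc l + b * x ^ l) - ((1 / x) ^ Suc l + b * (1 / x) ^ l))"
    unfolding ge2 by (simp only: algebra_simps)
  also have "\<dots> = (x ^ Suc (Suc (Suc l)) + b * x ^ Suc (Suc l)) - ((1 / x) ^ Suc (Suc (Suc l)) + b * (1 / x) ^ Suc (Suc l))"
    unfolding xz by (simp only: algebra_simps)
  finally show ?case .
qed simp

text \<open>
  The character of the rectangle \<open>u\<^sup>n\<close> as a sum over the sign changes in the Weyl group; \<open>E\<close> is the
  set of variables that are not inverted, and \<open>m = 2u\<close>.
\<close>

definition sgnvar :: "nat set \<Rightarrow> (nat \<Rightarrow> real) \<Rightarrow> nat \<Rightarrow> real" where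
  "sgnvar E x i = (if i \<in> E then x i else 1 / x i)"

definition rect_term :: "real \<Rightarrow> nat \<Rightarrow> (nat \<Rightarrow> real) \<Rightarrow> nat set \<Rightarrow> nat set \<Rightarrow> real" where
  "rect_term b m x V E = (\<Prod>i\<in>E. x i ^ m * (1 + b / x i) / (1 - 1 / (x i)\<^sup>2)) *
     (\<Prod>i\<in>V - E. (1 + b * x i) / (1 - (x i)\<^sup>2)) *
     (\<Prod>i\<in>V. \<Prod>j\<in>{j\<in>V. j < i}. 1 / (1 - 1 / (sgnvar E x j * sgnvar E x i)))"

definition rect_char :: "real \<Rightarrow> nat \<Rightarrow> (nat \<Rightarrow> real) \<Rightarrow> nat set \<Rightarrow> real" where
  "rect_char b m x V = (\<Sum>E\<in>Pow V. rect_term b m x V E)"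

lemma sgnvar_product_neq_1:
  assumes "inj_on x V" "\<And>j. j \<in> V \<Longrightarrow> 0 < x j \<and> x j < 1" "i \<in> V" "j \<in> V" "i \<noteq> j"
  shows "sgnvar E x i * sgnvar E x j \<noteq> 1"
proof -
  have "0 < x i" "x i < 1" "0 < x j" "x j < 1" using assms(2)[OF assms(3)] assms(2)[OF assms(4)] by auto
  then have "x i * x j < 1" "x i \<noteq> 0" "x j \<noteq> 0" using mult_strict_mono[of "x i" 1 "x j" 1] by auto
  moreover have "x i \<noteq> x j" using inj_onD[OF assms(1) _ assms(3,4)] assms(5) by blast
  ultimately show ?thesis by (auto simp: sgnvar_def field_simps)
qed

text \<open>Relates the Vandermonde product in the values x + 1/x, which is the same for all sign
  changes, to the one in the signed variables. The quotient consists of the pair factors of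
  \<open>rect_term\<close>.\<close>

lemma diff_plus_inverse:
  fixes p q :: real
  assumes "p \<noteq> 0" "q \<noteq> 0" "q * p \<noteq> 1"
  shows "(q + 1 / q - (p + 1 / p)) / (1 - 1 / (q * p)) = q - p"
proof -
  have "q + 1 / q - (p + 1 / p) = (q - p) * (1 - 1 / (q * p))"
    using assms by (simp add: field_simps)
  moreover have "1 - 1 / (q * p) \<noteq> 0" using assms by (simp add: field_simps)
  ultimately show ?thesis by simp
qed

text \<open>The closed form makes each column a combination of a column of powers of x and one of
  powers of 1/x. For a rectangle the exponents are those of a Vandermonde matrix up to a factor of
  the column, so choosing one summand in every column gives Vandermonde determinants in signed
  variables.\<close>

theorem cb_rectangle:
  assumes inj: "inj_on x {..<n}" and x: "\<And>j. j < n \<Longrightarrow> 0 < x j \<and> x j < 1"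
  shows "(\<Prod>j<n. x j ^ u) * cb b x n (replicate n u) = rect_char b (2 * u) x {..<n}"
proof -
  define t where "t = (\<lambda>j. x j + 1 / x j)"
  define \<alpha> where "\<alpha> = (\<lambda>j. x j ^ Suc u + b * x j ^ u)"
  define \<gamma> where "\<gamma> = (\<lambda>j. - ((1 / x j) ^ Suc u + b * (1 / x j) ^ u))"
  have x0: "x j \<noteq> 0" "x j - 1 / x j \<noteq> 0" if "j < n" for j
  proof -
    show "x j \<noteq> 0" using x[OF that] by simp
    have "x j * x j < 1" using x[OF that] mult_strict_mono[of "x j" 1 "x j" 1] by simp
    then show "x j - 1 / x j \<noteq> 0" using x[OF that] by (auto simp: field_simps)
  qed
  have v: "vand n t \<noteq> 0"
    unfolding t_def using inj x by (intro vand_nonzero inj_on_plus_inverse) auto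
  have vs: "vand n (sgnvar E x) = vand n t * (\<Prod>i<n. \<Prod>j<i. 1 / (1 - 1 / (sgnvar E x j * sgnvar E x i)))" for E
  proof -
    have "sgnvar E x j - sgnvar E x i = (t j - t i) * (1 / (1 - 1 / (sgnvar E x j * sgnvar E x i)))"
      if "i < n" "j < i" for i j
    proof -
      have s: "sgnvar E x j * sgnvar E x i \<noteq> 1"
        using that x by (intro sgnvar_product_neq_1[OF inj]) auto
      have tt: "t k = sgnvar E x k + 1 / sgnvar E x k" "sgnvar E x k \<noteq> 0" if "k < n" for k
        using x0[OF that] by (auto simp: t_def sgnvar_def)
      show ?thesis
        using s tt[of i] tt[of j] that by (simp add: diff_plus_inverse)
    qed
    then show ?thesis by (simp add: vand_def prod.distrib[symmetric])
  qed
  have "(\<Prod>j<n. x j - 1 / x j) * (cb b x n (replicate n u) * vand n t) =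
      dt n (\<lambda>i j. (x j - 1 / x j) * cb_one b (u + (n - Suc i)) (x j))"
    unfolding t_def using cb_det[of n x "replicate n u" b] x0(1) by (simp add: dt_scale_columns cong: dt_cong)
  also have "\<dots> = dt n (\<lambda>i j. \<alpha> j * x j ^ (n - Suc i) + \<gamma> j * (1 / x j) ^ (n - Suc i))"
  proof (rule dt_cong)
    fix i j assume "j < n"
    show "(x j - 1 / x j) * cb_one b (u + (n - Suc i)) (x j) =
        \<alpha> j * x j ^ (n - Suc i) + \<gamma> j * (1 / x j) ^ (n - Suc i)"
      unfolding cb_one_closed[OF x0(1)[OF \<open>j < n\<close>]] \<alpha>_def \<gamma>_def
      by (simp only: power_add power_Suc algebra_simps mult_minus_left mult_minus_right minus_add_distrib)
  qed
  also have "\<dots> = (\<Sum>E\<in>Pow {..<n}. (\<Prod>j\<in>E. \<alpha> j) * (\<Prod>j\<in>{..<n} - E. \<gamma> j) * vand n (sgnvar E x))"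
    unfolding dt_column_expansion dt_vandermonde[symmetric] sgnvar_def
    by (intro sum.cong refl arg_cong2[of _ _ _ _ "(*)"] dt_cong) auto
  also have "\<dots> = vand n t * (\<Sum>E\<in>Pow {..<n}. (\<Prod>j\<in>E. \<alpha> j) * (\<Prod>j\<in>{..<n} - E. \<gamma> j) *
      (\<Prod>i<n. \<Prod>j<i. 1 / (1 - 1 / (sgnvar E x j * sgnvar E x i))))"
    unfolding vs by (simp add: sum_distrib_left mult_ac)
  finally have char: "(\<Prod>j<n. x j - 1 / x j) * cb b x n (replicate n u) =
      (\<Sum>E\<in>Pow {..<n}. (\<Prod>j\<in>E. \<alpha> j) * (\<Prod>j\<in>{..<n} - E. \<gamma> j) *
      (\<Prod>i<n. \<Prod>j<i. 1 / (1 - 1 / (sgnvar E x j * sgnvar E x i))))"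
    using v by simp
  \<comment> \<open>The prefactor x^u raises the exponent \<open>u\<close> of the uninverted
    variables to \<open>2 * u\<close> and cancels the exponent of the inverted ones. The Weyl
    denominators x - 1/x are common to all sets \<open>E\<close>.\<close>
  have factor: "(\<Prod>j\<in>E. \<alpha> j) * (\<Prod>j\<in>{..<n} - E. \<gamma> j) * (\<Prod>j<n. x j ^ u) =
     (\<Prod>j<n. x j - 1 / x j) * ((\<Prod>i\<in>E. x i ^ (2 * u) * (1 + b / x i) / (1 - 1 / (x i)\<^sup>2)) *
     (\<Prod>i\<in>{..<n} - E. (1 + b * x i) / (1 - (x i)\<^sup>2)))" if "E \<in> Pow {..<n}" for E
  proof -
    have sub: "E \<subseteq> {..<n}" using that by auto
    have split: "(\<Prod>j<n. h j) = (\<Prod>j\<in>E. h j) * (\<Prod>j\<in>{..<n} - E. h j)" for h :: "nat \<Rightarrow> real"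
      using prod.subset_diff[OF sub, of h] by (simp add: mult.commute)
    have 1: "\<alpha> j * x j ^ u = (x j - 1 / x j) * (x j ^ (2 * u) * (1 + b / x j) / (1 - 1 / (x j)\<^sup>2))" if "j < n" for j
    proof -
      have *: "1 - 1 / (x j)\<^sup>2 = (x j - 1 / x j) / x j" using x0(1)[OF that] by (simp add: field_simps power2_eq_square)
      have "\<alpha> j * x j ^ u = x j ^ (2 * u) * (1 + b / x j) * x j"
        using x0(1)[OF that] unfolding \<alpha>_def mult_2 power_add by (simp add: field_simps)
      then show ?thesis unfolding * using x0[OF that] by simp
    qed
    have 2: "\<gamma> j * x j ^ u = (x j - 1 / x j) * ((1 + b * x j) / (1 - (x j)\<^sup>2))" if "j < n" for j
    proof -
      have "(1 / x j) ^ u * x j ^ u = 1"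
        using x0(1)[OF that] by (simp flip: power_mult_distrib)
      moreover have "\<gamma> j * x j ^ u = - ((1 / x j) * ((1 / x j) ^ u * x j ^ u) + b * ((1 / x j) ^ u * x j ^ u))"
        unfolding \<gamma>_def power_Suc mult_minus_left by (simp only: distrib_left distrib_right mult_ac)
      ultimately have g: "\<gamma> j * x j ^ u = - (1 / x j + b)" by simp
      have sq: "1 - (x j)\<^sup>2 = - (x j - 1 / x j) * x j"
        using x0(1)[OF that] by (simp add: field_simps power2_eq_square)
      have d: "d * ((1 + b * y) / (- d * y)) = - (1 / y + b)" if "d \<noteq> 0" "y \<noteq> 0" for d y :: real
        using that by (simp add: field_simps)
      show ?thesis
        unfolding g sq by (rule d[OF x0(2)[OF that] x0(1)[OF that], symmetric])
    qed
    have "(\<Prod>j\<in>E. \<alpha> j) * (\<Prod>j\<in>{..<n} - E. \<gamma> j) * (\<Prod>j<n. x j ^ u) =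
        (\<Prod>j\<in>E. \<alpha> j * x j ^ u) * (\<Prod>j\<in>{..<n} - E. \<gamma> j * x j ^ u)"
      by (simp add: split prod.distrib mult_ac)
    also have "\<dots> = (\<Prod>j\<in>E. (x j - 1 / x j) * (x j ^ (2 * u) * (1 + b / x j) / (1 - 1 / (x j)\<^sup>2))) *
        (\<Prod>j\<in>{..<n} - E. (x j - 1 / x j) * ((1 + b * x j) / (1 - (x j)\<^sup>2)))"
      using sub by (intro arg_cong2[of _ _ _ _ "(*)"] prod.cong refl 1 2) auto
    finally show ?thesis by (simp only: split prod.distrib mult_ac)
  qed
  have "(\<Prod>j<n. x j - 1 / x j) * ((\<Prod>j<n. x j ^ u) * cb b x n (replicate n u)) =
      (\<Prod>j<n. x j ^ u) * ((\<Prod>j<n. x j - 1 / x j) * cb b x n (replicate n u))"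
    by (rule mult.left_commute)
  also have "\<dots> = (\<Sum>E\<in>Pow {..<n}. ((\<Prod>j\<in>E. \<alpha> j) * (\<Prod>j\<in>{..<n} - E. \<gamma> j) * (\<Prod>j<n. x j ^ u)) *
      (\<Prod>i<n. \<Prod>j<i. 1 / (1 - 1 / (sgnvar E x j * sgnvar E x i))))"
    unfolding char sum_distrib_left by (intro sum.cong refl) (simp only: mult_ac)
  also have "\<dots> = (\<Prod>j<n. x j - 1 / x j) * rect_char b (2 * u) x {..<n}"
  proof -
    have *: "(\<Prod>i<n. \<Prod>j\<in>{j \<in> {..<n}. j < i}. h i j) = (\<Prod>i<n. \<Prod>j<i. h i j)" for h :: "nat \<Rightarrow> nat \<Rightarrow> real"
      by (intro prod.cong) auto
    show ?thesis
      unfolding rect_char_def rect_term_def sum_distrib_left *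
      by (rule sum.cong[OF refl], subst factor, assumption) (rule mult.assoc)
  qed
  finally have "(\<Prod>j<n. x j - 1 / x j) * ((\<Prod>j<n. x j ^ u) * cb b x n (replicate n u)) =
      (\<Prod>j<n. x j - 1 / x j) * rect_char b (2 * u) x {..<n}" .
  moreover have "(\<Prod>j<n. x j - 1 / x j) \<noteq> 0"
    using x0 by simp
  ultimately show ?thesis by simp
qed

section \<open>Subset sums for rectangular shapes\<close>

text \<open>
  Both sides are polynomials in \<open>a\<close> of degree less than \<open>card E\<close>, because the leading terms on the left
  cancel, and they agree at the points \<open>a = - b / y k\<close>.
\<close>

lemma partial_fraction_identity:
  fixes y :: "'i \<Rightarrow> real"
  assumes fin: "finite E" and inj: "inj_on y E" and nz: "\<And>i. i \<in> E \<Longrightarrow> y i \<noteq> 0"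
  shows "(\<Prod>i\<in>E. b + a * y i) - (\<Prod>i\<in>E. y i * (a + b * y i)) =
    b * (\<Sum>j\<in>E. (1 - (y j)\<^sup>2) * (\<Prod>i\<in>E - {j}. (b + a * y i) * (y i * (1 - y i * y j) / (y i - y j))))"
proof (cases "b = 0")
  \<comment> \<open>The interpolation points \<open>- b / y k\<close> are distinct only for nonzero
    \<open>b\<close>. For \<open>b = 0\<close> both products on the left agree.\<close>
  case True
  then show ?thesis by (simp add: mult.commute)
next
  case False
  define c where "c j = (1 - (y j)\<^sup>2) * (\<Prod>i\<in>E - {j}. y i * (1 - y i * y j) / (y i - y j))" for j
  define p where "p = (\<Prod>i\<in>E. [:b, y i:]) - (\<Prod>i\<in>E. [:b * (y i)\<^sup>2, y i:]) -
    Polynomial.smult b (\<Sum>j\<in>E. Polynomial.smult (c j) (\<Prod>i\<in>E - {j}. [:b, y i:]))"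
  have eval: "poly p t = (\<Prod>i\<in>E. b + t * y i) - (\<Prod>i\<in>E. y i * (t + b * y i)) -
      b * (\<Sum>j\<in>E. (1 - (y j)\<^sup>2) * (\<Prod>i\<in>E - {j}. (b + t * y i) * (y i * (1 - y i * y j) / (y i - y j))))" for t
  proof -
    have "c j * (\<Prod>i\<in>E - {j}. b + t * y i) =
        (1 - (y j)\<^sup>2) * (\<Prod>i\<in>E - {j}. (b + t * y i) * (y i * (1 - y i * y j) / (y i - y j)))" for j
      unfolding c_def prod.distrib by (simp only: mult_ac)
    moreover have "b * (y i)\<^sup>2 + t * y i = y i * (t + b * y i)" for i
      by (simp add: algebra_simps power2_eq_square)
    ultimately show ?thesis by (simp add: p_def poly_prod poly_sum)
  qed
  have root: "poly p (- b / y k) = 0" if k: "k \<in> E" for k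
  proof -
    have yk: "y k \<noteq> 0" by (rule nz[OF k])
    have zero: "(\<Prod>i\<in>A. (b + - b / y k * y i) * f i) = 0" if "k \<in> A" "A \<subseteq> E" for A f
    proof (rule prod_zero)
      show "finite A" using fin that finite_subset by blast
      show "\<exists>i\<in>A. (b + - b / y k * y i) * f i = 0" using that yk by (intro bexI[of _ k]) auto
    qed
    have "(\<Sum>j\<in>E. (1 - (y j)\<^sup>2) * (\<Prod>i\<in>E - {j}. (b + - b / y k * y i) * (y i * (1 - y i * y j) / (y i - y j)))) =
        (\<Sum>j\<in>{k}. (1 - (y j)\<^sup>2) * (\<Prod>i\<in>E - {j}. (b + - b / y k * y i) * (y i * (1 - y i * y j) / (y i - y j))))"
    proof (rule sum.mono_neutral_right)
      show "\<forall>j\<in>E - {k}. (1 - (y j)\<^sup>2) * (\<Prod>i\<in>E - {j}. (b + - b / y k * y i) * (y i * (1 - y i * y j) / (y i - y j))) = 0"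
      proof
        fix j assume "j \<in> E - {k}"
        then have "k \<in> E - {j}" using k by auto
        then show "(1 - (y j)\<^sup>2) * (\<Prod>i\<in>E - {j}. (b + - b / y k * y i) * (y i * (1 - y i * y j) / (y i - y j))) = 0"
          by (subst zero) auto
      qed
    qed (use fin k in auto)
    also have "\<dots> = (1 - (y k)\<^sup>2) * (\<Prod>i\<in>E - {k}. (b + - b / y k * y i) * (y i * (1 - y i * y k) / (y i - y k)))"
      by simp
    also have "(\<Prod>i\<in>E - {k}. (b + - b / y k * y i) * (y i * (1 - y i * y k) / (y i - y k))) =
        (\<Prod>i\<in>E - {k}. y i * (- b / y k + b * y i))"
    \<comment> \<open>At the point \<open>- b / y k\<close>, the factor b + a y_i is a multiple of
      y_i - y_k, and a + b y_i is the same multiple of 1 - y_i y_k. This cancels the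
      denominator.\<close>
    proof (rule prod.cong)
      fix i assume "i \<in> E - {k}"
      then have "y i - y k \<noteq> 0" using inj k by (auto simp: inj_on_def)
      moreover have "b + - b / y k * y i = - (b / y k) * (y i - y k)"
        using yk by (simp add: field_simps)
      moreover have "- b / y k + b * y i = - (b / y k) * (1 - y i * y k)"
        using yk by (simp add: field_simps)
      ultimately show "(b + - b / y k * y i) * (y i * (1 - y i * y k) / (y i - y k)) = y i * (- b / y k + b * y i)"
        by simp
    qed simp
    also have "b * ((1 - (y k)\<^sup>2) * \<dots>) = - (y k * (- b / y k + b * y k)) * (\<Prod>i\<in>E - {k}. y i * (- b / y k + b * y i))"
    proof -
      have "b * (1 - (y k)\<^sup>2) = - (y k * (- b / y k + b * y k))"
        using yk by (simp add: field_simps power2_eq_square)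
      then show ?thesis by (simp only: mult.assoc[symmetric])
    qed
    also have "\<dots> = - (\<Prod>i\<in>E. y i * (- b / y k + b * y i))"
      using prod.remove[OF fin k, of "\<lambda>i. y i * (- b / y k + b * y i)"] by simp
    finally show ?thesis
      using zero[of E "\<lambda>_. 1"] k unfolding eval by simp
  qed
  have deg: "Polynomial.degree (\<Prod>i\<in>A. [:f i, y i:]) = card A" "Polynomial.coeff (\<Prod>i\<in>A. [:f i, y i:]) (card A) = (\<Prod>i\<in>A. y i)"
    if "A \<subseteq> E" for A f
  proof -
    have yA: "i \<in> A \<Longrightarrow> y i \<noteq> 0" for i using that nz by auto
    show d: "Polynomial.degree (\<Prod>i\<in>A. [:f i, y i:]) = card A"
      using yA by (subst degree_prod_eq_sum_degree) auto
    show "Polynomial.coeff (\<Prod>i\<in>A. [:f i, y i:]) (card A) = (\<Prod>i\<in>A. y i)"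
      using lead_coeff_prod[of "\<lambda>i. [:f i, y i:]" A] yA unfolding d by simp
  qed
  have "p = 0"
  proof (rule ccontr)
    assume p: "p \<noteq> 0"
    have le: "Polynomial.degree (\<Prod>i\<in>E - {j}. [:b, y i:]) \<le> card E" for j
      using deg(1)[of "E - {j}" "\<lambda>_. b"] fin by (auto intro: card_mono)
    have "Polynomial.degree p \<le> card E"
      unfolding p_def using deg(1)[of E] le
      by (intro degree_diff_le order.trans[OF degree_smult_le] degree_sum_le fin) auto
    moreover have "Polynomial.coeff p (card E) = 0"
    proof -
      have "Polynomial.coeff (\<Prod>i\<in>E - {j}. [:b, y i:]) (card E) = 0" if "j \<in> E" for j
        using deg(1)[of "E - {j}" "\<lambda>_. b"] card_Diff1_less[OF fin that] by (intro coeff_eq_0) simp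
      then show ?thesis
        using deg(2)[of E] by (simp add: p_def coeff_sum)
    qed
    ultimately have "Polynomial.degree p < card E"
      using p le_neq_trans[of "Polynomial.degree p" "card E"] leading_coeff_0_iff[of p] by fastforce
    moreover have "card ((\<lambda>k. - b / y k) ` E) = card E"
    proof (rule card_image, rule inj_onI)
      fix k l assume kl: "k \<in> E" "l \<in> E" and "- b / y k = - b / y l"
      then have "y k = y l" using False nz[OF kl(1)] nz[OF kl(2)] by (simp add: field_simps)
      then show "k = l" using inj kl by (auto simp: inj_on_def)
    qed
    moreover have "card ((\<lambda>k. - b / y k) ` E) \<le> card {t. poly p t = 0}"
      using root p by (intro card_mono poly_roots_finite) auto
    moreover have "card {t. poly p t = 0} \<le> Polynomial.degree p"
      using p by (rule card_poly_roots_bound)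
    ultimately show False by linarith
  qed
  then have "poly p a = 0" by simp
  then show ?thesis unfolding eval by simp
qed

section \<open>Removing one variable from the sum over sign changes\<close>

lemma prod_pairs_remove:
  fixes h :: "nat \<Rightarrow> nat \<Rightarrow> 'a::comm_monoid_mult"
  assumes fin: "finite V" and k: "k \<in> V" and sym: "\<And>i j. h i j = h j i"
  shows "(\<Prod>i\<in>V. \<Prod>j\<in>{j\<in>V. j < i}. h i j) =
    (\<Prod>i\<in>V - {k}. \<Prod>j\<in>{j\<in>V - {k}. j < i}. h i j) * (\<Prod>i\<in>V - {k}. h i k)"
proof -
  have 1: "(\<Prod>j\<in>{j\<in>V. j < i}. h i j) = (if k < i then h i k else 1) * (\<Prod>j\<in>{j\<in>V - {k}. j < i}. h i j)" for i
  proof (cases "k < i")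
    case True
    then have "{j\<in>V. j < i} = insert k {j\<in>V - {k}. j < i}" using k by auto
    then show ?thesis using fin True by simp
  next
    case False
    then have "{j\<in>V. j < i} = {j\<in>V - {k}. j < i}" by auto
    then show ?thesis using False by simp
  qed
  have 2: "{j\<in>V. j < k} = {j\<in>V - {k}. j < k}" by auto
  have "(\<Prod>i\<in>V. \<Prod>j\<in>{j\<in>V. j < i}. h i j) =
      (\<Prod>j\<in>{j\<in>V - {k}. j < k}. h k j) * (\<Prod>i\<in>V - {k}. \<Prod>j\<in>{j\<in>V. j < i}. h i j)"
    unfolding prod.remove[OF fin k] 2 ..
  also have "(\<Prod>j\<in>{j\<in>V - {k}. j < k}. h k j) = (\<Prod>i\<in>V - {k}. if i < k then h i k else 1)"
    using fin by (simp only: prod.inter_filter[OF finite_Diff] sym[of k])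
  also have "(\<Prod>i\<in>V - {k}. \<Prod>j\<in>{j\<in>V. j < i}. h i j) =
      (\<Prod>i\<in>V - {k}. if k < i then h i k else 1) * (\<Prod>i\<in>V - {k}. \<Prod>j\<in>{j\<in>V - {k}. j < i}. h i j)"
    unfolding 1 prod.distrib ..
  also have "(\<Prod>i\<in>V - {k}. if i < k then h i k else 1) * \<dots> =
      (\<Prod>i\<in>V - {k}. (if i < k then h i k else 1) * (if k < i then h i k else 1)) *
      (\<Prod>i\<in>V - {k}. \<Prod>j\<in>{j\<in>V - {k}. j < i}. h i j)"
    by (simp only: prod.distrib mult.assoc)
  also have "(\<Prod>i\<in>V - {k}. (if i < k then h i k else 1) * (if k < i then h i k else 1)) = (\<Prod>i\<in>V - {k}. h i k)"
    by (rule prod.cong) auto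
  finally show ?thesis by (simp only: mult.commute)
qed

text \<open>An index \<open>j\<close> with a set avoiding it is the same as a set with a marked
  element. This regroups the terms with one variable removed by the subset \<open>E\<close> for
  which the partial fraction identity is used.\<close>

lemma sum_Pow_remove:
  assumes "finite V"
  shows "(\<Sum>j\<in>V. \<Sum>F\<in>Pow (V - {j}). g j F) = (\<Sum>E\<in>Pow V. \<Sum>j\<in>E. g j (E - {j}))"
proof -
  have fE: "finite E" if "E \<in> Pow V" for E using that assms finite_subset by auto
  have "(\<Sum>j\<in>V. \<Sum>F\<in>Pow (V - {j}). g j F) = (\<Sum>(j, F)\<in>Sigma V (\<lambda>j. Pow (V - {j})). g j F)"
    using assms by (subst sum.Sigma) auto
  also have "\<dots> = (\<Sum>(E, j)\<in>Sigma (Pow V) (\<lambda>E. E). g j (E - {j}))"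
    by (rule sum.reindex_bij_witness[of _ "\<lambda>(E, j). (j, E - {j})" "\<lambda>(j, F). (insert j F, j)"]) (auto simp: insert_absorb intro!: arg_cong[of _ _ "g _"])
  also have "\<dots> = (\<Sum>E\<in>Pow V. \<Sum>j\<in>E. g j (E - {j}))"
    using assms fE by (subst sum.Sigma) auto
  finally show ?thesis .
qed

text \<open>Isolates the dependence on \<open>b\<close>, so that the removal of a variable can be
  computed at \<open>b = 0\<close>.\<close>

lemma rect_term_factor:
  "rect_term b m x V E = rect_term 0 m x V E * ((\<Prod>i\<in>E. 1 + b / x i) * (\<Prod>i\<in>V - E. 1 + b * x i))"
proof -
  have "(\<Prod>i\<in>E. x i ^ m * (1 + b / x i) / (1 - 1 / (x i)\<^sup>2)) =
      (\<Prod>i\<in>E. x i ^ m * (1 + 0 / x i) / (1 - 1 / (x i)\<^sup>2)) * (\<Prod>i\<in>E. 1 + b / x i)"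
    by (simp add: prod.distrib[symmetric])
  moreover have "(\<Prod>i\<in>V - E. (1 + b * x i) / (1 - (x i)\<^sup>2)) =
      (\<Prod>i\<in>V - E. (1 + 0 * x i) / (1 - (x i)\<^sup>2)) * (\<Prod>i\<in>V - E. 1 + b * x i)"
    by (simp add: prod.distrib[symmetric])
  ultimately show ?thesis unfolding rect_term_def by (simp only: mult_ac)
qed

text \<open>The quotient on the left is the coefficient that Laplace expansion of an alternant
  produces, and the factor on the right is a summand of \<open>partial_fraction_identity\<close> at
  1/x. They match because the pair factors involving \<open>k\<close> account for the
  difference.\<close>

lemma rect_term_remove:
  assumes fin: "finite V" and E: "E \<subseteq> V" and k: "k \<in> E"
    and inj: "inj_on x V" and x: "\<And>j. j \<in> V \<Longrightarrow> 0 < x j \<and> x j < 1"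
  shows "x k ^ (m + card (V - {k})) / (\<Prod>i\<in>V - {k}. x k - x i) * rect_term 0 m x (V - {k}) (E - {k}) =
    rect_term 0 m x V E * ((1 - (1 / x k)\<^sup>2) *
      (\<Prod>i\<in>E - {k}. 1 / x i * (1 - 1 / x i * (1 / x k)) / (1 / x i - 1 / x k)))"
proof -
  have kV: "k \<in> V" using E k by auto
  have finE: "finite E" using fin E finite_subset by blast
  have pos: "0 < x i" "x i < 1" "x i \<noteq> 0" if "i \<in> V" for i using x[OF that] by auto
  define h where "h i j = 1 / (1 - 1 / (sgnvar E x j * sgnvar E x i))" for i j
  define P where "P = (\<Prod>i\<in>V - {k}. \<Prod>j\<in>{j\<in>V - {k}. j < i}. h i j)"
  define A where "A = (\<Prod>i\<in>E - {k}. x i ^ m * (1 + 0 / x i) / (1 - 1 / (x i)\<^sup>2))"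
  define C where "C = (\<Prod>i\<in>V - E. (1 + 0 * x i) / (1 - (x i)\<^sup>2))"
  define g where "g i = 1 / x i * (1 - 1 / x i * (1 / x k)) / (1 / x i - 1 / x k)" for i
  have "(\<Prod>i\<in>V - {k}. \<Prod>j\<in>{j\<in>V - {k}. j < i}. 1 / (1 - 1 / (sgnvar (E - {k}) x j * sgnvar (E - {k}) x i))) = P"
    unfolding P_def h_def by (intro prod.cong refl) (auto simp: sgnvar_def)
  moreover have "V - {k} - (E - {k}) = V - E" using k by auto
  ultimately have L: "rect_term 0 m x (V - {k}) (E - {k}) = A * C * P"
    unfolding rect_term_def A_def C_def by simp
  have "(\<Prod>i\<in>V. \<Prod>j\<in>{j\<in>V. j < i}. h i j) = P * (\<Prod>i\<in>V - {k}. h i k)"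
    unfolding P_def by (rule prod_pairs_remove[OF fin kV]) (simp add: h_def mult.commute)
  then have R: "rect_term 0 m x V E = (x k ^ m / (1 - 1 / (x k)\<^sup>2) * A) * C * (P * (\<Prod>i\<in>V - {k}. h i k))"
    unfolding rect_term_def h_def[symmetric] prod.remove[OF finE k] A_def C_def by simp
  \<comment> \<open>For \<open>i\<close> outside \<open>E\<close> the pair factor of
    \<open>i\<close> and \<open>k\<close> already equals x_k / (x_k - x_i). For \<open>i\<close> in
    \<open>E\<close> it becomes so after multiplication with the fraction
    \<open>g i\<close>.\<close>
  have ratio: "(\<Prod>i\<in>V - {k}. h i k) * (\<Prod>i\<in>E - {k}. g i) = x k ^ card (V - {k}) / (\<Prod>i\<in>V - {k}. x k - x i)"
  proof -
    have "(\<Prod>i\<in>E - {k}. g i) = (\<Prod>i\<in>V - {k}. if i \<in> E then g i else 1)"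
      using fin E by (intro prod.mono_neutral_cong_left) auto
    then have "(\<Prod>i\<in>V - {k}. h i k) * (\<Prod>i\<in>E - {k}. g i) = (\<Prod>i\<in>V - {k}. h i k * (if i \<in> E then g i else 1))"
      by (simp add: prod.distrib)
    also have "\<dots> = (\<Prod>i\<in>V - {k}. x k / (x k - x i))"
    proof (rule prod.cong)
      fix i assume i: "i \<in> V - {k}"
      have nz: "x i \<noteq> 0" "x k \<noteq> 0" "x k - x i \<noteq> 0" "x i * x k \<noteq> 1"
      proof -
        show "x i \<noteq> 0" "x k \<noteq> 0" using pos i kV by auto
        show "x k - x i \<noteq> 0" using inj i kV by (auto simp: inj_on_def)
        show "x i * x k \<noteq> 1" using mult_strict_mono[of "x i" 1 "x k" 1] pos[of i] pos[of k] i kV by auto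
      qed
      show "h i k * (if i \<in> E then g i else 1) = x k / (x k - x i)"
      proof (cases "i \<in> E")
        case True
        have "1 - 1 / (x i * x k) \<noteq> 0" using nz by (simp add: field_simps)
        moreover have "1 / x i - 1 / x k = (x k - x i) / (x i * x k)" using nz by (simp add: field_simps)
        ultimately show ?thesis using True k nz by (simp add: h_def g_def sgnvar_def mult.commute)
      next
        case False
        have "1 - 1 / (x k * (1 / x i)) = (x k - x i) / x k" using nz by (simp add: field_simps)
        then show ?thesis using False k by (simp add: h_def sgnvar_def)
      qed
    qed simp
    also have "\<dots> = x k ^ card (V - {k}) / (\<Prod>i\<in>V - {k}. x k - x i)"
      by (simp add: prod_dividef)
    finally show ?thesis .
  qed
  have nz1: "1 - 1 / (x k)\<^sup>2 \<noteq> 0"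
    using pos[OF kV] mult_strict_mono[of "x k" 1 "x k" 1] by (auto simp: field_simps power2_eq_square)
  have "rect_term 0 m x V E * ((1 - (1 / x k)\<^sup>2) * (\<Prod>i\<in>E - {k}. g i)) =
      (1 - 1 / (x k)\<^sup>2) * (x k ^ m / (1 - 1 / (x k)\<^sup>2)) * A * C * P * ((\<Prod>i\<in>V - {k}. h i k) * (\<Prod>i\<in>E - {k}. g i))"
    unfolding R power_one_over by (simp only: mult_ac)
  also have "\<dots> = x k ^ (m + card (V - {k})) / (\<Prod>i\<in>V - {k}. x k - x i) * (A * C * P)"
    unfolding ratio using nz1 by (simp add: power_add)
  finally show ?thesis unfolding L g_def ..
qed

context
  fixes V :: "nat set" and x :: "nat \<Rightarrow> real"
  assumes fin: "finite V" and inj: "inj_on x V" and x: "\<And>j. j \<in> V \<Longrightarrow> 0 < x j \<and> x j < 1"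
begin

text \<open>For each \<open>E\<close> this is \<open>partial_fraction_identity\<close> at y = 1/x
  with parameters a = b and 1. Its first product restores the term of \<open>E\<close>. The second
  lowers the exponent by two, since y (b + y) = (1 + b x) / x^2.\<close>

lemma rect_char_even:
  assumes m: "m = Suc (Suc l)"
  shows "rect_char b m x V = (\<Prod>i\<in>V. 1 + b * x i) * rect_char 0 l x V +
    (\<Sum>j\<in>V. x j ^ (m + card (V - {j})) / (\<Prod>i\<in>V - {j}. x j - x i) * rect_char b m x (V - {j}))"
proof -
  define c where "c j = x j ^ (m + card (V - {j})) / (\<Prod>i\<in>V - {j}. x j - x i)" for j
  have "rect_term b m x V E = (\<Prod>i\<in>V. 1 + b * x i) * rect_term 0 l x V E +
      (\<Sum>j\<in>E. c j * rect_term b m x (V - {j}) (E - {j}))" if "E \<in> Pow V" for E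
  proof -
    have E: "E \<subseteq> V" using that by simp
    have finE: "finite E" using fin E finite_subset by blast
    have nz: "x i \<noteq> 0" if "i \<in> E" for i using x[of i] E that by auto
    define y where "y i = 1 / x i" for i
    define Q where "Q = rect_term 0 m x V E"
    define K where "K = (\<Prod>i\<in>V - E. 1 + b * x i)"
    have "c j * rect_term b m x (V - {j}) (E - {j}) = Q * K *
        ((1 - (y j)\<^sup>2) * (\<Prod>i\<in>E - {j}. (1 + b * y i) * (y i * (1 - y i * y j) / (y i - y j))))"
      if j: "j \<in> E" for j
    proof -
      have "V - {j} - (E - {j}) = V - E" using j by auto
      then have "c j * rect_term b m x (V - {j}) (E - {j}) =
          (c j * rect_term 0 m x (V - {j}) (E - {j})) * ((\<Prod>i\<in>E - {j}. 1 + b * y i) * K)"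
        unfolding rect_term_factor[of b m x "V - {j}"] K_def y_def by simp
      also have "c j * rect_term 0 m x (V - {j}) (E - {j}) =
          Q * ((1 - (y j)\<^sup>2) * (\<Prod>i\<in>E - {j}. y i * (1 - y i * y j) / (y i - y j)))"
        unfolding c_def Q_def y_def by (rule rect_term_remove[OF fin E j inj x])
      finally show ?thesis unfolding prod.distrib by (simp only: mult_ac)
    qed
    then have "(\<Sum>j\<in>E. c j * rect_term b m x (V - {j}) (E - {j})) = Q * K *
        (1 * (\<Sum>j\<in>E. (1 - (y j)\<^sup>2) * (\<Prod>i\<in>E - {j}. (1 + b * y i) * (y i * (1 - y i * y j) / (y i - y j)))))"
      by (simp add: sum_distrib_left)
    also have "\<dots> = Q * K * ((\<Prod>i\<in>E. 1 + b * y i) - (\<Prod>i\<in>E. y i * (b + 1 * y i)))"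
    proof (subst partial_fraction_identity[OF finE])
      show "inj_on y E" using inj_on_subset[OF inj E] unfolding y_def inj_on_def by simp
    qed (use nz in \<open>auto simp: y_def\<close>)
    finally have S: "(\<Sum>j\<in>E. c j * rect_term b m x (V - {j}) (E - {j})) =
        Q * K * (\<Prod>i\<in>E. 1 + b * y i) - Q * K * (\<Prod>i\<in>E. y i * (b + 1 * y i))"
      by (simp only: right_diff_distrib)
    have "Q * K * (\<Prod>i\<in>E. 1 + b * y i) = rect_term b m x V E"
      unfolding rect_term_factor[of b m] Q_def K_def y_def by (simp add: mult_ac)
    moreover have "Q * K * (\<Prod>i\<in>E. y i * (b + 1 * y i)) = (\<Prod>i\<in>V. 1 + b * x i) * rect_term 0 l x V E"
    proof -
      have "(\<Prod>i\<in>V. 1 + b * x i) = K * (\<Prod>i\<in>E. 1 + b * x i)"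
        unfolding K_def using prod.subset_diff[OF E fin] by simp
      moreover have "Q = rect_term 0 l x V E * (\<Prod>i\<in>E. (x i)\<^sup>2)"
      proof -
        have "(\<Prod>i\<in>E. x i ^ m * (1 + 0 / x i) / (1 - 1 / (x i)\<^sup>2)) =
           (\<Prod>i\<in>E. x i ^ l * (1 + 0 / x i) / (1 - 1 / (x i)\<^sup>2)) * (\<Prod>i\<in>E. (x i)\<^sup>2)"
          unfolding prod.distrib[symmetric] m by (simp add: power2_eq_square mult_ac)
        then show ?thesis unfolding Q_def rect_term_def by (simp only: mult_ac)
      qed
      moreover have "(\<Prod>i\<in>E. (x i)\<^sup>2) * (\<Prod>i\<in>E. y i * (b + 1 * y i)) = (\<Prod>i\<in>E. 1 + b * x i)"
        unfolding prod.distrib[symmetric] using nz by (intro prod.cong) (auto simp: y_def field_simps power2_eq_square)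
      ultimately show ?thesis by (simp add: mult_ac)
    qed
    ultimately show ?thesis unfolding S by simp
  qed
  then have "rect_char b m x V = (\<Prod>i\<in>V. 1 + b * x i) * rect_char 0 l x V +
      (\<Sum>E\<in>Pow V. \<Sum>j\<in>E. c j * rect_term b m x (V - {j}) (E - {j}))"
    by (simp add: rect_char_def sum.distrib sum_distrib_left)
  also have "(\<Sum>E\<in>Pow V. \<Sum>j\<in>E. c j * rect_term b m x (V - {j}) (E - {j})) =
      (\<Sum>j\<in>V. c j * rect_char b m x (V - {j}))"
    using sum_Pow_remove[OF fin, of "\<lambda>j F. c j * rect_term b m x (V - {j}) F"]
    by (simp add: rect_char_def sum_distrib_left)
  finally show ?thesis unfolding c_def .
qed

text \<open>The instance with the parameters exchanged, a = 1 and constant \<open>b\<close>.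
  Multiplied by the product of the x in \<open>E\<close>, its two products become \<Prod>(1 + b x)
  and \<Prod>(1 + b / x), which belong to the two characters.\<close>

lemma rect_char_odd:
  "(\<Prod>i\<in>V. 1 + b * x i) * rect_char 0 m x V = rect_char b m x V +
    b * (\<Sum>j\<in>V. x j ^ (Suc m + card (V - {j})) / (\<Prod>i\<in>V - {j}. x j - x i) *
      ((\<Prod>i\<in>V - {j}. 1 + b * x i) * rect_char 0 m x (V - {j})))"
proof -
  define c where "c j = x j ^ (Suc m + card (V - {j})) / (\<Prod>i\<in>V - {j}. x j - x i)" for j
  have "(\<Prod>i\<in>V. 1 + b * x i) * rect_term 0 m x V E = rect_term b m x V E +
      b * (\<Sum>j\<in>E. c j * ((\<Prod>i\<in>V - {j}. 1 + b * x i) * rect_term 0 m x (V - {j}) (E - {j})))" if "E \<in> Pow V" for E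
  proof -
    have E: "E \<subseteq> V" using that by simp
    have finE: "finite E" using fin E finite_subset by blast
    have nz: "x i \<noteq> 0" if "i \<in> E" for i using x[of i] E that by auto
    define y where "y i = 1 / x i" for i
    define Q where "Q = rect_term 0 m x V E"
    define K where "K = (\<Prod>i\<in>V - E. 1 + b * x i)"
    define X where "X = (\<Prod>i\<in>E. x i)"
    have "c j * ((\<Prod>i\<in>V - {j}. 1 + b * x i) * rect_term 0 m x (V - {j}) (E - {j})) = Q * K * X *
        ((1 - (y j)\<^sup>2) * (\<Prod>i\<in>E - {j}. (b + 1 * y i) * (y i * (1 - y i * y j) / (y i - y j))))"
      if j: "j \<in> E" for j
    proof -
      have jV: "j \<in> V" using E j by auto
      have sub: "V - {j} - (E - {j}) = V - E" "E - {j} \<subseteq> V - {j}" using j E by auto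
      have "c j * rect_term 0 m x (V - {j}) (E - {j}) = x j * (x j ^ (m + card (V - {j})) / (\<Prod>i\<in>V - {j}. x j - x i) *
          rect_term 0 m x (V - {j}) (E - {j}))"
        by (simp add: c_def)
      also have "\<dots> = x j * (Q * ((1 - (y j)\<^sup>2) * (\<Prod>i\<in>E - {j}. y i * (1 - y i * y j) / (y i - y j))))"
        unfolding Q_def y_def by (rule arg_cong[of _ _ "(*) (x j)"], rule rect_term_remove[OF fin E j inj x])
      finally have 1: "c j * rect_term 0 m x (V - {j}) (E - {j}) = \<dots>" .
      have "(\<Prod>i\<in>V - {j}. 1 + b * x i) = K * (\<Prod>i\<in>E - {j}. 1 + b * x i)"
        unfolding K_def using prod.subset_diff[OF sub(2), of "\<lambda>i. 1 + b * x i"] fin by (simp add: sub(1))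
      also have "(\<Prod>i\<in>E - {j}. 1 + b * x i) = (\<Prod>i\<in>E - {j}. x i) * (\<Prod>i\<in>E - {j}. b + 1 * y i)"
        unfolding prod.distrib[symmetric] using nz by (intro prod.cong) (auto simp: y_def field_simps)
      finally have 2: "(\<Prod>i\<in>V - {j}. 1 + b * x i) = K * ((\<Prod>i\<in>E - {j}. x i) * (\<Prod>i\<in>E - {j}. b + 1 * y i))" .
      have 3: "X = x j * (\<Prod>i\<in>E - {j}. x i)"
        unfolding X_def by (rule prod.remove[OF finE j])
      have "c j * ((\<Prod>i\<in>V - {j}. 1 + b * x i) * rect_term 0 m x (V - {j}) (E - {j})) =
          (c j * rect_term 0 m x (V - {j}) (E - {j})) * (\<Prod>i\<in>V - {j}. 1 + b * x i)"
        by (simp only: mult_ac)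
      then show ?thesis unfolding 1 2 3 prod.distrib by (simp only: mult_ac)
    qed
    then have "b * (\<Sum>j\<in>E. c j * ((\<Prod>i\<in>V - {j}. 1 + b * x i) * rect_term 0 m x (V - {j}) (E - {j}))) = Q * K * X *
        (b * (\<Sum>j\<in>E. (1 - (y j)\<^sup>2) * (\<Prod>i\<in>E - {j}. (b + 1 * y i) * (y i * (1 - y i * y j) / (y i - y j)))))"
      by (simp add: sum_distrib_left mult_ac)
    also have "\<dots> = Q * K * X * ((\<Prod>i\<in>E. b + 1 * y i) - (\<Prod>i\<in>E. y i * (1 + b * y i)))"
    proof (subst partial_fraction_identity[OF finE])
      show "inj_on y E" using inj_on_subset[OF inj E] unfolding y_def inj_on_def by simp
    qed (use nz in \<open>auto simp: y_def\<close>)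
    finally have S: "b * (\<Sum>j\<in>E. c j * ((\<Prod>i\<in>V - {j}. 1 + b * x i) * rect_term 0 m x (V - {j}) (E - {j}))) =
        Q * K * X * (\<Prod>i\<in>E. b + 1 * y i) - Q * K * X * (\<Prod>i\<in>E. y i * (1 + b * y i))"
      by (simp only: right_diff_distrib)
    have "Q * K * X * (\<Prod>i\<in>E. y i * (1 + b * y i)) = rect_term b m x V E"
    proof -
      have "X * (\<Prod>i\<in>E. y i * (1 + b * y i)) = (\<Prod>i\<in>E. 1 + b / x i)"
        unfolding X_def prod.distrib[symmetric] using nz by (intro prod.cong) (auto simp: y_def)
      then show ?thesis
        unfolding rect_term_factor[of b m] Q_def[symmetric] K_def[symmetric] by (simp add: mult_ac)
    qed
    moreover have "Q * K * X * (\<Prod>i\<in>E. b + 1 * y i) = (\<Prod>i\<in>V. 1 + b * x i) * rect_term 0 m x V E"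
    proof -
      have "(\<Prod>i\<in>V. 1 + b * x i) = K * (\<Prod>i\<in>E. 1 + b * x i)"
        unfolding K_def using prod.subset_diff[OF E fin] by simp
      moreover have "X * (\<Prod>i\<in>E. b + 1 * y i) = (\<Prod>i\<in>E. 1 + b * x i)"
        unfolding X_def prod.distrib[symmetric] using nz by (intro prod.cong) (auto simp: y_def field_simps)
      ultimately show ?thesis by (simp add: Q_def mult_ac)
    qed
    ultimately show ?thesis unfolding S by simp
  qed
  then have "(\<Prod>i\<in>V. 1 + b * x i) * rect_char 0 m x V = rect_char b m x V +
      (\<Sum>E\<in>Pow V. b * (\<Sum>j\<in>E. c j * ((\<Prod>i\<in>V - {j}. 1 + b * x i) * rect_term 0 m x (V - {j}) (E - {j}))))"
    by (simp add: rect_char_def sum.distrib sum_distrib_left[of "\<Prod>i\<in>V. 1 + b * x i"])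
  also have "(\<Sum>E\<in>Pow V. b * (\<Sum>j\<in>E. c j * ((\<Prod>i\<in>V - {j}. 1 + b * x i) * rect_term 0 m x (V - {j}) (E - {j})))) =
      b * (\<Sum>j\<in>V. c j * ((\<Prod>i\<in>V - {j}. 1 + b * x i) * rect_char 0 m x (V - {j})))"
    using sum_Pow_remove[OF fin, of "\<lambda>j F. c j * ((\<Prod>i\<in>V - {j}. 1 + b * x i) * rect_term 0 m x (V - {j}) F)"]
    by (simp add: rect_char_def sum_distrib_left)
  finally show ?thesis unfolding c_def .
qed

end

text \<open>Laplace expansion renumbers the remaining variables, whereas the recursions above keep a
  hole in the index set. Monotone renumbering preserves the order of the pairs.\<close>

lemma rect_char_reindex:
  assumes f: "strict_mono f"
  shows "rect_char b m (x \<circ> f) V = rect_char b m x (f ` V)"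
proof -
  have inj: "inj f" using f by (rule strict_mono_imp_inj_on)
  have injs: "inj_on f S" for S using inj inj_on_subset by blast
  have less: "f i < f j \<longleftrightarrow> i < j" for i j using f by (rule strict_mono_less)
  have s: "sgnvar (f ` E) x (f i) = sgnvar E (x \<circ> f) i" for E i
    using inj by (auto simp: sgnvar_def inj_image_mem_iff)
  have "rect_term b m (x \<circ> f) V E = rect_term b m x (f ` V) (f ` E)" for E
  proof -
    have d: "f ` V - f ` E = f ` (V - E)" using inj by (simp add: image_set_diff)
    have p: "{j \<in> f ` V. j < f i} = f ` {j \<in> V. j < i}" for i using less by auto
    show ?thesis
      unfolding rect_term_def d by (simp add: prod.reindex[OF injs] p s)
  qed
  then have "rect_char b m (x \<circ> f) V = (\<Sum>E\<in>Pow V. rect_term b m x (f ` V) (f ` E))"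
    by (simp add: rect_char_def)
  also have "\<dots> = (\<Sum>F\<in>(`) f ` Pow V. rect_term b m x (f ` V) F)"
    by (simp add: sum.reindex inj_on_image_Pow injs)
  finally show ?thesis
    by (simp add: rect_char_def image_Pow_surj)
qed

section \<open>Laplace expansion of alternants\<close>

definition skip :: "nat \<Rightarrow> nat \<Rightarrow> nat" where
  "skip k j = (if j < k then j else Suc j)"

lemma strict_mono_skip: "strict_mono (skip k)"
  by (auto simp: strict_mono_def skip_def)

lemma skip_image: "k \<le> n \<Longrightarrow> skip k ` {..<n} = {..<Suc n} - {k}"
proof (intro equalityI subsetI)
  fix j assume k: "k \<le> n" and j: "j \<in> {..<Suc n} - {k}"
  show "j \<in> skip k ` {..<n}"
  proof (cases "j < k")
    case True
    then show ?thesis using k by (intro image_eqI[of _ _ j]) (auto simp: skip_def)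
  next
    case False
    then show ?thesis using j by (intro image_eqI[of _ _ "j - 1"]) (auto simp: skip_def)
  qed
qed (auto simp: skip_def split: if_splits)

lemma dt_laplace_first_row:
  "dt (Suc n) f = (\<Sum>k<Suc n. (- 1) ^ k * f 0 k * dt n (\<lambda>i j. f (Suc i) (skip k j)))"
proof -
  let ?A = "Matrix.mat (Suc n) (Suc n) (\<lambda>(i, j). f i j)"
  have c: "cofactor ?A 0 k = (- 1) ^ k * dt n (\<lambda>i j. f (Suc i) (skip k j))" for k
  proof -
    have "mat_delete ?A 0 k = Matrix.mat n n (\<lambda>(i, j). f (Suc i) (skip k j))"
      by (rule eq_matI) (auto simp: mat_delete_def skip_def)
    then show ?thesis by (simp add: cofactor_def dt_def)
  qed
  have "dt (Suc n) f = (\<Sum>k<Suc n. ?A $$ (0, k) * cofactor ?A 0 k)"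
    unfolding dt_def by (rule laplace_expansion_row) auto
  then show ?thesis unfolding c by (simp add: mult_ac)
qed

lemma vand_skip:
  assumes "k \<le> n"
  shows "vand (Suc n) t = (- 1) ^ k * (\<Prod>i\<in>{..<Suc n} - {k}. t k - t i) * vand n (t \<circ> skip k)"
  using assms
proof (induction n)
  case (Suc n)
  show ?case
  proof (cases "k = Suc n")
    case True
    have 1: "vand (Suc n) (t \<circ> skip k) = vand (Suc n) t"
      unfolding vand_def by (intro prod.cong refl) (auto simp: skip_def True)
    have 2: "(\<Prod>j<Suc n. t j - t (Suc n)) = (- 1) ^ Suc n * (\<Prod>j<Suc n. t (Suc n) - t j)"
    proof -
      have "(\<Prod>j<Suc n. t j - t (Suc n)) = (\<Prod>j<Suc n. (- 1) * (t (Suc n) - t j))" by simp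
      then show ?thesis unfolding prod.distrib by simp
    qed
    have 3: "{..<Suc (Suc n)} - {k} = {..<Suc n}" using True by auto
    show ?thesis unfolding vand_Suc[of "Suc n" t] 1 2 3 unfolding True by (simp only: mult_ac)
  next
    case False
    then have k: "k \<le> n" using Suc.prems by simp
    have "(\<Prod>j<Suc n. t j - t (Suc n)) = (t k - t (Suc n)) * (\<Prod>j\<in>{..<Suc n} - {k}. t j - t (Suc n))"
      using k by (intro prod.remove) auto
    also have "(\<Prod>j\<in>{..<Suc n} - {k}. t j - t (Suc n)) = (\<Prod>j<n. (t \<circ> skip k) j - (t \<circ> skip k) n)"
    proof -
      have "inj_on (skip k) {..<n}"
        by (rule inj_onI) (auto simp: skip_def split: if_splits)
      from prod.reindex[OF this, of "\<lambda>j. t j - t (Suc n)"] show ?thesis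
        using k by (simp add: skip_image skip_def[of k n])
    qed
    finally have 1: "(\<Prod>j<Suc n. t j - t (Suc n)) = (t k - t (Suc n)) * (\<Prod>j<n. (t \<circ> skip k) j - (t \<circ> skip k) n)" .
    have "{..<Suc (Suc n)} - {k} = insert (Suc n) ({..<Suc n} - {k})" using k by auto
    then have 2: "(\<Prod>i\<in>{..<Suc (Suc n)} - {k}. t k - t i) = (t k - t (Suc n)) * (\<Prod>i\<in>{..<Suc n} - {k}. t k - t i)"
      by simp
    show ?thesis
      unfolding vand_Suc[of "Suc n" t] vand_Suc[of n "t \<circ> skip k"] 1 2 Suc.IH[OF k] by (simp only: mult_ac)
  qed
qed (simp add: vand_def)

text \<open>The Schur polynomial at distinct arguments. It agrees there with \<open>schur\<close> by
  \<open>schur_eq_schur_ratio\<close>.\<close>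

definition schur_ratio :: "nat \<Rightarrow> (nat \<Rightarrow> real) \<Rightarrow> nat list \<Rightarrow> real" where
  "schur_ratio n x \<mu> = dt n (\<lambda>i j. x j ^ (\<mu> ! i + (n - Suc i))) / vand n x"

text \<open>Expansion along the row of the largest part. The signs cancel against those of
  \<open>vand_skip\<close>, which arise when variable \<open>j\<close> leaves the Vandermonde
  product.\<close>

lemma schur_ratio_Cons:
  assumes inj: "inj_on x {..<Suc n}"
  shows "schur_ratio (Suc n) x (k # \<mu>) =
    (\<Sum>j<Suc n. x j ^ (k + n) / (\<Prod>i\<in>{..<Suc n} - {j}. x j - x i) * schur_ratio n (x \<circ> skip j) \<mu>)"
proof -
  have "(- 1) ^ j * x j ^ (k + n) * d / vand (Suc n) x =
      x j ^ (k + n) / (\<Prod>i\<in>{..<Suc n} - {j}. x j - x i) * (d / vand n (x \<circ> skip j))"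
    if "j < Suc n" for j d
    using that by (simp add: vand_skip[of j n x] del: lessThan_Suc)
  then show ?thesis
    unfolding schur_ratio_def dt_laplace_first_row sum_divide_distrib by (intro sum.cong) simp_all
qed

section \<open>The bounded Littlewood identity\<close>

definition partitions_below :: "nat \<Rightarrow> nat \<Rightarrow> nat list set" where
  "partitions_below m n = {\<mu>. length \<mu> = n \<and> sorted_wrt (\<ge>) \<mu> \<and> (\<forall>k\<in>set \<mu>. k \<le> m)}"

lemma finite_partitions_below [simp]: "finite (partitions_below m n)"
proof (rule finite_subset)
  show "partitions_below m n \<subseteq> {xs. set xs \<subseteq> {..m} \<and> length xs = n}"
    by (auto simp: partitions_below_def)
qed (simp add: finite_lists_length_eq)

lemma sum_partitions_below_Suc:
  "(\<Sum>\<mu>\<in>partitions_below m (Suc n). f \<mu>) = (\<Sum>k\<le>m. \<Sum>\<nu>\<in>partitions_below k n. f (k # \<nu>))"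
proof -
  have "(\<Sum>\<mu>\<in>partitions_below m (Suc n). f \<mu>) = (\<Sum>(k, \<nu>)\<in>Sigma {..m} (\<lambda>k. partitions_below k n). f (k # \<nu>))"
  proof (rule sum.reindex_bij_witness[of _ "\<lambda>(k, \<nu>). k # \<nu>" "\<lambda>\<mu>. (hd \<mu>, tl \<mu>)"])
    fix \<mu> assume "\<mu> \<in> partitions_below m (Suc n)"
    then obtain k \<nu> where "\<mu> = k # \<nu>" "length \<nu> = n" "sorted_wrt (\<ge>) (k # \<nu>)" "\<forall>i\<in>set (k # \<nu>). i \<le> m"
      by (cases \<mu>) (auto simp: partitions_below_def)
    then show "(case (hd \<mu>, tl \<mu>) of (k, \<nu>) \<Rightarrow> k # \<nu>) = \<mu>" "(hd \<mu>, tl \<mu>) \<in> Sigma {..m} (\<lambda>k. partitions_below k n)"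
      "(case (hd \<mu>, tl \<mu>) of (k, \<nu>) \<Rightarrow> f (k # \<nu>)) = f \<mu>"
      by (auto simp: partitions_below_def)
  qed (auto simp: partitions_below_def)
  also have "\<dots> = (\<Sum>k\<le>m. \<Sum>\<nu>\<in>partitions_below k n. f (k # \<nu>))"
    by (subst sum.Sigma) auto
  finally show ?thesis .
qed

lemma partitions_below_0 [simp]: "partitions_below m 0 = {[]}"
  by (auto simp: partitions_below_def)

lemma oddrows_Cons: "b ^ oddrows (k # \<nu>) = (b :: 'a::monoid_mult) ^ (k mod 2) * b ^ oddrows \<nu>"
  by (cases "odd k") (auto simp: oddrows_def odd_iff_mod_2_eq_one)

definition bounded_schur_sum :: "real \<Rightarrow> nat \<Rightarrow> nat \<Rightarrow> (nat \<Rightarrow> real) \<Rightarrow> real" where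
  "bounded_schur_sum b m n x = (\<Sum>\<mu>\<in>partitions_below m n. b ^ oddrows \<mu> * schur_ratio n x \<mu>)"

lemma bounded_schur_sum_Suc:
  assumes "inj_on x {..<Suc n}"
  shows "bounded_schur_sum b m (Suc n) x = (\<Sum>k\<le>m. b ^ (k mod 2) *
    (\<Sum>j<Suc n. x j ^ (k + n) / (\<Prod>i\<in>{..<Suc n} - {j}. x j - x i) * bounded_schur_sum b k n (x \<circ> skip j)))"
proof -
  have "(\<Sum>\<nu>\<in>partitions_below k n. b ^ oddrows (k # \<nu>) * schur_ratio (Suc n) x (k # \<nu>)) = b ^ (k mod 2) *
      (\<Sum>j<Suc n. x j ^ (k + n) / (\<Prod>i\<in>{..<Suc n} - {j}. x j - x i) * bounded_schur_sum b k n (x \<circ> skip j))" for k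
  proof -
    have "(\<Sum>\<nu>\<in>partitions_below k n. b ^ oddrows (k # \<nu>) * schur_ratio (Suc n) x (k # \<nu>)) =
      (\<Sum>\<nu>\<in>partitions_below k n. \<Sum>j<Suc n. b ^ (k mod 2) * (x j ^ (k + n) / (\<Prod>i\<in>{..<Suc n} - {j}. x j - x i) *
        (b ^ oddrows \<nu> * schur_ratio n (x \<circ> skip j) \<nu>)))"
      unfolding schur_ratio_Cons[OF assms] oddrows_Cons sum_distrib_left
      by (intro sum.cong refl) (simp only: mult_ac times_divide_eq_left times_divide_eq_right)
    also have "\<dots> = b ^ (k mod 2) *
      (\<Sum>j<Suc n. x j ^ (k + n) / (\<Prod>i\<in>{..<Suc n} - {j}. x j - x i) * bounded_schur_sum b k n (x \<circ> skip j))"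
      unfolding bounded_schur_sum_def sum_distrib_left by (rule sum.swap)
    finally show ?thesis .
  qed
  then show ?thesis unfolding bounded_schur_sum_def[of b m] sum_partitions_below_Suc by simp
qed

text \<open>With \<open>m = 2u\<close>, an even \<open>m\<close> belongs to an integer rectangle. An
  odd \<open>m\<close> belongs to a half-integer one, whose odd ends give a factor
  \<open>1 + b * x i\<close> each and leave the parameter 0 and the exponent
  \<open>m - 1\<close>.\<close>

definition littlewood_char :: "real \<Rightarrow> nat \<Rightarrow> (nat \<Rightarrow> real) \<Rightarrow> nat set \<Rightarrow> real" where
  "littlewood_char b m x V =
    (if even m then rect_char b m x V else (\<Prod>i\<in>V. 1 + b * x i) * rect_char 0 (m - 1) x V)"

text \<open>The last sum will match the partitions whose first part is exactly \<open>Suc m\<close>,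
  so this is the counterpart of \<open>bounded_schur_sum_Suc\<close>.\<close>

lemma littlewood_char_Suc:
  assumes "finite V" "inj_on x V" "\<And>j. j \<in> V \<Longrightarrow> 0 < x j \<and> x j < 1"
  shows "littlewood_char b (Suc m) x V = littlewood_char b m x V + b ^ (Suc m mod 2) *
    (\<Sum>j\<in>V. x j ^ (Suc m + card (V - {j})) / (\<Prod>i\<in>V - {j}. x j - x i) * littlewood_char b (Suc m) x (V - {j}))"
proof (cases "even m")
  case True
  then have "Suc m mod 2 = 1" by presburger
  with True show ?thesis
    unfolding littlewood_char_def using rect_char_odd[OF assms, of b m] by simp
next
  case False
  then obtain l where m: "m = Suc l" by (cases m) auto
  have "Suc m mod 2 = 0" using False by presburger
  with False show ?thesis
    unfolding littlewood_char_def using rect_char_even[OF assms, of "Suc m" l b] m by simp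
qed

text \<open>Both sides have the same increment from \<open>m\<close> to \<open>Suc m\<close>, and
  this increment involves fewer variables at the bound \<open>Suc m\<close>. Hence the induction on
  \<open>m\<close> is nested in one on the number of variables that holds for all bounds.\<close>

theorem bounded_littlewood:
  assumes "inj_on x {..<n}" "\<And>j. j < n \<Longrightarrow> 0 < x j \<and> x j < 1"
  shows "bounded_schur_sum b m n x = littlewood_char b m x {..<n}"
  using assms
proof (induction n arbitrary: x m)
  case 0
  show ?case
    by (simp add: bounded_schur_sum_def littlewood_char_def rect_char_def rect_term_def schur_ratio_def oddrows_def)
next
  case (Suc n)
  note outer_IH = Suc.IH and prems = Suc.prems
  show ?case
  proof (induction m)
    case 0
    have "partitions_below 0 (Suc n) = {replicate (Suc n) 0}"
      by (auto simp: partitions_below_def sorted_wrt_iff_nth_less simp del: replicate_Suc intro: replicate_eqI)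
    moreover have "schur_ratio (Suc n) x (replicate (Suc n) 0) = 1"
    proof -
      have "dt (Suc n) (\<lambda>i j. x j ^ (replicate (Suc n) 0 ! i + (Suc n - Suc i))) = vand (Suc n) x"
        unfolding dt_vandermonde[symmetric] by (rule dt_cong) (simp del: replicate_Suc)
      then show ?thesis
        using vand_nonzero[OF prems(1)] by (simp add: schur_ratio_def del: replicate_Suc)
    qed
    moreover have "oddrows (replicate (Suc n) 0) = 0"
      by (simp add: oddrows_def del: replicate_Suc)
    \<comment> \<open>At \<open>m = 0\<close> this is a denominator identity. It comes for free from
      the rectangle of height 0, whose character is 1 by \<open>cb_zero\<close>.\<close>
    moreover have "rect_char b 0 x {..<Suc n} = 1"
      using cb_rectangle[of x "Suc n" 0 b, OF prems] by (simp add: cb_zero del: replicate_Suc cb.simps)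
    ultimately show ?case
      by (simp add: bounded_schur_sum_def littlewood_char_def del: replicate_Suc)
  next
    case (Suc m)
    have IH: "bounded_schur_sum b (Suc m) n (x \<circ> skip j) = littlewood_char b (Suc m) x ({..<Suc n} - {j})"
      if j: "j < Suc n" for j
    proof -
      have im: "skip j ` {..<n} = {..<Suc n} - {j}" by (rule skip_image) (use j in simp)
      have inj: "inj_on (skip j) {..<n}" by (rule inj_onI) (auto simp: skip_def split: if_splits)
      have "bounded_schur_sum b (Suc m) n (x \<circ> skip j) = littlewood_char b (Suc m) (x \<circ> skip j) {..<n}"
      proof (rule outer_IH)
        show "inj_on (x \<circ> skip j) {..<n}"
          using inj im inj_on_subset[OF prems(1)] by (intro comp_inj_on) auto
        show "0 < (x \<circ> skip j) i \<and> (x \<circ> skip j) i < 1" if "i < n" for i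
          using prems(2)[of "skip j i"] that by (simp add: skip_def)
      qed
      also have "\<dots> = littlewood_char b (Suc m) x ({..<Suc n} - {j})"
        unfolding littlewood_char_def rect_char_reindex[OF strict_mono_skip] im[symmetric]
        by (simp add: prod.reindex[OF inj])
      finally show ?thesis .
    qed
    have "bounded_schur_sum b (Suc m) (Suc n) x = bounded_schur_sum b m (Suc n) x + b ^ (Suc m mod 2) *
      (\<Sum>j<Suc n. x j ^ (Suc m + n) / (\<Prod>i\<in>{..<Suc n} - {j}. x j - x i) * bounded_schur_sum b (Suc m) n (x \<circ> skip j))"
      unfolding bounded_schur_sum_Suc[OF prems(1)] by simp
    also have "\<dots> = littlewood_char b m x {..<Suc n} + b ^ (Suc m mod 2) *
      (\<Sum>j\<in>{..<Suc n}. x j ^ (Suc m + card ({..<Suc n} - {j})) / (\<Prod>i\<in>{..<Suc n} - {j}. x j - x i) *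
        littlewood_char b (Suc m) x ({..<Suc n} - {j}))"
      unfolding Suc by (intro arg_cong2[of _ _ _ _ "(+)"] arg_cong2[of _ _ _ _ "(*)"] sum.cong refl) (simp_all add: IH)
    also have "\<dots> = littlewood_char b (Suc m) x {..<Suc n}"
      using prems by (intro littlewood_char_Suc[symmetric]) auto
    finally show ?case .
  qed
qed

section \<open>Evaluation homomorphism and divisibility of alternants\<close>

definition mon_eval :: "(nat \<Rightarrow> real) \<Rightarrow> (nat \<Rightarrow>\<^sub>0 nat) \<Rightarrow> real" where
  "mon_eval x m = (\<Prod>j\<in>Poly_Mapping.keys m. x j ^ Poly_Mapping.lookup m j)"

lemma mpoly_eval_alt: "mpoly_eval x P = (\<Sum>m\<in>Poly_Mapping.keys P. Poly_Mapping.lookup P m * mon_eval x m)"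
  by (simp add: mpoly_eval_def mon_eval_def)

lemma mon_eval_superset:
  assumes "finite A" "Poly_Mapping.keys m \<subseteq> A"
  shows "mon_eval x m = (\<Prod>j\<in>A. x j ^ Poly_Mapping.lookup m j)"
  unfolding mon_eval_def using assms
  by (intro prod.mono_neutral_left) (auto simp: in_keys_iff)

lemma mon_eval_add: "mon_eval x (m + m') = mon_eval x m * mon_eval x m'"
proof -
  let ?A = "Poly_Mapping.keys m \<union> Poly_Mapping.keys m'"
  have "mon_eval x (m + m') = (\<Prod>j\<in>?A. x j ^ Poly_Mapping.lookup (m + m') j)"
    by (intro mon_eval_superset) (auto simp: in_keys_iff lookup_add)
  also have "\<dots> = (\<Prod>j\<in>?A. x j ^ Poly_Mapping.lookup m j) * (\<Prod>j\<in>?A. x j ^ Poly_Mapping.lookup m' j)"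
    by (simp add: lookup_add power_add prod.distrib)
  also have "\<dots> = mon_eval x m * mon_eval x m'"
    using mon_eval_superset[of ?A m x] mon_eval_superset[of ?A m' x] by simp
  finally show ?thesis .
qed

lemma mpoly_eval_superset:
  assumes "finite A" "Poly_Mapping.keys P \<subseteq> A"
  shows "mpoly_eval x P = (\<Sum>m\<in>A. Poly_Mapping.lookup P m * mon_eval x m)"
  unfolding mpoly_eval_alt using assms
  by (intro sum.mono_neutral_left) (auto simp: in_keys_iff)

lemma mpoly_eval_add: "mpoly_eval x (P + Q) = mpoly_eval x P + mpoly_eval x Q"
proof -
  let ?A = "Poly_Mapping.keys P \<union> Poly_Mapping.keys Q"
  have "mpoly_eval x (P + Q) = (\<Sum>m\<in>?A. Poly_Mapping.lookup (P + Q) m * mon_eval x m)"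
    by (intro mpoly_eval_superset) (auto simp: in_keys_iff lookup_add)
  also have "\<dots> = mpoly_eval x P + mpoly_eval x Q"
    using mpoly_eval_superset[of ?A P x] mpoly_eval_superset[of ?A Q x]
    by (simp add: lookup_add distrib_right sum.distrib)
  finally show ?thesis .
qed

lemma mpoly_eval_0 [simp]: "mpoly_eval x 0 = 0"
  by (simp add: mpoly_eval_def)

lemma mpoly_eval_single: "mpoly_eval x (Poly_Mapping.single m a) = a * mon_eval x m"
  using mpoly_eval_superset[of "{m}" "Poly_Mapping.single m a" x] by simp

lemma mpoly_eval_1 [simp]: "mpoly_eval x 1 = 1"
proof -
  have "mpoly_eval x 1 = mpoly_eval x (Poly_Mapping.single 0 1)" by simp
  also have "\<dots> = 1" unfolding mpoly_eval_single by (simp add: mon_eval_def)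
  finally show ?thesis .
qed

lemma mpoly_eval_sum: "mpoly_eval x (\<Sum>i\<in>A. f i) = (\<Sum>i\<in>A. mpoly_eval x (f i))"
  by (induction A rule: infinite_finite_induct) (auto simp: mpoly_eval_add)

lemma poly_mapping_sum_single:
  "(\<Sum>m\<in>Poly_Mapping.keys P. Poly_Mapping.single m (Poly_Mapping.lookup P m)) = P"
  by (rule poly_mapping_eqI)
    (simp add: lookup_sum lookup_single when_def in_keys_iff)

lemma mpoly_eval_mult: "mpoly_eval x (P * Q) = mpoly_eval x P * mpoly_eval x Q"
proof -
  have "P * Q = (\<Sum>m\<in>Poly_Mapping.keys P. Poly_Mapping.single m (Poly_Mapping.lookup P m)) *
      (\<Sum>m\<in>Poly_Mapping.keys Q. Poly_Mapping.single m (Poly_Mapping.lookup Q m))"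
    by (simp only: poly_mapping_sum_single)
  also have "mpoly_eval x \<dots> = mpoly_eval x P * mpoly_eval x Q"
    unfolding sum_product mpoly_eval_sum mult_single mpoly_eval_single mon_eval_add
      mpoly_eval_alt[of x P] mpoly_eval_alt[of x Q]
    by (simp only: mult_ac)
  finally show ?thesis .
qed

lemma mpoly_eval_uminus: "mpoly_eval x (- P) = - mpoly_eval x P"
  using mpoly_eval_add[of x P "- P"] by simp

lemma mpoly_eval_prod: "mpoly_eval x (\<Prod>i\<in>A. f i) = (\<Prod>i\<in>A. mpoly_eval x (f i))"
  by (induction A rule: infinite_finite_induct) (auto simp: mpoly_eval_mult)

lemma mpoly_eval_power: "mpoly_eval x (P ^ n) = mpoly_eval x P ^ n"
  by (induction n) (auto simp: mpoly_eval_mult)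

lemma mpoly_eval_X_var: "mpoly_eval x (X_var j) = x j"
  by (simp add: X_var_def mpoly_eval_single mon_eval_def)

lemma mpoly_eval_dt: "mpoly_eval x (dt n f) = dt n (\<lambda>i j. mpoly_eval x (f i j))"
proof -
  have "mpoly_eval x (of_int (sign p)) = of_int (sign p)" for p :: "nat \<Rightarrow> nat"
    by (simp add: sign_def mpoly_eval_uminus)
  then show ?thesis
    by (simp add: dt_leibniz mpoly_eval_sum mpoly_eval_mult mpoly_eval_prod)
qed

text \<open>Division with remainder by the monic polynomial \<Prod>(X - x_i), which vanishes at
  every \<open>x j\<close>. The remainder has degree less than \<open>n\<close>, and its
  coefficients are the same for all \<open>j\<close>.\<close>

lemma power_reduction:
  fixes x :: "nat \<Rightarrow> 'a::idom"
  shows "\<exists>r. \<forall>j<n. x j ^ l = (\<Sum>k<n. r k * x j ^ k)"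
proof (cases "n = 0")
  case False
  show ?thesis
  proof (induction l)
    case 0
    have "x j ^ 0 = (\<Sum>k<n. (if k = 0 then 1 else 0) * x j ^ k)" for j
      using False by (simp add: sum.remove[of _ 0])
    then show ?case by (intro exI[of _ "\<lambda>k. if k = 0 then 1 else 0"] allI impI)
  next
    case (Suc l)
    then obtain r where r: "\<And>j. j < n \<Longrightarrow> x j ^ l = (\<Sum>k<n. r k * x j ^ k)" by blast
    define P where "P = (\<Prod>i<n. [:- x i, 1:])"
    have deg: "Polynomial.degree P = n"
      unfolding P_def by (subst degree_prod_eq_sum_degree) auto
    have monic: "Polynomial.coeff P n = 1"
      using lead_coeff_prod[of "\<lambda>i. [:- x i, 1:]" "{..<n}"] deg unfolding P_def by simp
    obtain n' where n': "n = Suc n'" using False by (cases n) auto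
    have red: "x j ^ n = (\<Sum>k<n. - Polynomial.coeff P k * x j ^ k)" if "j < n" for j
    proof -
      have "poly P (x j) = 0"
        using that unfolding P_def poly_prod by (intro prod_zero) auto
      then have "(\<Sum>k<n. Polynomial.coeff P k * x j ^ k) + x j ^ n = 0"
        by (simp add: poly_altdef deg monic lessThan_Suc_atMost[symmetric])
      then show ?thesis by (simp add: sum_negf eq_neg_iff_add_eq_0 add.commute)
    qed
    have "x j ^ Suc l = (\<Sum>k<n. ((if k = 0 then 0 else r (k - 1)) - r n' * Polynomial.coeff P k) * x j ^ k)"
      if j: "j < n" for j
    proof -
      have "x j ^ Suc l = (\<Sum>k<n. r k * x j ^ Suc k)"
        using r[OF j] by (simp add: sum_distrib_left mult_ac)
      also have "\<dots> = (\<Sum>k<n'. r k * x j ^ Suc k) + r n' * x j ^ n"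
        by (simp add: n')
      also have "(\<Sum>k<n'. r k * x j ^ Suc k) = (\<Sum>k<n. (if k = 0 then 0 else r (k - 1)) * x j ^ k)"
        unfolding n' sum.lessThan_Suc_shift by simp
      finally show ?thesis
        unfolding red[OF j] by (simp add: sum_distrib_left left_diff_distrib sum_subtractf sum_negf mult.assoc)
    qed
    then show ?case
      by (intro exI[of _ "\<lambda>k. (if k = 0 then 0 else r (k - 1)) - r n' * Polynomial.coeff P k"] allI impI)
  qed
qed simp

text \<open>After reduction every row is a combination of Vandermonde rows, so the determinant of
  the coefficients is a quotient. Working over an arbitrary integral domain allows the
  \<open>x j\<close> to be polynomial variables.\<close>

lemma alternant_divisible:
  fixes x :: "nat \<Rightarrow> 'a::idom"
  shows "\<exists>S. S * dt n (\<lambda>i j. x j ^ (n - Suc i)) = dt n (\<lambda>i j. x j ^ e i)"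
proof -
  obtain r where r: "\<And>l j. j < n \<Longrightarrow> x j ^ l = (\<Sum>k<n. r l k * x j ^ k)"
    using power_reduction[of n x] by metis
  have "x j ^ e i = (\<Sum>k<n. r (e i) (n - Suc k) * x j ^ (n - Suc k))" if "j < n" for i j
    using r[OF that, of "e i"] sum.nat_diff_reindex[of "\<lambda>k. r (e i) k * x j ^ k" n] by simp
  then have "dt n (\<lambda>i j. x j ^ e i) = dt n (\<lambda>i j. \<Sum>k<n. r (e i) (n - Suc k) * x j ^ (n - Suc k))"
    by (intro dt_cong)
  also have "\<dots> = dt n (\<lambda>i k. r (e i) (n - Suc k)) * dt n (\<lambda>i j. x j ^ (n - Suc i))"
    by (rule dt_mult)
  finally show ?thesis by metis
qed

lemma alternant_eq_dt: "alternant n e = dt n (\<lambda>i j. X_var (Suc j) ^ e (Suc i))"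
  by (simp add: alternant_def dt_def)

text \<open>\<open>schur_poly\<close> is a definite description. Existence is
  \<open>alternant_divisible\<close>, and uniqueness follows because the Vandermonde product of
  distinct variables is nonzero in a ring without zero divisors.\<close>

lemma schur_poly_times_alternant:
  "schur_poly n \<mu> * alternant n (\<lambda>i. n - i) = alternant n (\<lambda>i. \<mu> ! (i - 1) + n - i)"
proof -
  have inj: "inj_on (\<lambda>j. X_var (Suc j)) {..<n}"
  proof (rule inj_onI)
    fix i j assume "X_var (Suc i) = X_var (Suc j)"
    \<comment> \<open>Evaluation at the point with coordinates k separates the variables.\<close>
    then have "mpoly_eval (\<lambda>k. real k) (X_var (Suc i)) = mpoly_eval (\<lambda>k. real k) (X_var (Suc j))" by simp
    then show "i = j" by (simp add: mpoly_eval_X_var)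
  qed
  have nz: "alternant n (\<lambda>i. n - i) \<noteq> 0"
    unfolding alternant_eq_dt dt_vandermonde using vand_nonzero[OF inj] .
  obtain S where S: "S * alternant n (\<lambda>i. n - i) = alternant n (\<lambda>i. \<mu> ! (i - 1) + n - i)"
    using alternant_divisible[of n "\<lambda>j. X_var (Suc j)" "\<lambda>i. \<mu> ! i + n - Suc i"]
    unfolding alternant_eq_dt by auto
  show ?thesis
    unfolding schur_poly_def
  proof (rule theI[of _ S], rule S)
    fix T assume "T * alternant n (\<lambda>i. n - i) = alternant n (\<lambda>i. \<mu> ! (i - 1) + n - i)"
    then have "T * alternant n (\<lambda>i. n - i) = S * alternant n (\<lambda>i. n - i)" by (simp only: S)
    then show "T = S" by (simp only: mult_right_cancel[OF nz])
  qed
qed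

lemma inj_on_shift_Suc:
  assumes "inj_on x {1..n}"
  shows "inj_on (\<lambda>j. x (Suc j)) {..<n}"
proof (rule inj_onI)
  fix i j assume "i \<in> {..<n}" "j \<in> {..<n}" "x (Suc i) = x (Suc j)"
  then show "i = j" using inj_onD[OF assms, of "Suc i" "Suc j"] by simp
qed

lemma schur_eq_schur_ratio:
  assumes "inj_on x {1..n}"
  shows "schur n \<mu> x = schur_ratio n (\<lambda>j. x (Suc j)) \<mu>"
proof -
  have ev: "mpoly_eval x (alternant n e) = dt n (\<lambda>i j. x (Suc j) ^ e (Suc i))" for e
    by (simp add: alternant_eq_dt mpoly_eval_dt mpoly_eval_power mpoly_eval_X_var)
  have inj: "inj_on (\<lambda>j. x (Suc j)) {..<n}"
    using assms by (rule inj_on_shift_Suc)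
  have "schur n \<mu> x * dt n (\<lambda>i j. x (Suc j) ^ (n - Suc i)) = dt n (\<lambda>i j. x (Suc j) ^ (\<mu> ! i + n - Suc i))"
    using arg_cong[OF schur_poly_times_alternant[of n \<mu>], of "mpoly_eval x"]
    by (simp add: mpoly_eval_mult ev schur_def)
  moreover have "dt n (\<lambda>i j. x (Suc j) ^ (\<mu> ! i + n - Suc i)) = dt n (\<lambda>i j. x (Suc j) ^ (\<mu> ! i + (n - Suc i)))"
    by (rule dt_cong) simp
  ultimately show ?thesis
    unfolding schur_ratio_def dt_vandermonde using vand_nonzero[OF inj] by (simp add: field_simps)
qed

lemma tendsto_mpoly_eval:
  assumes "\<And>j. ((\<lambda>e. X e j) \<longlongrightarrow> x j) F"
  shows "((\<lambda>e. mpoly_eval (X e) P) \<longlongrightarrow> mpoly_eval x P) F"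
  unfolding mpoly_eval_def using assms by (intro tendsto_intros)

text \<open>Alternant quotients and sign changes require distinct variables, but
  \<open>schur\<close> evaluates a polynomial and \<open>cb\<close> is continuous for positive
  arguments, so the identity extends to coinciding ones.\<close>

theorem bounded_littlewood_cb:
  assumes p: "\<And>j. j \<in> {1..n} \<Longrightarrow> 0 < p j \<and> p j < 1"
  shows "(\<Sum>\<mu>\<in>partitions_below (2 * u + (if half then 1 else 0)) n. b ^ oddrows \<mu> * schur n \<mu> p) =
    (if half then \<Prod>j<n. 1 + b * p (Suc j) else 1) * (\<Prod>j<n. p (Suc j) ^ u) *
    cb (if half then 0 else b) (\<lambda>j. p (Suc j)) n (replicate n u)" (is "?f p = ?g p")
proof (rule generic_eqI[of "{1..n}" p ?f ?g])
  show "((\<lambda>e. ?f (X e)) \<longlongrightarrow> ?f p) (at_right 0)"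
    if "\<And>j. ((\<lambda>e. X e j) \<longlongrightarrow> p j) (at_right 0)" for X
    unfolding schur_def using that by (intro tendsto_intros tendsto_mpoly_eval)
  show "((\<lambda>e. ?g (X e)) \<longlongrightarrow> ?g p) (at_right 0)"
    if X: "\<And>j. ((\<lambda>e. X e j) \<longlongrightarrow> p j) (at_right 0)" for X
  proof (intro tendsto_mult tendsto_prod tendsto_power X tendsto_cb)
    show "((\<lambda>e. if half then \<Prod>j<n. 1 + b * X e (Suc j) else 1) \<longlongrightarrow>
        (if half then \<Prod>j<n. 1 + b * p (Suc j) else 1)) (at_right 0)"
      using X by (auto intro!: tendsto_intros)
  qed (use p in auto)
  fix y :: "nat \<Rightarrow> real"
  assume inj: "inj_on y {1..n}" and y: "\<And>j. j \<in> {1..n} \<Longrightarrow> 0 < y j \<and> y j < 1"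
  have inj': "inj_on (\<lambda>j. y (Suc j)) {..<n}"
    using inj by (rule inj_on_shift_Suc)
  have y': "0 < y (Suc j) \<and> y (Suc j) < 1" if "j < n" for j
    using y that by simp
  have "?f y = bounded_schur_sum b (2 * u + (if half then 1 else 0)) n (\<lambda>j. y (Suc j))"
    by (simp add: bounded_schur_sum_def schur_eq_schur_ratio[OF inj])
  also have "\<dots> = ?g y"
    using bounded_littlewood[of "\<lambda>j. y (Suc j)" n b "2 * u + (if half then 1 else 0)"]
      cb_rectangle[of "\<lambda>j. y (Suc j)" n u] inj' y' by (simp add: littlewood_char_def)
  finally show "?f y = ?g y" .
qed (use p in auto)

section \<open>Splitting a rectangular shape\<close>

lemma all_less_Suc_shift: "(\<forall>i<Suc n. P i) \<longleftrightarrow> P 0 \<and> (\<forall>i<n. P (Suc i))"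
  by (auto simp: less_Suc_eq_0_disj)

lemma odd_rows_Cons:
  "r # rho \<in> odd_rows (l # lam) \<longleftrightarrow> (if lam = [] then 0 else hd lam) \<le> r \<and> r \<le> l \<and> rho \<in> odd_rows lam"
  by (cases lam) (auto simp: odd_rows_def all_less_Suc_shift)

lemma even_rows_Cons:
  "v # nu \<in> even_rows (r # rho) \<longleftrightarrow> rho \<noteq> [] \<and> hd rho \<le> v \<and> v \<le> r \<and> nu \<in> even_rows rho"
  by (cases rho) (auto simp: even_rows_def all_less_Suc_shift)

text \<open>Interlacing can be read in both directions: once \<open>u\<close> is prepended to the
  longer row, the upper and the lower row exchange their roles.\<close>

lemma odd_rows_Cons_iff:
  "rho \<in> odd_rows (u # lam) \<longleftrightarrow> rho \<noteq> [] \<and> hd rho \<le> u \<and> lam \<in> even_rows rho"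
proof (induction lam arbitrary: rho u)
  case Nil
  show ?case by (cases rho) (auto simp: odd_rows_def even_rows_def)
next
  case (Cons l lam)
  show ?case
  proof (cases rho)
    case Nil
    then show ?thesis by (auto simp: odd_rows_def)
  next
    case (Cons r rho')
    then show ?thesis
      using Cons.IH[of rho' l] by (auto simp: odd_rows_Cons even_rows_Cons)
  qed
qed

lemma even_rows_Cons_iff:
  "nu \<in> even_rows (u # rho) \<longleftrightarrow> (nu \<noteq> [] \<longrightarrow> hd nu \<le> u) \<and> rho \<in> odd_rows nu"
proof (cases nu)
  case Nil
  then show ?thesis by (auto simp: odd_rows_def even_rows_def)
next
  case (Cons v nu')
  then show ?thesis
    using odd_rows_Cons_iff[of rho v nu'] by (auto simp: even_rows_Cons)
qed

text \<open>An entry squeezed between two copies of \<open>u\<close> equals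
  \<open>u\<close>.\<close>

lemma odd_rows_append_replicate:
  "odd_rows (replicate a u @ u # lam) = (\<lambda>rho. replicate a u @ rho) ` odd_rows (u # lam)"
proof (induction a)
  case (Suc a)
  have "odd_rows (u # replicate a u @ u # lam) = (\<lambda>rho. u # rho) ` odd_rows (replicate a u @ u # lam)"
  proof (intro equalityI subsetI)
    fix rho assume rho: "rho \<in> odd_rows (u # replicate a u @ u # lam)"
    then obtain r rho' where [simp]: "rho = r # rho'" by (cases rho) (auto simp: odd_rows_def)
    show "rho \<in> (\<lambda>rho. u # rho) ` odd_rows (replicate a u @ u # lam)"
      using rho by (cases a) (auto simp: odd_rows_Cons)
  qed (cases a; auto simp: odd_rows_Cons)
  then show ?case using Suc by (simp add: image_image)
qed simp

lemma even_rows_append_replicate: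
  "even_rows (replicate a u @ u # rho) = (\<lambda>nu. replicate a u @ nu) ` even_rows (u # rho)"
proof (induction a)
  case (Suc a)
  have "even_rows (u # replicate a u @ u # rho) = (\<lambda>nu. u # nu) ` even_rows (replicate a u @ u # rho)"
  proof (intro equalityI subsetI)
    fix nu assume nu: "nu \<in> even_rows (u # replicate a u @ u # rho)"
    then obtain v nu' where [simp]: "nu = v # nu'" by (cases nu) (auto simp: even_rows_def)
    show "nu \<in> (\<lambda>nu. u # nu) ` even_rows (replicate a u @ u # rho)"
      using nu by (cases a) (auto simp: even_rows_Cons)
  qed (cases a; auto simp: even_rows_Cons)
  then show ?case using Suc by (simp add: image_image)
qed simp

lemma sorted_ge_iff_nth_Suc: "sorted_wrt (\<ge>) (xs :: nat list) \<longleftrightarrow> (\<forall>i. Suc i < length xs \<longrightarrow> xs ! Suc i \<le> xs ! i)"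
  by (subst sorted_wrt_iff_nth_Suc_transp) (auto simp: transp_def)

lemma partitions_below_iff:
  "\<mu> \<in> partitions_below m n \<longleftrightarrow> length \<mu> = n \<and> sorted_wrt (\<ge>) \<mu> \<and> (\<mu> \<noteq> [] \<longrightarrow> hd \<mu> \<le> m)"
  by (cases \<mu>) (auto simp: partitions_below_def)

text \<open>The same three rows have two readings. From top to bottom they are the free parts of
  three rows of a pattern of nearly rectangular shape. From bottom to top they are the three top
  rows of a pattern of shape \<open>nu\<close>.\<close>

lemma interlacing_exchange:
  "lam \<in> partitions_below u k \<and> rho \<in> odd_rows (u # lam) \<and> nu \<in> even_rows (u # rho) \<longleftrightarrow>
   nu \<in> partitions_below u (Suc k) \<and> rho \<in> odd_rows nu \<and> lam \<in> even_rows rho"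
proof -
  have 1: "sorted_wrt (\<ge>) lam" if "lam \<in> even_rows rho"
    using even_rows_decreasing[OF that] by (auto simp: sorted_ge_iff_nth_Suc)
  have 2: "sorted_wrt (\<ge>) nu" if "nu \<in> even_rows (u # rho)"
    using even_rows_decreasing[OF that] by (auto simp: sorted_ge_iff_nth_Suc)
  have 3: "length lam = length rho - 1" if "lam \<in> even_rows rho" using that by (simp add: even_rows_def)
  have 4: "length nu = length rho" if "rho \<in> odd_rows nu" using that by (simp add: odd_rows_def)
  have 5: "hd rho \<le> hd nu" if "rho \<in> odd_rows nu" "rho \<noteq> []" using that
    by (cases "nu = []") (auto simp: odd_rows_def hd_conv_nth)
  have 6: "hd lam \<le> hd rho" if "lam \<in> even_rows rho" "lam \<noteq> []" using that
  proof -
    have "0 < length lam" "length lam = length rho - 1" "lam ! i \<le> rho ! i" if "i < length rho - 1" for i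
      using \<open>lam \<noteq> []\<close> \<open>lam \<in> even_rows rho\<close> that by (auto simp: even_rows_def)
    moreover have "0 < length rho - 1"
      using \<open>lam \<noteq> []\<close> 3[OF \<open>lam \<in> even_rows rho\<close>] by (metis length_greater_0_conv)
    ultimately have "lam ! 0 \<le> rho ! 0" by blast
    moreover have "rho \<noteq> []" using \<open>0 < length rho - 1\<close> by auto
    ultimately show ?thesis using \<open>lam \<noteq> []\<close> by (simp add: hd_conv_nth)
  qed
  show ?thesis (is "?L \<longleftrightarrow> ?R")
  proof
    assume L: ?L
    then have rho: "rho \<noteq> []" "lam \<in> even_rows rho" "rho \<in> odd_rows nu" "nu \<noteq> [] \<longrightarrow> hd nu \<le> u"
      by (auto simp: odd_rows_Cons_iff even_rows_Cons_iff)
    then have "length nu = Suc k"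
      using L 3 4 by (cases rho) (auto simp: partitions_below_def)
    then show ?R using L rho 2 by (simp add: partitions_below_iff)
  next
    assume R: ?R
    then have len: "length rho = Suc k" "length lam = k" using 3 4 by (auto simp: partitions_below_def)
    then have ne: "rho \<noteq> []" "nu \<noteq> []" using R 4 by auto
    have "hd nu \<le> u" using R ne by (simp add: partitions_below_iff)
    then show ?L
      using R len ne 1 5 6 by (fastforce simp: odd_rows_Cons_iff even_rows_Cons_iff partitions_below_iff)
  qed
qed

lemma sum_triple_exchange:
  assumes "finite A" "\<And>x. finite (B x)" "\<And>y. finite (C y)" "finite A'" "\<And>z. finite (B' z)" "\<And>y. finite (C' y)"
    and "\<And>x y z. x \<in> A \<and> y \<in> B x \<and> z \<in> C y \<longleftrightarrow> z \<in> A' \<and> y \<in> B' z \<and> x \<in> C' y"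
  shows "(\<Sum>x\<in>A. \<Sum>y\<in>B x. \<Sum>z\<in>C y. f x y z) = (\<Sum>z\<in>A'. \<Sum>y\<in>B' z. \<Sum>x\<in>C' y. f x y z)"
proof -
  have d: "x \<in> A \<Longrightarrow> y \<in> B x \<Longrightarrow> z \<in> C y \<Longrightarrow> z \<in> A' \<and> y \<in> B' z \<and> x \<in> C' y"
    "z \<in> A' \<Longrightarrow> y \<in> B' z \<Longrightarrow> x \<in> C' y \<Longrightarrow> x \<in> A \<and> y \<in> B x \<and> z \<in> C y" for x y z
    using assms(7) by blast+
  have "(\<Sum>x\<in>A. \<Sum>y\<in>B x. \<Sum>z\<in>C y. f x y z) = (\<Sum>(x, y, z)\<in>Sigma A (\<lambda>x. Sigma (B x) C). f x y z)"
    using assms by (simp add: sum.Sigma finite_SigmaI)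
  also have "\<dots> = (\<Sum>(z, y, x)\<in>Sigma A' (\<lambda>z. Sigma (B' z) C'). f x y z)"
  proof (rule sum.reindex_bij_witness[of _ "\<lambda>(z, y, x). (x, y, z)" "\<lambda>(x, y, z). (z, y, x)"])
    fix t assume "t \<in> Sigma A (\<lambda>x. Sigma (B x) C)"
    then obtain x y z where t: "t = (x, y, z)" "x \<in> A" "y \<in> B x" "z \<in> C y" by auto
    then show "(case t of (x, y, z) \<Rightarrow> (z, y, x)) \<in> Sigma A' (\<lambda>z. Sigma (B' z) C')"
      using d(1)[of x y z] by simp
  next
    fix t assume "t \<in> Sigma A' (\<lambda>z. Sigma (B' z) C')"
    then obtain x y z where t: "t = (z, y, x)" "z \<in> A'" "y \<in> B' z" "x \<in> C' y" by auto
    then show "(case t of (z, y, x) \<Rightarrow> (x, y, z)) \<in> Sigma A (\<lambda>x. Sigma (B x) C)"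
      using d(2)[of z y x] by simp
  qed auto
  also have "\<dots> = (\<Sum>z\<in>A'. \<Sum>y\<in>B' z. \<Sum>x\<in>C' y. f x y z)"
    using assms by (simp add: sum.Sigma finite_SigmaI)
  finally show ?thesis .
qed

lemma cb_near_rectangle_Suc:
  assumes "length lam = k" "n = a + Suc k"
  shows "cb b x (Suc n) (replicate (Suc (Suc a)) u @ lam) =
    (\<Sum>rho\<in>odd_rows (u # lam). \<Sum>nu\<in>even_rows (u # rho).
      (if 0 < rho ! k then 1 + b * x n else 1) *
      x n powi (int (sum_list lam) + int (sum_list nu) - 2 * int (sum_list rho)) * cb b x n (replicate a u @ nu))"
proof -
  have inj: "inj_on ((@) ws) S" for ws :: "nat list" and S by (auto simp: inj_on_def)
  have "replicate (Suc (Suc a)) u @ lam = replicate (Suc a) u @ u # lam"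
    by (simp add: replicate_app_Cons_same)
  then have "cb b x (Suc n) (replicate (Suc (Suc a)) u @ lam) =
    (\<Sum>rho\<in>odd_rows (u # lam). \<Sum>nu\<in>even_rows (replicate a u @ u # rho).
      (if 0 < (replicate (Suc a) u @ rho) ! n then 1 + b * x n else 1) *
      x n powi (int (sum_list (replicate (Suc (Suc a)) u @ lam)) + int (sum_list nu) - 2 * int (sum_list (replicate (Suc a) u @ rho))) *
      cb b x n nu)"
    by (simp only: cb.simps odd_rows_append_replicate sum.reindex[OF inj] o_def)
      (simp add: replicate_app_Cons_same)
  also have "\<dots> = (\<Sum>rho\<in>odd_rows (u # lam). \<Sum>nu\<in>even_rows (u # rho).
      (if 0 < rho ! k then 1 + b * x n else 1) *
      x n powi (int (sum_list lam) + int (sum_list nu) - 2 * int (sum_list rho)) * cb b x n (replicate a u @ nu))"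
  proof (rule sum.cong[OF refl])
    fix rho
    have "(replicate (Suc a) u @ rho) ! n = rho ! k"
      using assms by (simp add: nth_append)
    moreover have "int (sum_list (replicate (Suc (Suc a)) u @ lam)) + int (sum_list (replicate a u @ nu)) -
        2 * int (sum_list (replicate (Suc a) u @ rho)) = int (sum_list lam) + int (sum_list nu) - 2 * int (sum_list rho)" for nu
      by (simp add: sum_list_replicate algebra_simps)
    ultimately show "(\<Sum>nu\<in>even_rows (replicate a u @ u # rho).
      (if 0 < (replicate (Suc a) u @ rho) ! n then 1 + b * x n else 1) *
      x n powi (int (sum_list (replicate (Suc (Suc a)) u @ lam)) + int (sum_list nu) - 2 * int (sum_list (replicate (Suc a) u @ rho))) *
      cb b x n nu) = (\<Sum>nu\<in>even_rows (u # rho).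
      (if 0 < rho ! k then 1 + b * x n else 1) *
      x n powi (int (sum_list lam) + int (sum_list nu) - 2 * int (sum_list rho)) * cb b x n (replicate a u @ nu))"
      by (simp only: even_rows_append_replicate sum.reindex[OF inj] o_def)
  qed
  finally show ?thesis .
qed

text \<open>Each peeled pair of rows becomes the new top of the second pattern, so the last variable
  of the rectangle is the first one there. This explains the argument
  \<open>N - Suc i\<close>.\<close>

theorem cb_rectangle_split:
  assumes "2 * k \<le> N"
  shows "cb b x N (replicate N u) =
    (\<Sum>lam\<in>partitions_below u k. cb b x (N - k) (replicate (N - 2 * k) u @ lam) * cb b (\<lambda>i. x (N - Suc i)) k lam)"
  using assms
proof (induction k)
  case (Suc k)
  define n a where "n = N - Suc k" and "a = N - 2 * Suc k"
  have N: "N - k = Suc n" "N - 2 * k = Suc (Suc a)" "n = a + Suc k"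
    using Suc.prems by (auto simp: n_def a_def)
  let ?y = "\<lambda>i. x (N - Suc i)"
  define w where "w rho lam nu = (if 0 < rho ! k then 1 + b * x n else 1) *
      x n powi (int (sum_list lam) + int (sum_list nu) - 2 * int (sum_list rho))" for rho lam nu :: "nat list"
  have "cb b x N (replicate N u) =
      (\<Sum>lam\<in>partitions_below u k. cb b x (Suc n) (replicate (Suc (Suc a)) u @ lam) * cb b ?y k lam)"
    using Suc by (simp add: N del: cb.simps replicate_Suc)
  also have "\<dots> = (\<Sum>lam\<in>partitions_below u k. \<Sum>rho\<in>odd_rows (u # lam). \<Sum>nu\<in>even_rows (u # rho).
      w rho lam nu * cb b x n (replicate a u @ nu) * cb b ?y k lam)"
  proof (rule sum.cong[OF refl])
    fix lam assume "lam \<in> partitions_below u k"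
    then have len: "length lam = k" by (simp add: partitions_below_def)
    show "cb b x (Suc n) (replicate (Suc (Suc a)) u @ lam) * cb b ?y k lam =
      (\<Sum>rho\<in>odd_rows (u # lam). \<Sum>nu\<in>even_rows (u # rho).
      w rho lam nu * cb b x n (replicate a u @ nu) * cb b ?y k lam)"
      unfolding cb_near_rectangle_Suc[OF len N(3)] w_def by (simp only: sum_distrib_right)
  qed
  also have "\<dots> = (\<Sum>nu\<in>partitions_below u (Suc k). \<Sum>rho\<in>odd_rows nu. \<Sum>lam\<in>even_rows rho.
      w rho lam nu * cb b x n (replicate a u @ nu) * cb b ?y k lam)"
    by (rule sum_triple_exchange) (simp_all add: interlacing_exchange)
  also have "\<dots> = (\<Sum>nu\<in>partitions_below u (Suc k). cb b x n (replicate a u @ nu) * cb b ?y (Suc k) nu)"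
    unfolding cb.simps w_def n_def[symmetric] sum_distrib_left
    by (intro sum.cong refl) (simp only: mult_ac add.commute)
  finally show ?case unfolding n_def a_def .
qed simp

lemma cb_reverse_variables:
  assumes "\<And>j. j < k \<Longrightarrow> 0 < x j \<and> x j < 1" "lam \<in> partitions_below u k"
  shows "cb b (\<lambda>i. x (k - Suc i)) k lam = cb b x k lam"
proof -
  define p where "p i = (if i < k then k - Suc i else i)" for i
  have "p permutes {..<k}"
    by (rule bij_imp_permutes, rule bij_betwI[of _ _ _ p]) (auto simp: p_def)
  then have "cb b (x \<circ> p) k lam = cb b x k lam"
    using assms by (intro cb_symmetric) (auto simp: partitions_below_def sorted_ge_iff_nth_Suc)
  moreover have "cb b (x \<circ> p) k lam = cb b (\<lambda>i. x (k - Suc i)) k lam"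
    by (rule cb_cong) (simp add: p_def)
  ultimately show ?thesis by simp
qed

section \<open>Split orthogonal patterns\<close>

definition half_shift :: "bool \<Rightarrow> real" where
  "half_shift half = (if half then 1 / 2 else 0)"

definition shifted :: "bool \<Rightarrow> nat list \<Rightarrow> real list" where
  "shifted half lam = map (\<lambda>k. real k + half_shift half) lam"

lemma length_shifted [simp]: "length (shifted half lam) = length lam"
  by (simp add: shifted_def)

lemma nth_shifted [simp]: "i < length lam \<Longrightarrow> shifted half lam ! i = real (lam ! i) + half_shift half"
  by (simp add: shifted_def)

lemma inj_shifted: "inj (shifted half)"
  unfolding shifted_def by (rule inj_mapI) (auto simp: inj_def)

lemma half_plus_nat_notin_Ints: "real k + 1 / 2 \<notin> \<int>"
proof
  assume "real k + 1 / 2 \<in> \<int>"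
  then obtain z where "real k + 1 / 2 = of_int z" by (elim Ints_cases)
  then have "of_int (2 * int k + 1) = (of_int (2 * z) :: real)" by simp
  then have "2 * int k + 1 = 2 * z" by (simp only: of_int_eq_iff)
  then show False by presburger
qed

lemma Ints_shift_iff: "real k + half_shift half \<in> \<int> \<longleftrightarrow> \<not> half"
  using half_plus_nat_notin_Ints[of k] by (auto simp: half_shift_def)

lemma half_integer_shift_iff: "is_half_integer (real k + half_shift half) \<longleftrightarrow> half"
proof (cases half)
  case False
  have "real k - 1 / 2 \<notin> \<int>"
  proof
    assume "real k - 1 / 2 \<in> \<int>"
    then have "real k - 1 / 2 + 1 \<in> \<int>" by (intro Ints_add) auto
    then show False using half_plus_nat_notin_Ints[of k] by simp
  qed
  with False show ?thesis by (simp add: is_half_integer_def half_shift_def)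
qed (simp add: is_half_integer_def half_shift_def)

lemma Nats_shift_unique:
  assumes "real k + half_shift half - half_shift half' \<in> \<nat>"
  shows "half = half'"
proof -
  obtain q where "real k + half_shift half - half_shift half' = real q" using assms by (elim Nats_cases)
  then have "real k + half_shift half = real q + half_shift half'" by simp
  then show ?thesis using Ints_shift_iff[of k half] Ints_shift_iff[of q half'] by simp
qed

text \<open>One alternative of the disjunction in \<open>split_orthogonal_pattern\<close>. The
  inequalities are indexed by the lower of two consecutive rows, which suits an induction on the
  height.\<close>

definition pattern_of_class :: "bool \<Rightarrow> nat \<Rightarrow> (nat \<Rightarrow> nat \<Rightarrow> real) \<Rightarrow> bool" where
  "pattern_of_class half n z \<longleftrightarrow>
     (\<forall>i j. (i, j) \<notin> pattern_index n \<longrightarrow> z i j = 0) \<and>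
     (\<forall>i j. 1 \<le> i \<and> i < 2 * n \<and> 1 \<le> j \<and> j \<le> (i + 1) div 2 \<longrightarrow>
        z i j \<le> z (i + 1) j \<and> (j < (i + 2) div 2 \<longrightarrow> z (i + 1) (j + 1) \<le> z i j)) \<and>
     (\<forall>(i, j)\<in>odd_ends n. 2 * z i j \<in> \<nat>) \<and>
     (\<forall>(i, j)\<in>pattern_index n - odd_ends n. z i j - half_shift half \<in> \<nat>)"

lemma split_orthogonal_pattern_iff:
  "split_orthogonal_pattern n z \<longleftrightarrow> pattern_of_class False n z \<or> pattern_of_class True n z"
proof -
  have "((\<forall>i j. (i, j) \<in> pattern_index n \<and> (i + 1, j + 1) \<in> pattern_index n \<longrightarrow> z (i + 1) (j + 1) \<le> z i j) \<and>
     (\<forall>i j. (i, j) \<in> pattern_index n \<and> (i + 1, j) \<in> pattern_index n \<longrightarrow> z i j \<le> z (i + 1) j)) \<longleftrightarrow>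
     (\<forall>i j. 1 \<le> i \<and> i < 2 * n \<and> 1 \<le> j \<and> j \<le> (i + 1) div 2 \<longrightarrow>
        z i j \<le> z (i + 1) j \<and> (j < (i + 2) div 2 \<longrightarrow> z (i + 1) (j + 1) \<le> z i j))" (is "?A \<longleftrightarrow> ?B")
  proof
    assume A: ?A
    show ?B
    proof (intro allI impI)
      fix i j assume ij: "1 \<le> i \<and> i < 2 * n \<and> 1 \<le> j \<and> j \<le> (i + 1) div 2"
      then have "(i, j) \<in> pattern_index n" "(i + 1, j) \<in> pattern_index n"
        "j < (i + 2) div 2 \<Longrightarrow> (i + 1, j + 1) \<in> pattern_index n"
        by (auto simp: pattern_index_def)
      then show "z i j \<le> z (i + 1) j \<and> (j < (i + 2) div 2 \<longrightarrow> z (i + 1) (j + 1) \<le> z i j)"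
        using A by blast
    qed
  next
    assume B: ?B
    show ?A
    proof (intro conjI allI impI)
      fix i j assume "(i, j) \<in> pattern_index n \<and> (i + 1, j + 1) \<in> pattern_index n"
      then have "1 \<le> i \<and> i < 2 * n \<and> 1 \<le> j \<and> j \<le> (i + 1) div 2" "j < (i + 2) div 2"
        by (auto simp: pattern_index_def)
      then show "z (i + 1) (j + 1) \<le> z i j" using B by blast
    next
      fix i j assume "(i, j) \<in> pattern_index n \<and> (i + 1, j) \<in> pattern_index n"
      then have "1 \<le> i \<and> i < 2 * n \<and> 1 \<le> j \<and> j \<le> (i + 1) div 2"
        by (auto simp: pattern_index_def)
      then show "z i j \<le> z (i + 1) j" using B by blast
    qed
  qed
  note inter = this
  have sh: "(\<forall>(i, j)\<in>A. z i j - half_shift False \<in> \<nat>) \<longleftrightarrow> (\<forall>(i, j)\<in>A. z i j \<in> \<nat>)"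
    "(\<forall>(i, j)\<in>A. z i j - half_shift True \<in> \<nat>) \<longleftrightarrow> (\<forall>(i, j)\<in>A. z i j - 1 / 2 \<in> \<nat>)" for A
    by (simp_all add: half_shift_def)
  have taut: "(a \<and> b \<and> c \<and> d \<and> (e \<or> f)) = ((a \<and> (b \<and> c) \<and> d \<and> e) \<or> (a \<and> (b \<and> c) \<and> d \<and> f))" for a b c d e f
    by blast
  show ?thesis
    unfolding split_orthogonal_pattern_def pattern_of_class_def inter[symmetric] sh by (rule taut)
qed

text \<open>The first entry of the top row is never an odd end and therefore decides the class. In
  height 0 both classes consist of the zero array.\<close>

lemma patterns_of_shape_shifted:
  assumes "length lam = n"
  shows "patterns_of_shape n (shifted half lam) =
    {z. pattern_of_class half n z \<and> (\<forall>j\<in>{1..n}. z (2 * n) j = real (lam ! (j - 1)) + half_shift half)}"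
proof -
  have "pattern_of_class half n z"
    if z: "pattern_of_class half' n z" and row: "\<forall>j\<in>{1..n}. z (2 * n) j = real (lam ! (j - 1)) + half_shift half" for z half'
  proof (cases "n = 0")
    case True
    with z show ?thesis by (simp add: pattern_of_class_def pattern_index_def)
  next
    case False
    have "(2 * n, 1) \<in> pattern_index n - odd_ends n"
    proof -
      have "2 * n \<noteq> 2 * i - 1" if "1 \<le> i" for i using that by presburger
      then show ?thesis using False by (auto simp: pattern_index_def odd_ends_def)
    qed
    then have "z (2 * n) 1 - half_shift half' \<in> \<nat>" using z unfolding pattern_of_class_def by blast
    moreover have "z (2 * n) 1 = real (lam ! 0) + half_shift half" using row False by simp
    ultimately have "half = half'" using Nats_shift_unique by metis
    then show ?thesis using z by simp
  qed
  moreover have "(\<forall>j\<in>{1..n}. z (2 * n) j = shifted half lam ! (j - 1)) \<longleftrightarrow>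
      (\<forall>j\<in>{1..n}. z (2 * n) j = real (lam ! (j - 1)) + half_shift half)" for z :: "nat \<Rightarrow> nat \<Rightarrow> real"
    using assms by (intro ball_cong refl) auto
  ultimately show ?thesis
    unfolding patterns_of_shape_def split_orthogonal_pattern_iff by (cases half) auto
qed

text \<open>The component \<open>nu\<close> repeats the top row of \<open>z\<close>. Carrying it
  along makes the domain an iterated dependent sum over the index sets that occur in
  \<open>cb\<close>. The odd end is stored as its rounded-up value \<open>rho ! n\<close> together
  with twice the amount \<open>a\<close> of the rounding.\<close>

definition add_rows :: "bool \<Rightarrow> nat \<Rightarrow> nat list \<Rightarrow> nat list \<times> nat \<times> nat list \<times> (nat \<Rightarrow> nat \<Rightarrow> real) \<Rightarrow> nat \<Rightarrow> nat \<Rightarrow> real" where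
  "add_rows half n lam = (\<lambda>(rho, a, nu, z) i j.
     if i \<le> 2 * n then z i j
     else if i = 2 * n + 1 \<and> 1 \<le> j \<and> j \<le> Suc n
       then real (rho ! (j - 1)) + half_shift half - (if j = Suc n then real a / 2 else 0)
     else if i = 2 * n + 2 \<and> 1 \<le> j \<and> j \<le> Suc n then real (lam ! (j - 1)) + half_shift half
     else 0)"

text \<open>
  The last entry of an odd row is \<open>k + half_shift half - a / 2\<close> with \<open>a \<in> {0, 1}\<close>; it is atypical iff \<open>a = 1\<close>.
\<close>

definition end_shifts :: "bool \<Rightarrow> nat \<Rightarrow> nat set" where
  "end_shifts half k = (if half \<or> 0 < k then {0, 1} else {0})"

lemma odd_end_cases:
  assumes "2 * t \<in> \<nat>"
  obtains k a where "a \<in> end_shifts half k" "t = real k + half_shift half - real a / 2"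
proof -
  obtain q where q: "2 * t = real q" using assms by (elim Nats_cases)
  show ?thesis
  proof (cases half)
    case True
    show ?thesis
    proof (cases "even q")
      case True
      then obtain k where "q = 2 * k" by (elim evenE)
      with q \<open>half\<close> show ?thesis by (intro that[of 1 k]) (auto simp: end_shifts_def half_shift_def)
    next
      case False
      then obtain k where "q = 2 * k + 1" by (elim oddE)
      with q \<open>half\<close> show ?thesis by (intro that[of 0 k]) (auto simp: end_shifts_def half_shift_def)
    qed
  next
    case False
    show ?thesis
    proof (cases "even q")
      case True
      then obtain k where "q = 2 * k" by (elim evenE)
      with q False show ?thesis by (intro that[of 0 k]) (auto simp: end_shifts_def half_shift_def)
    next
      case odd: False
      then obtain k where "q = 2 * k + 1" by (elim oddE)
      with q False show ?thesis by (intro that[of 1 "Suc k"]) (auto simp: end_shifts_def half_shift_def)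
    qed
  qed
qed

lemma odd_end_unique:
  assumes "a \<in> {0, 1}" "a' \<in> {0, 1}" "real k - real a / 2 = real k' - real a' / 2"
  shows "k = k' \<and> a = a'"
proof -
  have "real (2 * k + a') = real (2 * k' + a)" using assms(3) by simp
  then have "2 * k + a' = 2 * k' + a" by (simp only: of_nat_eq_iff)
  then show ?thesis using assms(1,2) by (auto; presburger)
qed

lemma end_shifts_subset: "end_shifts half k \<subseteq> {0, 1}"
  by (auto simp: end_shifts_def)

lemma odd_end_nonneg:
  assumes "a \<in> end_shifts half k"
  shows "2 * (real k + half_shift half - real a / 2) \<in> \<nat>"
proof -
  have "2 * (real k + half_shift half - real a / 2) = real (2 * k + (if half then 1 else 0) - a)"
    using assms by (auto simp: end_shifts_def half_shift_def split: if_splits)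
  then show ?thesis by (metis of_nat_in_Nats)
qed

lemma pattern_index_Suc:
  "(i, j) \<in> pattern_index (Suc n) \<longleftrightarrow> (i, j) \<in> pattern_index n \<or> (i = 2 * n + 1 \<or> i = 2 * n + 2) \<and> 1 \<le> j \<and> j \<le> Suc n"
  by (auto simp: pattern_index_def)

lemma odd_ends_Suc: "(i, j) \<in> odd_ends (Suc n) \<longleftrightarrow> (i, j) \<in> odd_ends n \<or> i = 2 * n + 1 \<and> j = Suc n"
  by (auto simp: odd_ends_def le_Suc_eq)

lemma odd_ends_subset: "odd_ends n \<subseteq> pattern_index n"
  by (auto simp: pattern_index_def odd_ends_def)

text \<open>The odd end of row \<open>2 * n + 1\<close> occurs in upper bounds of the interlacing
  only. This is why it can be rounded up to the class of its neighbours without changing the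
  interlacing conditions.\<close>

lemma pattern_of_class_Suc:
  "pattern_of_class half (Suc n) z \<longleftrightarrow>
     pattern_of_class half n (\<lambda>i j. if i \<le> 2 * n then z i j else 0) \<and>
     (\<forall>i j. 2 * n < i \<and> (i, j) \<notin> pattern_index (Suc n) \<longrightarrow> z i j = 0) \<and>
     (\<forall>j\<in>{1..n}. z (2 * n + 1) (j + 1) \<le> z (2 * n) j \<and> z (2 * n) j \<le> z (2 * n + 1) j) \<and>
     (\<forall>j\<in>{1..n}. z (2 * n + 2) (j + 1) \<le> z (2 * n + 1) j) \<and>
     (\<forall>j\<in>{1..Suc n}. z (2 * n + 1) j \<le> z (2 * n + 2) j) \<and>
     2 * z (2 * n + 1) (Suc n) \<in> \<nat> \<and>
     (\<forall>j\<in>{1..n}. z (2 * n + 1) j - half_shift half \<in> \<nat>) \<and>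
     (\<forall>j\<in>{1..Suc n}. z (2 * n + 2) j - half_shift half \<in> \<nat>)" (is "?L \<longleftrightarrow> ?R")
proof -
  let ?z = "\<lambda>i j. if i \<le> 2 * n then z i j else 0"
  have le: "i \<le> 2 * n" if "(i, j) \<in> pattern_index n" for i j using that by (simp add: pattern_index_def)
  have lo: "i \<le> 2 * n" if "(i, j) \<in> odd_ends n" for i j using that le odd_ends_subset by blast
  define Q where "Q i j \<longleftrightarrow> z i j \<le> z (i + 1) j \<and> (j < (i + 2) div 2 \<longrightarrow> z (i + 1) (j + 1) \<le> z i j)" for i j
  have supp: "(\<forall>i j. (i, j) \<notin> pattern_index (Suc n) \<longrightarrow> z i j = 0) \<longleftrightarrow>
      (\<forall>i j. (i, j) \<notin> pattern_index n \<longrightarrow> ?z i j = 0) \<and>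
      (\<forall>i j. 2 * n < i \<and> (i, j) \<notin> pattern_index (Suc n) \<longrightarrow> z i j = 0)"
  proof (intro iffI conjI allI impI)
    fix i j assume z: "\<forall>i j. (i, j) \<notin> pattern_index (Suc n) \<longrightarrow> z i j = 0" and ij: "(i, j) \<notin> pattern_index n"
    show "?z i j = 0" using z ij by (cases "i \<le> 2 * n") (auto simp: pattern_index_Suc)
  next
    fix i j
    assume z: "(\<forall>i j. (i, j) \<notin> pattern_index n \<longrightarrow> ?z i j = 0) \<and>
        (\<forall>i j. 2 * n < i \<and> (i, j) \<notin> pattern_index (Suc n) \<longrightarrow> z i j = 0)"
      and ij: "(i, j) \<notin> pattern_index (Suc n)"
    show "z i j = 0"
    proof (cases "i \<le> 2 * n")
      case True
      have "(i, j) \<notin> pattern_index n" using ij by (simp add: pattern_index_Suc)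
      then have "?z i j = 0" using z by blast
      with True show ?thesis by simp
    next
      case False
      then show ?thesis using z ij by simp
    qed
  qed blast
  have inter: "(\<forall>i j. 1 \<le> i \<and> i < 2 * Suc n \<and> 1 \<le> j \<and> j \<le> (i + 1) div 2 \<longrightarrow> Q i j) \<longleftrightarrow>
      (\<forall>i j. 1 \<le> i \<and> i < 2 * n \<and> 1 \<le> j \<and> j \<le> (i + 1) div 2 \<longrightarrow>
        ?z i j \<le> ?z (i + 1) j \<and> (j < (i + 2) div 2 \<longrightarrow> ?z (i + 1) (j + 1) \<le> ?z i j)) \<and>
      (\<forall>j\<in>{1..n}. Q (2 * n) j) \<and> (\<forall>j\<in>{1..Suc n}. Q (2 * n + 1) j)" (is "?A \<longleftrightarrow> ?B1 \<and> ?B2 \<and> ?B3")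
  proof
    assume A: ?A
    have "?B1" using A unfolding Q_def by auto
    moreover have "?B2" using A by auto
    moreover have "?B3" using A by auto
    ultimately show "?B1 \<and> ?B2 \<and> ?B3" by blast
  next
    assume B: "?B1 \<and> ?B2 \<and> ?B3"
    show ?A
    proof (intro allI impI)
      fix i j assume ij: "1 \<le> i \<and> i < 2 * Suc n \<and> 1 \<le> j \<and> j \<le> (i + 1) div 2"
      then have "i < 2 * n \<or> i = 2 * n \<or> i = 2 * n + 1" by auto
      then show "Q i j"
      proof (elim disjE)
        assume "i < 2 * n"
        then show ?thesis using B ij unfolding Q_def by auto
      next
        assume "i = 2 * n"
        then show ?thesis using B ij by auto
      next
        assume "i = 2 * n + 1"
        then show ?thesis using B ij by auto
      qed
    qed
  qed
  have ends: "(\<forall>(i, j)\<in>odd_ends (Suc n). 2 * z i j \<in> \<nat>) \<longleftrightarrow>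
      (\<forall>(i, j)\<in>odd_ends n. 2 * ?z i j \<in> \<nat>) \<and> 2 * z (2 * n + 1) (Suc n) \<in> \<nat>"
    using lo by (auto simp: Ball_def odd_ends_Suc)
  have cls: "(\<forall>(i, j)\<in>pattern_index (Suc n) - odd_ends (Suc n). z i j - half_shift half \<in> \<nat>) \<longleftrightarrow>
      (\<forall>(i, j)\<in>pattern_index n - odd_ends n. ?z i j - half_shift half \<in> \<nat>) \<and>
      (\<forall>j\<in>{1..n}. z (2 * n + 1) j - half_shift half \<in> \<nat>) \<and> (\<forall>j\<in>{1..Suc n}. z (2 * n + 2) j - half_shift half \<in> \<nat>)"
    (is "?A \<longleftrightarrow> ?B1 \<and> ?B2 \<and> ?B3")
  proof -
    have "(i, j) \<in> pattern_index (Suc n) - odd_ends (Suc n) \<longleftrightarrow>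
        (i, j) \<in> pattern_index n - odd_ends n \<or> i = 2 * n + 1 \<and> j \<in> {1..n} \<or> i = 2 * n + 2 \<and> j \<in> {1..Suc n}" for i j
    proof -
      have "(i, j) \<notin> odd_ends n" if "2 * n < i" using lo[of i j] that by auto
      moreover have "(i, j) \<notin> pattern_index n" if "2 * n < i" using le[of i j] that by auto
      moreover have "i \<le> 2 * n" if "(i, j) \<in> pattern_index n" using le that by auto
      ultimately show ?thesis
        unfolding pattern_index_Suc odd_ends_Suc Diff_iff by auto
    qed
    then have "?A \<longleftrightarrow> (\<forall>i j. (i, j) \<in> pattern_index n - odd_ends n \<or> i = 2 * n + 1 \<and> j \<in> {1..n} \<or>
        i = 2 * n + 2 \<and> j \<in> {1..Suc n} \<longrightarrow> z i j - half_shift half \<in> \<nat>)"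
      unfolding Ball_def split_paired_All by simp
    also have "\<dots> \<longleftrightarrow> (\<forall>i j. (i, j) \<in> pattern_index n - odd_ends n \<longrightarrow> z i j - half_shift half \<in> \<nat>) \<and> ?B2 \<and> ?B3"
      by blast
    also have "(\<forall>i j. (i, j) \<in> pattern_index n - odd_ends n \<longrightarrow> z i j - half_shift half \<in> \<nat>) \<longleftrightarrow> ?B1"
      by (auto simp: Ball_def dest: le)
    finally show ?thesis .
  qed
  have Q: "(\<forall>j\<in>{1..n}. Q (2 * n) j) \<longleftrightarrow> (\<forall>j\<in>{1..n}. z (2 * n + 1) (j + 1) \<le> z (2 * n) j \<and> z (2 * n) j \<le> z (2 * n + 1) j)"
    "(\<forall>j\<in>{1..Suc n}. Q (2 * n + 1) j) \<longleftrightarrow> (\<forall>j\<in>{1..n}. z (2 * n + 2) (j + 1) \<le> z (2 * n + 1) j) \<and>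
     (\<forall>j\<in>{1..Suc n}. z (2 * n + 1) j \<le> z (2 * n + 2) j)"
    unfolding Q_def by auto
  show ?thesis
    unfolding pattern_of_class_def Q_def[symmetric] supp inter ends cls Q by blast
qed

lemma finite_end_shifts [simp]: "finite (end_shifts half k)"
  by (simp add: end_shifts_def)

lemma add_rows_simps:
  "i \<le> 2 * n \<Longrightarrow> add_rows half n lam (rho, a, nu, z) i j = z i j"
  "1 \<le> j \<Longrightarrow> j \<le> n \<Longrightarrow> add_rows half n lam (rho, a, nu, z) (2 * n + 1) j = real (rho ! (j - 1)) + half_shift half"
  "add_rows half n lam (rho, a, nu, z) (2 * n + 1) (Suc n) = real (rho ! n) + half_shift half - real a / 2"
  "1 \<le> j \<Longrightarrow> j \<le> Suc n \<Longrightarrow> add_rows half n lam (rho, a, nu, z) (2 * n + 2) j = real (lam ! (j - 1)) + half_shift half"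
  "2 * n < i \<Longrightarrow> (i, j) \<notin> pattern_index (Suc n) \<Longrightarrow> add_rows half n lam (rho, a, nu, z) i j = 0"
  by (auto simp: add_rows_def pattern_index_Suc)

lemma odd_rows_nth:
  assumes "rho \<in> odd_rows lam" "length lam = Suc n"
  shows "length rho = Suc n" "i \<le> n \<Longrightarrow> rho ! i \<le> lam ! i" "i < n \<Longrightarrow> lam ! Suc i \<le> rho ! i"
  using assms by (auto simp: odd_rows_def less_Suc_eq_le split: if_splits)

lemma even_rows_nth:
  assumes "nu \<in> even_rows rho" "length rho = Suc n"
  shows "length nu = n" "i < n \<Longrightarrow> nu ! i \<le> rho ! i" "i < n \<Longrightarrow> rho ! Suc i \<le> nu ! i"
  using assms by (auto simp: even_rows_def)

lemma add_rows_in_patterns: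
  assumes lam: "length lam = Suc n" and rho: "rho \<in> odd_rows lam" and a: "a \<in> end_shifts half (rho ! n)"
    and nu: "nu \<in> even_rows rho" and z: "z \<in> patterns_of_shape n (shifted half nu)"
  shows "add_rows half n lam (rho, a, nu, z) \<in> patterns_of_shape (Suc n) (shifted half lam)"
proof -
  note r = odd_rows_nth[OF rho lam] and v = even_rows_nth[OF nu odd_rows_nth(1)[OF rho lam]]
  define Z where "Z = add_rows half n lam (rho, a, nu, z)"
  note Z = add_rows_simps[where half = half and n = n and lam = lam and rho = rho and a = a and nu = nu and z = z, folded Z_def]
  have z': "pattern_of_class half n z" "\<And>j. 1 \<le> j \<Longrightarrow> j \<le> n \<Longrightarrow> z (2 * n) j = real (nu ! (j - 1)) + half_shift half"
    using z v(1) by (auto simp: patterns_of_shape_shifted)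
  have "(\<lambda>i j. if i \<le> 2 * n then Z i j else 0) = z"
  proof (intro ext)
    fix i j
    have "z i j = 0" if "\<not> i \<le> 2 * n"
      using z'(1) that unfolding pattern_of_class_def pattern_index_def by auto
    then show "(if i \<le> 2 * n then Z i j else 0) = z i j" by (simp add: Z)
  qed
  moreover have "Z (2 * n + 1) (j + 1) \<le> Z (2 * n) j" "Z (2 * n) j \<le> Z (2 * n + 1) j"
    "Z (2 * n + 2) (j + 1) \<le> Z (2 * n + 1) j" if j: "j \<in> {1..n}" for j
  proof -
    obtain i where i: "j = Suc i" "i < n" using j by (cases j) auto
    show "Z (2 * n) j \<le> Z (2 * n + 1) j"
      using i v(2)[of i] Z(2)[of j] Z(1)[of "2 * n" j] z'(2)[of j] by simp
    show "Z (2 * n + 2) (j + 1) \<le> Z (2 * n + 1) j"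
      using i r(3)[of i] Z(2)[of j] Z(4)[of "j + 1"] by simp
    show "Z (2 * n + 1) (j + 1) \<le> Z (2 * n) j"
      using i v(3)[of i] Z(2)[of "j + 1"] Z(3) Z(1)[of "2 * n" j] z'(2)[of j] by (cases "Suc i = n") auto
  qed
  moreover have "Z (2 * n + 1) j \<le> Z (2 * n + 2) j" if j: "j \<in> {1..Suc n}" for j
  proof -
    obtain i where i: "j = Suc i" "i \<le> n" using j by (cases j) auto
    show ?thesis
      using i r(2)[of i] Z(2)[of j] Z(3) Z(4)[of j] by (cases "i = n") auto
  qed
  moreover have "2 * Z (2 * n + 1) (Suc n) \<in> \<nat>"
    unfolding Z(3) by (rule odd_end_nonneg[OF a])
  moreover have "Z (2 * n + 1) j - half_shift half \<in> \<nat>" if "j \<in> {1..n}" for j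
    using that Z(2)[of j] by simp
  moreover have "Z (2 * n + 2) j - half_shift half \<in> \<nat>" if "j \<in> {1..Suc n}" for j
    using that Z(4)[of j] by simp
  ultimately have "pattern_of_class half (Suc n) Z"
    unfolding pattern_of_class_Suc using z'(1) Z(5) by simp
  moreover have "\<forall>j\<in>{1..Suc n}. Z (2 * Suc n) j = real (lam ! (j - 1)) + half_shift half"
    using Z(4) by simp
  ultimately show ?thesis
    unfolding patterns_of_shape_shifted[OF lam] Z_def by simp
qed

lemma patterns_are_add_rows:
  assumes lam: "length lam = Suc n" and Z: "Z \<in> patterns_of_shape (Suc n) (shifted half lam)"
  shows "\<exists>rho\<in>odd_rows lam. \<exists>a\<in>end_shifts half (rho ! n). \<exists>nu\<in>even_rows rho.
    \<exists>z\<in>patterns_of_shape n (shifted half nu). Z = add_rows half n lam (rho, a, nu, z)"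
proof -
  define z where "z = (\<lambda>i j. if i \<le> 2 * n then Z i j else 0)"
  have pat: "pattern_of_class half (Suc n) Z"
    and top: "\<And>j. 1 \<le> j \<Longrightarrow> j \<le> Suc n \<Longrightarrow> Z (2 * n + 2) j = real (lam ! (j - 1)) + half_shift half"
    using Z unfolding patterns_of_shape_shifted[OF lam] by auto
  note P = pat[unfolded pattern_of_class_Suc, folded z_def]
  have pz: "pattern_of_class half n z" using P by blast
  have Nz: "z i j - half_shift half \<in> \<nat>" if "(i, j) \<in> pattern_index n - odd_ends n" for i j
    using pz bspec[OF _ that] unfolding pattern_of_class_def by auto
  have "\<exists>k. Z (2 * n + 1) j = real k + half_shift half" if "j \<in> {1..n}" for j
  proof -
    have "Z (2 * n + 1) j - half_shift half \<in> \<nat>" using P that by blast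
    then obtain k where "Z (2 * n + 1) j - half_shift half = real k" by (elim Nats_cases)
    then show ?thesis by (intro exI[of _ k]) simp
  qed
  then obtain R where R: "\<And>j. j \<in> {1..n} \<Longrightarrow> Z (2 * n + 1) j = real (R j) + half_shift half" by metis
  have "\<exists>k. Z (2 * n) j = real k + half_shift half" if j: "j \<in> {1..n}" for j
  proof -
    have "2 * n \<noteq> 2 * i - 1" if "1 \<le> i" for i using that by presburger
    then have "(2 * n, j) \<in> pattern_index n - odd_ends n"
      using j by (auto simp: pattern_index_def odd_ends_def)
    then have "z (2 * n) j - half_shift half \<in> \<nat>" by (rule Nz)
    then obtain k where "z (2 * n) j - half_shift half = real k" by (elim Nats_cases)
    then show ?thesis by (intro exI[of _ k]) (simp add: z_def)
  qed
  then obtain V where V: "\<And>j. j \<in> {1..n} \<Longrightarrow> Z (2 * n) j = real (V j) + half_shift half" by metis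
  have "2 * Z (2 * n + 1) (Suc n) \<in> \<nat>" using P by blast
  then obtain k a where a: "a \<in> end_shifts half k" and k: "Z (2 * n + 1) (Suc n) = real k + half_shift half - real a / 2"
    by (rule odd_end_cases)
  \<comment> \<open>Since a/2 is less than 1, every upper bound of the odd end that lies in the
    class is also an upper bound of its rounded-up value.\<close>
  have a1: "a \<le> 1" using a end_shifts_subset[of half k] by auto
  define rho where "rho = map (\<lambda>i. if i < n then R (Suc i) else k) [0..<Suc n]"
  define nu where "nu = map (\<lambda>i. V (Suc i)) [0..<n]"
  have len: "length rho = Suc n" "length nu = n" by (simp_all add: rho_def nu_def)
  have nth_rho: "rho ! i = R (Suc i)" if "i < n" for i
    using that by (simp add: rho_def del: upt_Suc)
  have nth_rho': "rho ! n = k"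
    by (simp add: rho_def del: upt_Suc)
  have nth_nu: "nu ! i = V (Suc i)" if "i < n" for i
    using that by (simp add: nu_def)
  have rho: "rho \<in> odd_rows lam"
  proof -
    have "rho ! i \<le> lam ! i \<and> (i < n \<longrightarrow> lam ! Suc i \<le> rho ! i)" if i: "i \<le> n" for i
    proof (cases "i < n")
      case True
      have "Z (2 * n + 1) (Suc i) \<le> Z (2 * n + 2) (Suc i)" "Z (2 * n + 2) (Suc i + 1) \<le> Z (2 * n + 1) (Suc i)"
        using P True by auto
      then show ?thesis using R[of "Suc i"] top[of "Suc i"] top[of "Suc i + 1"] True by (simp add: nth_rho)
    next
      case False
      then have "i = n" using i by simp
      moreover have "Z (2 * n + 1) (Suc n) \<le> Z (2 * n + 2) (Suc n)" using P by auto
      ultimately show ?thesis using k top[of "Suc n"] a1 by (simp add: nth_rho')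
    qed
    then show ?thesis using lam by (simp add: odd_rows_def len less_Suc_eq_le)
  qed
  have nu: "nu \<in> even_rows rho"
  proof -
    have "rho ! Suc i \<le> nu ! i \<and> nu ! i \<le> rho ! i" if i: "i < n" for i
    proof -
      have "Z (2 * n + 1) (Suc i + 1) \<le> Z (2 * n) (Suc i)" "Z (2 * n) (Suc i) \<le> Z (2 * n + 1) (Suc i)"
        using P i by auto
      then show ?thesis
        using R[of "Suc i"] R[of "Suc (Suc i)"] V[of "Suc i"] k a1 i nth_rho[of "Suc i"] nth_rho'
        by (cases "Suc i = n") (auto simp: nth_rho nth_nu)
    qed
    then show ?thesis by (simp add: even_rows_def len)
  qed
  have "z \<in> patterns_of_shape n (shifted half nu)"
    unfolding patterns_of_shape_shifted[OF len(2)]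
  proof (intro CollectI conjI ballI)
    show "pattern_of_class half n z" by (rule pz)
    fix j assume j: "j \<in> {1..n}"
    then obtain i where "j = Suc i" "i < n" by (cases j) auto
    then show "z (2 * n) j = real (nu ! (j - 1)) + half_shift half"
      using V[OF j] nth_nu[of i] by (simp add: z_def)
  qed
  moreover have "Z = add_rows half n lam (rho, a, nu, z)"
  proof (intro ext)
    fix i j
    show "Z i j = add_rows half n lam (rho, a, nu, z) i j"
    proof (cases "i \<le> 2 * n")
      case True
      then show ?thesis by (simp add: add_rows_simps z_def)
    next
      case False
      show ?thesis
      proof (cases "(i, j) \<in> pattern_index (Suc n)")
        case True
        then have j: "1 \<le> j" "j \<le> Suc n" and "i = 2 * n + 1 \<or> i = 2 * n + 2"
          using False by (auto simp: pattern_index_def)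
        then show ?thesis
        proof (elim disjE)
          assume i: "i = 2 * n + 1"
          show ?thesis
          proof (cases "j = Suc n")
            case True
            then show ?thesis unfolding i by (simp only: k add_rows_simps nth_rho')
          next
            case False
            then show ?thesis
              unfolding i using j R[of j] nth_rho[of "j - 1"] add_rows_simps(2)[of j n half lam rho a nu z] by simp
          qed
        next
          assume i: "i = 2 * n + 2"
          show ?thesis unfolding i using j top[of j] add_rows_simps(4)[of j n half lam rho a nu z] by simp
        qed
      next
        case out: False
        then have "Z i j = 0" using pat unfolding pattern_of_class_def by blast
        then show ?thesis using False out by (simp add: add_rows_simps)
      qed
    qed
  qed
  ultimately show ?thesis using rho nu a nth_rho' by metis
qed

lemma add_rows_inject:
  assumes lam: "length lam = Suc n"
    and 1: "rho \<in> odd_rows lam" "a \<in> end_shifts half (rho ! n)" "nu \<in> even_rows rho" "z \<in> patterns_of_shape n (shifted half nu)"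
    and 2: "rho' \<in> odd_rows lam" "a' \<in> end_shifts half (rho' ! n)" "nu' \<in> even_rows rho'" "z' \<in> patterns_of_shape n (shifted half nu')"
    and eq: "add_rows half n lam (rho, a, nu, z) = add_rows half n lam (rho', a', nu', z')"
  shows "rho = rho' \<and> a = a' \<and> nu = nu' \<and> z = z'"
proof -
  let ?Z = "add_rows half n lam (rho, a, nu, z)" and ?Z' = "add_rows half n lam (rho', a', nu', z')"
  note len = odd_rows_nth(1)[OF 1(1) lam] odd_rows_nth(1)[OF 2(1) lam]
  note len' = even_rows_nth(1)[OF 1(3) len(1)] even_rows_nth(1)[OF 2(3) len(2)]
  have "?Z (2 * n + 1) (Suc n) = ?Z' (2 * n + 1) (Suc n)" by (simp add: eq)
  then have last: "rho ! n = rho' ! n \<and> a = a'"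
    using odd_end_unique[of a a' "rho ! n" "rho' ! n"] 1(2) 2(2) end_shifts_subset[of half "rho ! n"]
      end_shifts_subset[of half "rho' ! n"] unfolding add_rows_simps by auto
  have rho: "rho = rho'"
  proof (rule nth_equalityI)
    fix i assume i: "i < length rho"
    show "rho ! i = rho' ! i"
    proof (cases "i = n")
      case False
      have "?Z (2 * n + 1) (Suc i) = ?Z' (2 * n + 1) (Suc i)" by (simp add: eq)
      then show ?thesis using False i len add_rows_simps(2)[of "Suc i" n] by simp
    qed (use last in simp)
  qed (use len in simp)
  have zz: "z = z'"
  proof (intro ext)
    fix i j
    have "z i j = 0 \<and> z' i j = 0" if "\<not> i \<le> 2 * n"
    proof -
      have "pattern_of_class half n z" "pattern_of_class half n z'"
        using 1(4) 2(4) len' by (auto simp: patterns_of_shape_shifted)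
      moreover have "(i, j) \<notin> pattern_index n" using that by (simp add: pattern_index_def)
      ultimately show ?thesis unfolding pattern_of_class_def by blast
    qed
    moreover have "z i j = z' i j" if "i \<le> 2 * n"
    proof -
      have "?Z i j = ?Z' i j" by (simp add: eq)
      then show ?thesis using that by (simp add: add_rows_simps)
    qed
    ultimately show "z i j = z' i j" by (cases "i \<le> 2 * n") auto
  qed
  have "nu = nu'"
  proof (rule nth_equalityI)
    fix i assume i: "i < length nu"
    have "z (2 * n) (Suc i) = real (nu ! i) + half_shift half" "z' (2 * n) (Suc i) = real (nu' ! i) + half_shift half"
      using 1(4) 2(4) len' i by (auto simp: patterns_of_shape_shifted)
    then show "nu ! i = nu' ! i" using zz by simp
  qed (use len' in simp)
  then show ?thesis using rho zz last by simp
qed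

lemma atypical_alt:
  assumes "length nu = n" "z \<in> patterns_of_shape n (shifted half nu)"
  shows "atypical n z = {(i, j) \<in> pattern_index n. if half then z i j \<in> \<int> else is_half_integer (z i j)}"
proof (cases "n = 0")
  case True
  then show ?thesis by (auto simp: atypical_def pattern_index_def)
next
  case False
  then have "z (2 * n) 1 = real (nu ! 0) + half_shift half"
    using assms by (auto simp: patterns_of_shape_shifted)
  then show ?thesis by (cases half) (simp_all add: atypical_def Ints_shift_iff)
qed

lemma sum_nth_from_1:
  assumes "length xs = n"
  shows "(\<Sum>j=1..n. real (xs ! (j - 1)) + c) = real (sum_list xs) + real n * c"
proof -
  have "(\<Sum>j=1..n. real (xs ! (j - 1)) + c) = (\<Sum>j<n. real (xs ! j) + c)"
    by (simp add: sum.atLeast1_atMost_eq)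
  also have "\<dots> = real (sum_list xs) + real n * c"
    using assms by (simp add: sum.distrib sum_list_sum_nth lessThan_atLeast0)
  finally show ?thesis .
qed

lemma finite_pattern_index [simp]: "finite (pattern_index n)"
  by (rule finite_subset[of _ "{..2 * n} \<times> {..2 * n}"]) (auto simp: pattern_index_def)

context
  fixes half :: bool and n :: nat and lam rho nu :: "nat list" and a :: nat and z :: "nat \<Rightarrow> nat \<Rightarrow> real"
  assumes lam: "length lam = Suc n" and rho: "rho \<in> odd_rows lam" and a: "a \<in> end_shifts half (rho ! n)"
    and nu: "nu \<in> even_rows rho" and z: "z \<in> patterns_of_shape n (shifted half nu)"
begin

lemma card_atypical_add_rows: "card (atypical (Suc n) (add_rows half n lam (rho, a, nu, z))) = a + card (atypical n z)"
proof -
  note len = odd_rows_nth(1)[OF rho lam] even_rows_nth(1)[OF nu odd_rows_nth(1)[OF rho lam]]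
  define Z where "Z = add_rows half n lam (rho, a, nu, z)"
  note Z = add_rows_simps[where half = half and n = n and lam = lam and rho = rho and a = a and nu = nu and z = z, folded Z_def]
  define aty where "aty t \<longleftrightarrow> (if half then t \<in> \<int> else is_half_integer t)" for t
  have Zpat: "Z \<in> patterns_of_shape (Suc n) (shifted half lam)"
    unfolding Z_def by (rule add_rows_in_patterns[OF lam rho a nu z])
  have 1: "atypical (Suc n) Z = {(i, j) \<in> pattern_index (Suc n). aty (Z i j)}"
    "atypical n z = {(i, j) \<in> pattern_index n. aty (z i j)}"
    unfolding aty_def by (rule atypical_alt[OF lam Zpat], rule atypical_alt[OF len(2) z])
  have typical: "\<not> aty (real k + half_shift half)" for k
    by (simp add: aty_def Ints_shift_iff half_integer_shift_iff)
  have end_aty: "aty (real k + half_shift half - real a / 2) \<longleftrightarrow> a = 1" if "a \<in> end_shifts half k" for k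
  proof (cases "a = 1")
    case True
    show ?thesis
    proof (cases half)
      case True
      with \<open>a = 1\<close> show ?thesis by (simp add: aty_def half_shift_def)
    next
      case False
      then have "is_half_integer (real k - 1 / 2)"
        using \<open>a = 1\<close> that Ints_of_nat[of "k - 1"] by (auto simp: is_half_integer_def of_nat_diff)
      with \<open>a = 1\<close> False show ?thesis by (simp add: aty_def half_shift_def)
    qed
  next
    case False
    then have "a = 0" using end_shifts_subset[of half k] that by auto
    then show ?thesis using typical[of k] by simp
  qed
  have "{(i, j) \<in> pattern_index (Suc n). aty (Z i j)} =
      {(i, j) \<in> pattern_index n. aty (z i j)} \<union> (if a = 1 then {(2 * n + 1, Suc n)} else {})"
  proof -
    have "(i, j) \<in> pattern_index (Suc n) \<and> aty (Z i j) \<longleftrightarrow>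
        (i, j) \<in> pattern_index n \<and> aty (z i j) \<or> a = 1 \<and> i = 2 * n + 1 \<and> j = Suc n" for i j
    proof -
      have le: "(i, j) \<in> pattern_index n \<Longrightarrow> i \<le> 2 * n" by (simp add: pattern_index_def)
      consider "i \<le> 2 * n" | "i = 2 * n + 1 \<and> 1 \<le> j \<and> j \<le> n" | "i = 2 * n + 1 \<and> j = Suc n"
        | "i = 2 * n + 2 \<and> 1 \<le> j \<and> j \<le> Suc n" | "2 * n < i \<and> (i, j) \<notin> pattern_index (Suc n)"
      proof -
        have "(i, j) \<notin> pattern_index n" if "\<not> i \<le> 2 * n" using le that by blast
        then have "i \<le> 2 * n \<or> (i = 2 * n + 1 \<and> 1 \<le> j \<and> j \<le> n) \<or> (i = 2 * n + 1 \<and> j = Suc n) \<or>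
            (i = 2 * n + 2 \<and> 1 \<le> j \<and> j \<le> Suc n) \<or> (2 * n < i \<and> (i, j) \<notin> pattern_index (Suc n))"
          unfolding pattern_index_Suc le_Suc_eq[of j n] by (metis not_le)
        then show thesis using that by blast
      qed
      then show ?thesis
      proof cases
        case 1
        then show ?thesis by (auto simp: pattern_index_Suc Z)
      next
        case 2
        then have "\<not> aty (Z i j)" using Z(2)[of j] typical by simp
        then show ?thesis using 2 le by auto
      next
        case 3
        then have "aty (Z i j) \<longleftrightarrow> a = 1" using Z(3) end_aty[OF a] by simp
        then show ?thesis using 3 le by (auto simp: pattern_index_Suc)
      next
        case 4
        then have "\<not> aty (Z i j)" using Z(4)[of j] typical by simp
        then show ?thesis using 4 le by auto
      next
        case 5
        then show ?thesis using le by (auto simp: pattern_index_Suc)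
      qed
    qed
    then show ?thesis by auto
  qed
  moreover have "card ({(i, j) \<in> pattern_index n. aty (z i j)} \<union> (if a = 1 then {(2 * n + 1, Suc n)} else {})) =
      a + card {(i, j) \<in> pattern_index n. aty (z i j)}"
  proof -
    have fin: "finite {(i, j) \<in> pattern_index n. aty (z i j)}"
      by (rule finite_subset[OF _ finite_pattern_index[of n]]) auto
    have out: "(2 * n + 1, Suc n) \<notin> {(i, j) \<in> pattern_index n. aty (z i j)}" by (auto simp: pattern_index_def)
    have "a = 0 \<or> a = 1" using a end_shifts_subset[of half "rho ! n"] by auto
    then show ?thesis using fin out by auto
  qed
  ultimately show ?thesis unfolding Z_def[symmetric] 1 by simp
qed

lemma pattern_type_add_rows:
  "1 \<le> i \<Longrightarrow> i \<le> 2 * n \<Longrightarrow> pattern_type (add_rows half n lam (rho, a, nu, z)) i = pattern_type z i"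
  by (auto simp: pattern_type_def add_rows_simps(1) intro!: arg_cong2[of _ _ _ _ "(-)"] sum.cong)

text \<open>The class shift s enters as (n + 1) s - 2 (n + 1) s + n s = - s. Row
  \<open>2 * n + 1\<close> counts twice, so the rounding a/2 of its end contributes
  \<open>a\<close>.\<close>

lemma pattern_type_add_rows_top:
  "pattern_type (add_rows half n lam (rho, a, nu, z)) (2 * Suc n) -
    pattern_type (add_rows half n lam (rho, a, nu, z)) (2 * Suc n - 1) =
    of_int (int (sum_list lam) + int (sum_list nu) - 2 * int (sum_list rho)) - half_shift half + real a"
proof -
  note len = odd_rows_nth(1)[OF rho lam] even_rows_nth(1)[OF nu odd_rows_nth(1)[OF rho lam]]
  define Z where "Z = add_rows half n lam (rho, a, nu, z)"
  note Z = add_rows_simps[where half = half and n = n and lam = lam and rho = rho and a = a and nu = nu and z = z, folded Z_def]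
  have "(\<Sum>j=1..Suc n. Z (2 * n + 2) j) = (\<Sum>j=1..Suc n. real (lam ! (j - 1)) + half_shift half)"
    by (intro sum.cong refl Z(4)) auto
  then have top: "(\<Sum>j=1..Suc n. Z (2 * n + 2) j) = real (sum_list lam) + real (Suc n) * half_shift half"
    using sum_nth_from_1[OF lam] by simp
  have "(\<Sum>j=1..Suc n. Z (2 * n + 1) j) = (\<Sum>j=1..Suc n. real (rho ! (j - 1)) + half_shift half) - real a / 2"
  proof -
    have "(\<Sum>j=1..n. Z (2 * n + 1) j) = (\<Sum>j=1..n. real (rho ! (j - 1)) + half_shift half)"
      by (intro sum.cong refl Z(2)) auto
    then show ?thesis using Z(3) by simp
  qed
  then have mid: "(\<Sum>j=1..Suc n. Z (2 * n + 1) j) = real (sum_list rho) + real (Suc n) * half_shift half - real a / 2"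
    using sum_nth_from_1[OF len(1)] by simp
  have "(\<Sum>j=1..n. Z (2 * n) j) = (\<Sum>j=1..n. real (nu ! (j - 1)) + half_shift half)"
    using z len by (intro sum.cong refl) (simp add: Z(1) patterns_of_shape_shifted)
  then have bot: "(\<Sum>j=1..n. Z (2 * n) j) = real (sum_list nu) + real n * half_shift half"
    using sum_nth_from_1[OF len(2)] by simp
  have "pattern_type Z (2 * Suc n) = (\<Sum>j=1..Suc n. Z (2 * n + 2) j) - (\<Sum>j=1..Suc n. Z (2 * n + 1) j)"
    "pattern_type Z (2 * Suc n - 1) = (\<Sum>j=1..Suc n. Z (2 * n + 1) j) - (\<Sum>j=1..n. Z (2 * n) j)"
    by (simp_all add: pattern_type_def)
  then have "pattern_type Z (2 * Suc n) - pattern_type Z (2 * Suc n - 1) =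
    real (sum_list lam) + real (sum_list nu) - 2 * real (sum_list rho) - half_shift half + real a"
    unfolding top mid bot by (simp add: algebra_simps)
  then show ?thesis unfolding Z_def[symmetric] by simp
qed

end

lemma powr_int_shift:
  assumes "0 < (y::real)"
  shows "y powr (of_int e - s + real a) = y powi e * y powr (- s) * y ^ a"
proof -
  have "y powr (of_int e - s + real a) = y powr of_int e * y powr (- s) * y powr real a"
    by (simp add: powr_add[symmetric])
  then show ?thesis using assms by (simp add: powr_real_of_int' powr_realpow)
qed

theorem schur_CB_eq_cb:
  assumes "length lam = n" "\<And>i. i \<in> {1..n} \<Longrightarrow> 0 < x i"
  shows "schur_CB n (shifted half lam) x \<beta> =
    (\<Prod>i=1..n. x i powr (- half_shift half)) * (if half then \<Prod>i=1..n. 1 + \<beta> * x i else 1) *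
    cb (if half then 0 else \<beta>) (\<lambda>i. x (Suc i)) n lam"
proof -
  \<comment> \<open>Finiteness of the set of patterns is carried through the induction because
    splitting the sum over the dependent domain requires it.\<close>
  have "finite (patterns_of_shape n (shifted half lam)) \<and> schur_CB n (shifted half lam) x \<beta> =
    (\<Prod>i=1..n. x i powr (- half_shift half)) * (if half then \<Prod>i=1..n. 1 + \<beta> * x i else 1) *
    cb (if half then 0 else \<beta>) (\<lambda>i. x (Suc i)) n lam"
    using assms
  proof (induction n arbitrary: lam)
    case 0
    have "patterns_of_shape 0 (shifted half lam) = {\<lambda>_ _. 0}"
      using 0 by (auto simp: patterns_of_shape_shifted pattern_of_class_def pattern_index_def odd_ends_def)
    moreover have "atypical 0 (\<lambda>_ _. 0) = {}"
      by (auto simp: atypical_def pattern_index_def)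
    ultimately show ?case by (simp add: schur_CB_def)
  next
    case (Suc n)
    define y where "y = x (Suc n)"
    have y: "0 < y" using Suc.prems(2)[of "Suc n"] by (simp add: y_def)
    define w where "w m z = \<beta> ^ card (atypical m z) * (\<Prod>i=1..m. x i powr (pattern_type z (2 * i) - pattern_type z (2 * i - 1)))" for m z
    define T where "T = (SIGMA rho:odd_rows lam. SIGMA a:end_shifts half (rho ! n).
      SIGMA nu:even_rows rho. patterns_of_shape n (shifted half nu))"
    have split: "(\<Prod>i=1..Suc n. f i) = f (Suc n) * (\<Prod>i=1..n. f i)" for f :: "nat \<Rightarrow> real"
      by simp
    have fin: "finite (patterns_of_shape n (shifted half nu))" and
      IH: "schur_CB n (shifted half nu) x \<beta> =
        (\<Prod>i=1..n. x i powr (- half_shift half)) * (if half then \<Prod>i=1..n. 1 + \<beta> * x i else 1) *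
        cb (if half then 0 else \<beta>) (\<lambda>i. x (Suc i)) n nu"
      if "rho \<in> odd_rows lam" "nu \<in> even_rows rho" for rho nu
    proof -
      have "length nu = n" using that even_rows_nth(1)[OF that(2) odd_rows_nth(1)[OF that(1) Suc.prems(1)]] by simp
      then show "finite (patterns_of_shape n (shifted half nu))" "schur_CB n (shifted half nu) x \<beta> =
        (\<Prod>i=1..n. x i powr (- half_shift half)) * (if half then \<Prod>i=1..n. 1 + \<beta> * x i else 1) *
        cb (if half then 0 else \<beta>) (\<lambda>i. x (Suc i)) n nu"
        using Suc.IH[of nu] Suc.prems(2) by auto
    qed
    have image: "patterns_of_shape (Suc n) (shifted half lam) = add_rows half n lam ` T"
    proof (intro equalityI subsetI)
      fix Z assume "Z \<in> patterns_of_shape (Suc n) (shifted half lam)"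
      from patterns_are_add_rows[OF Suc.prems(1) this] show "Z \<in> add_rows half n lam ` T"
        unfolding T_def by blast
    next
      fix Z assume "Z \<in> add_rows half n lam ` T"
      then show "Z \<in> patterns_of_shape (Suc n) (shifted half lam)"
        unfolding T_def using add_rows_in_patterns[OF Suc.prems(1)] by blast
    qed
    have inj: "inj_on (add_rows half n lam) T"
      unfolding T_def inj_on_def using add_rows_inject[OF Suc.prems(1)] by auto
    have finT: "finite T"
      unfolding T_def using fin by (intro finite_SigmaI) auto
    have "schur_CB (Suc n) (shifted half lam) x \<beta> = (\<Sum>t\<in>T. w (Suc n) (add_rows half n lam t))"
      by (simp add: schur_CB_def w_def image sum.reindex[OF inj])
    also have "\<dots> = (\<Sum>(rho, a, nu, z)\<in>T. (\<beta> * y) ^ a * (y powr (- half_shift half) *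
        y powi (int (sum_list lam) + int (sum_list nu) - 2 * int (sum_list rho)) * w n z))"
    proof (rule sum.cong[OF refl], clarify)
      fix rho a nu z assume "(rho, a, nu, z) \<in> T"
      then have t: "rho \<in> odd_rows lam" "a \<in> end_shifts half (rho ! n)" "nu \<in> even_rows rho"
        "z \<in> patterns_of_shape n (shifted half nu)" by (auto simp: T_def)
      let ?Z = "add_rows half n lam (rho, a, nu, z)"
      have "(\<Prod>i=1..n. x i powr (pattern_type ?Z (2 * i) - pattern_type ?Z (2 * i - 1))) =
          (\<Prod>i=1..n. x i powr (pattern_type z (2 * i) - pattern_type z (2 * i - 1)))"
      proof (intro prod.cong refl)
        fix i assume "i \<in> {1..n}"
        then have "1 \<le> 2 * i" "2 * i \<le> 2 * n" "1 \<le> 2 * i - 1" "2 * i - 1 \<le> 2 * n" by auto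
        then show "x i powr (pattern_type ?Z (2 * i) - pattern_type ?Z (2 * i - 1)) =
            x i powr (pattern_type z (2 * i) - pattern_type z (2 * i - 1))"
          by (simp only: pattern_type_add_rows[OF Suc.prems(1) t])
      qed
      then show "w (Suc n) ?Z = (\<beta> * y) ^ a * (y powr (- half_shift half) *
        y powi (int (sum_list lam) + int (sum_list nu) - 2 * int (sum_list rho)) * w n z)"
        unfolding w_def card_atypical_add_rows[OF Suc.prems(1) t]
        unfolding split pattern_type_add_rows_top[OF Suc.prems(1) t] y_def[symmetric] powr_int_shift[OF y]
        by (simp only: power_add power_mult_distrib mult_ac)
    qed
    also have "\<dots> = (\<Sum>rho\<in>odd_rows lam. \<Sum>a\<in>end_shifts half (rho ! n). \<Sum>nu\<in>even_rows rho.
        \<Sum>z\<in>patterns_of_shape n (shifted half nu). (\<beta> * y) ^ a * (y powr (- half_shift half) *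
        y powi (int (sum_list lam) + int (sum_list nu) - 2 * int (sum_list rho)) * w n z))"
      unfolding T_def using fin by (simp add: sum.Sigma finite_SigmaI)
    also have "\<dots> = (\<Sum>rho\<in>odd_rows lam. \<Sum>a\<in>end_shifts half (rho ! n). \<Sum>nu\<in>even_rows rho.
        (\<beta> * y) ^ a * (y powr (- half_shift half) *
        y powi (int (sum_list lam) + int (sum_list nu) - 2 * int (sum_list rho)) * schur_CB n (shifted half nu) x \<beta>))"
      by (simp add: schur_CB_def w_def sum_distrib_left)
    also have "\<dots> = (\<Sum>rho\<in>odd_rows lam. \<Sum>nu\<in>even_rows rho.
        (\<Sum>a\<in>end_shifts half (rho ! n). (\<beta> * y) ^ a) * (y powr (- half_shift half) *
        y powi (int (sum_list lam) + int (sum_list nu) - 2 * int (sum_list rho)) * schur_CB n (shifted half nu) x \<beta>))"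
      by (intro sum.cong refl, subst sum.swap) (simp only: sum_distrib_right)
    also have "\<dots> = (\<Sum>rho\<in>odd_rows lam. \<Sum>nu\<in>even_rows rho.
      ((\<Prod>i=1..Suc n. x i powr (- half_shift half)) * (if half then \<Prod>i=1..Suc n. 1 + \<beta> * x i else 1)) *
      ((if 0 < rho ! n then 1 + (if half then 0 else \<beta>) * y else 1) *
       y powi (int (sum_list lam) + int (sum_list nu) - 2 * int (sum_list rho)) * cb (if half then 0 else \<beta>) (\<lambda>i. x (Suc i)) n nu))"
    proof (intro sum.cong refl)
      fix rho nu assume t: "rho \<in> odd_rows lam" "nu \<in> even_rows rho"
      have "(\<Sum>a\<in>end_shifts half (rho ! n). (\<beta> * y) ^ a) =
          (if half then 1 + \<beta> * y else 1) * (if 0 < rho ! n then 1 + (if half then 0 else \<beta>) * y else 1)"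
        by (simp add: end_shifts_def)
      then show "(\<Sum>a\<in>end_shifts half (rho ! n). (\<beta> * y) ^ a) * (y powr (- half_shift half) *
        y powi (int (sum_list lam) + int (sum_list nu) - 2 * int (sum_list rho)) * schur_CB n (shifted half nu) x \<beta>) =
      ((\<Prod>i=1..Suc n. x i powr (- half_shift half)) * (if half then \<Prod>i=1..Suc n. 1 + \<beta> * x i else 1)) *
      ((if 0 < rho ! n then 1 + (if half then 0 else \<beta>) * y else 1) *
       y powi (int (sum_list lam) + int (sum_list nu) - 2 * int (sum_list rho)) * cb (if half then 0 else \<beta>) (\<lambda>i. x (Suc i)) n nu)"
        unfolding IH[OF t] split y_def by (cases half) (simp_all only: if_True if_False mult_ac)
    qed
    also have "\<dots> = (\<Prod>i=1..Suc n. x i powr (- half_shift half)) * (if half then \<Prod>i=1..Suc n. 1 + \<beta> * x i else 1) *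
      cb (if half then 0 else \<beta>) (\<lambda>i. x (Suc i)) (Suc n) lam"
      unfolding cb.simps y_def sum_distrib_left ..
    finally show ?case using finT by (simp add: image)
  qed
  then show ?thesis by simp
qed

section \<open>Last passage times and Robinson-Schensted-Knuth local moves\<close>

definition interlaces :: "(nat \<Rightarrow> nat) \<Rightarrow> (nat \<Rightarrow> nat) \<Rightarrow> bool" where
  "interlaces \<kappa> c \<longleftrightarrow> (\<forall>i. c (Suc i) \<le> \<kappa> i \<and> \<kappa> i \<le> c i)"

lemma interlaces_zero: "interlaces (\<lambda>_. 0) (\<lambda>_. 0)"
  by (simp add: interlaces_def)

fun lpp :: "(nat \<Rightarrow> nat \<Rightarrow> nat) \<Rightarrow> nat \<Rightarrow> nat \<Rightarrow> nat" where
  "lpp w 0 j = 0"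
| "lpp w i 0 = 0"
| "lpp w (Suc i) (Suc j) = max (lpp w i (Suc j)) (lpp w (Suc i) j) + w (Suc i) (Suc j)"

lemma lpp_0_right [simp]: "lpp w i 0 = 0"
  by (cases i) auto

text \<open>The local rule of RSK in growth diagram form: \<kappa> sits diagonally before the new
  cell and \<alpha>, \<gamma> sit on its two neighbours. Part \<open>Suc l\<close> is the reflection
  of \<open>\<kappa> l\<close> in the interval from
  \<open>max (\<alpha> (Suc l)) (\<gamma> (Suc l))\<close> to
  \<open>min (\<alpha> l) (\<gamma> l)\<close>. Interlacing puts \<open>\<kappa> l\<close> into that
  interval, so the truncated subtraction is exact.\<close>

definition local_rule :: "(nat \<Rightarrow> nat) \<Rightarrow> (nat \<Rightarrow> nat) \<Rightarrow> (nat \<Rightarrow> nat) \<Rightarrow> nat \<Rightarrow> nat \<Rightarrow> nat" where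
  "local_rule \<kappa> \<alpha> \<gamma> w i = (case i of 0 \<Rightarrow> max (\<alpha> 0) (\<gamma> 0) + w
     | Suc l \<Rightarrow> max (\<alpha> (Suc l)) (\<gamma> (Suc l)) + min (\<alpha> l) (\<gamma> l) - \<kappa> l)"

lemma local_rule_simps:
  "local_rule \<kappa> \<alpha> \<gamma> w 0 = max (\<alpha> 0) (\<gamma> 0) + w"
  "local_rule \<kappa> \<alpha> \<gamma> w (Suc l) = max (\<alpha> (Suc l)) (\<gamma> (Suc l)) + min (\<alpha> l) (\<gamma> l) - \<kappa> l"
  by (simp_all add: local_rule_def)

text \<open>A reflection maps its interval to itself, which gives both inequalities for each part
  \<open>Suc l\<close>.\<close>

lemma interlaces_local_rule:
  assumes "interlaces \<kappa> \<alpha>" "interlaces \<kappa> \<gamma>"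
  shows "interlaces \<alpha> (local_rule \<kappa> \<alpha> \<gamma> w)" "interlaces \<gamma> (local_rule \<kappa> \<alpha> \<gamma> w)"
proof -
  have k: "\<alpha> (Suc i) \<le> \<kappa> i" "\<gamma> (Suc i) \<le> \<kappa> i" "\<kappa> i \<le> \<alpha> i" "\<kappa> i \<le> \<gamma> i" for i
    using assms by (auto simp: interlaces_def)
  have "\<alpha> i \<le> local_rule \<kappa> \<alpha> \<gamma> w i \<and> \<gamma> i \<le> local_rule \<kappa> \<alpha> \<gamma> w i" for i
    using k[of "i - 1"] by (cases i) (auto simp: local_rule_simps)
  moreover have "local_rule \<kappa> \<alpha> \<gamma> w (Suc i) \<le> \<alpha> i \<and> local_rule \<kappa> \<alpha> \<gamma> w (Suc i) \<le> \<gamma> i" for i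
    using k[of i] by (auto simp: local_rule_simps)
  ultimately show "interlaces \<alpha> (local_rule \<kappa> \<alpha> \<gamma> w)" "interlaces \<gamma> (local_rule \<kappa> \<alpha> \<gamma> w)"
    by (auto simp: interlaces_def)
qed

text \<open>Each minimum pairs with the maximum of the same index to a sum \<alpha> l + \<gamma> l.
  The index \<open>L\<close> lies beyond all nonzero parts of \<alpha> and \<gamma>.\<close>

lemma local_rule_size:
  assumes "interlaces \<kappa> \<alpha>" "interlaces \<kappa> \<gamma>" "\<alpha> L = 0" "\<gamma> L = 0"
  shows "(\<Sum>i\<le>L. local_rule \<kappa> \<alpha> \<gamma> w i) + (\<Sum>i\<le>L. \<kappa> i) = (\<Sum>i\<le>L. \<alpha> i) + (\<Sum>i\<le>L. \<gamma> i) + w"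
proof -
  have k: "\<kappa> i \<le> \<alpha> i" "\<kappa> i \<le> \<gamma> i" for i
    using assms by (auto simp: interlaces_def)
  have "(\<Sum>i\<le>l. local_rule \<kappa> \<alpha> \<gamma> w i) + (\<Sum>i<l. \<kappa> i) = (\<Sum>i<l. \<alpha> i) + (\<Sum>i<l. \<gamma> i) + max (\<alpha> l) (\<gamma> l) + w" for l
  proof (induction l)
    case (Suc l)
    have "local_rule \<kappa> \<alpha> \<gamma> w (Suc l) + \<kappa> l = max (\<alpha> (Suc l)) (\<gamma> (Suc l)) + min (\<alpha> l) (\<gamma> l)"
      using k[of l] by (simp add: local_rule_simps)
    moreover have "max (\<alpha> l) (\<gamma> l) + min (\<alpha> l) (\<gamma> l) = \<alpha> l + \<gamma> l" by simp
    ultimately show ?case using Suc by simp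
  qed (simp add: local_rule_simps)
  from this[of L] have "(\<Sum>i\<le>L. local_rule \<kappa> \<alpha> \<gamma> w i) + (\<Sum>i<L. \<kappa> i) = (\<Sum>i<L. \<alpha> i) + (\<Sum>i<L. \<gamma> i) + w"
    using assms by simp
  moreover have "\<kappa> L = 0" using k[of L] assms by simp
  ultimately show ?thesis using assms by (simp add: lessThan_Suc_atMost[symmetric])
qed

text \<open>
  The pair consists of the partitions at the cells of the antidiagonal \<open>i + j = k + 1\<close> and of the
  previous antidiagonal, both indexed by the column \<open>j\<close>.
\<close>

fun rsk :: "nat \<Rightarrow> (nat \<Rightarrow> nat \<Rightarrow> nat) \<Rightarrow> (nat \<Rightarrow> nat \<Rightarrow> nat) \<times> (nat \<Rightarrow> nat \<Rightarrow> nat)" where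
  "rsk 0 w = (\<lambda>_ _. 0, \<lambda>_ _. 0)"
| "rsk (Suc k) w = (let (C, K) = rsk k w in
     (\<lambda>j. if 1 \<le> j \<and> j \<le> Suc k then local_rule (K (j - 1)) (C (j - 1)) (C j) (w (k + 2 - j) j) else (\<lambda>_. 0), C))"

lemma rsk_Suc:
  "rsk k w = (C, K) \<Longrightarrow> rsk (Suc k) w =
    (\<lambda>j. if 1 \<le> j \<and> j \<le> Suc k then local_rule (K (j - 1)) (C (j - 1)) (C j) (w (k + 2 - j) j) else (\<lambda>_. 0), C)"
  by simp

definition rsk_states :: "nat \<Rightarrow> ((nat \<Rightarrow> nat \<Rightarrow> nat) \<times> (nat \<Rightarrow> nat \<Rightarrow> nat)) set" where
  "rsk_states k = {(C, K). (\<forall>j. \<not> (1 \<le> j \<and> j \<le> k) \<longrightarrow> C j = (\<lambda>_. 0)) \<and>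
     (\<forall>j. \<not> (1 \<le> j \<and> j < k) \<longrightarrow> K j = (\<lambda>_. 0)) \<and>
     (\<forall>j. interlaces (K j) (C j) \<and> interlaces (K j) (C (Suc j)))}"

lemma rsk_in_states: "rsk k w \<in> rsk_states k"
proof (induction k)
  case 0
  show ?case by (simp add: rsk_states_def interlaces_zero)
next
  case (Suc k)
  obtain C K where CK: "rsk k w = (C, K)" by fastforce
  have zC: "\<And>j. \<not> (1 \<le> j \<and> j \<le> k) \<Longrightarrow> C j = (\<lambda>_. 0)"
    and il: "\<And>j. interlaces (K j) (C j)" "\<And>j. interlaces (K j) (C (Suc j))"
    using Suc unfolding CK rsk_states_def by auto
  define N where "N j = (if 1 \<le> j \<and> j \<le> Suc k then local_rule (K (j - 1)) (C (j - 1)) (C j) (w (k + 2 - j) j) else (\<lambda>_. 0))" for j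
  have "interlaces (C j) (N j) \<and> interlaces (C j) (N (Suc j))" for j
  proof
    show "interlaces (C j) (N j)"
    proof (cases "1 \<le> j \<and> j \<le> Suc k")
      case True
      then obtain l where "j = Suc l" by (cases j) auto
      then show ?thesis using True interlaces_local_rule(2)[OF il(1)[of l] il(2)[of l]] by (simp add: N_def)
    next
      case False
      then show ?thesis using zC[of j] by (auto simp: N_def interlaces_zero)
    qed
    show "interlaces (C j) (N (Suc j))"
    proof (cases "j \<le> k")
      case True
      then show ?thesis using interlaces_local_rule(1)[OF il(1)[of j] il(2)[of j]] by (simp add: N_def)
    next
      case False
      then show ?thesis using zC[of j] by (auto simp: N_def interlaces_zero)
    qed
  qed
  moreover have "rsk (Suc k) w = (N, C)" unfolding rsk_Suc[OF CK] N_def ..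
  ultimately show ?case using zC by (auto simp: rsk_states_def N_def)
qed

lemma rsk_cong:
  assumes "\<And>i j. 1 \<le> i \<Longrightarrow> 1 \<le> j \<Longrightarrow> i + j \<le> k + 1 \<Longrightarrow> w i j = w' i j"
  shows "rsk k w = rsk k w'"
  using assms
proof (induction k)
  case (Suc k)
  have "rsk k w = rsk k w'" using Suc.prems by (intro Suc.IH) auto
  moreover have "w (k + 2 - j) j = w' (k + 2 - j) j" if "1 \<le> j \<and> j \<le> Suc k" for j
    using Suc.prems[of "k + 2 - j" j] that by auto
  ultimately show ?case by (auto simp: Let_def split: prod.split)
qed simp

text \<open>The last step can be undone: the parts from index 1 on determine \<open>K\<close>,
  because a reflection is injective, and part 0 then determines the weight of the new cell.\<close>

lemma rsk_inject:
  assumes "rsk k w = rsk k w'" "1 \<le> i" "1 \<le> j" "i + j \<le> k + 1"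
  shows "w i j = w' i j"
  using assms
proof (induction k arbitrary: i j)
  case (Suc k)
  obtain C K C' K' where CK: "rsk k w = (C, K)" "rsk k w' = (C', K')" by fastforce
  have st: "(C, K) \<in> rsk_states k" "(C', K') \<in> rsk_states k"
    using rsk_in_states[of k] CK by metis+
  have C: "C' = C" using Suc.prems(1) by (simp add: CK)
  have N: "local_rule (K l) (C l) (C (Suc l)) (w (Suc k - l) (Suc l)) =
      local_rule (K' l) (C l) (C (Suc l)) (w' (Suc k - l) (Suc l))" if "l \<le> k" for l
  proof -
    have "(if 1 \<le> Suc l \<and> Suc l \<le> Suc k then local_rule (K (Suc l - 1)) (C (Suc l - 1)) (C (Suc l)) (w (k + 2 - Suc l) (Suc l)) else (\<lambda>_. 0)) =
      (if 1 \<le> Suc l \<and> Suc l \<le> Suc k then local_rule (K' (Suc l - 1)) (C' (Suc l - 1)) (C' (Suc l)) (w' (k + 2 - Suc l) (Suc l)) else (\<lambda>_. 0))"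
      using fun_cong[OF arg_cong[OF Suc.prems(1), of fst], of "Suc l"] by (simp add: CK)
    then show ?thesis using that C by (simp add: Suc_diff_le)
  qed
  have "K = K'"
  proof
    fix l
    show "K l = K' l"
    proof (cases "l \<le> k")
      case True
      show ?thesis
      proof
        fix i
        have "K l i \<le> C l i" "K l i \<le> C (Suc l) i" "K' l i \<le> C l i" "K' l i \<le> C (Suc l) i"
          using st unfolding C rsk_states_def interlaces_def by auto
        then show "K l i = K' l i"
          using fun_cong[OF N[OF True], of "Suc i"] by (simp add: local_rule_simps)
      qed
    next
      case False
      then show ?thesis using st by (auto simp: rsk_states_def)
    qed
  qed
  then have eq: "rsk k w = rsk k w'" by (simp add: CK C)
  show ?case
  proof (cases "i + j \<le> k + 1")
    case True
    then show ?thesis using Suc.IH[OF eq] Suc.prems by simp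
  next
    case False
    then obtain l where "j = Suc l" "l \<le> k" "i = Suc k - l"
      using Suc.prems by (cases j) auto
    then show ?thesis using fun_cong[OF N[of l], of 0] by (simp add: local_rule_simps)
  qed
qed simp

lemma rsk_surj:
  assumes "s \<in> rsk_states k"
  shows "\<exists>w. rsk k w = s"
  using assms
proof (induction k arbitrary: s)
  case 0
  then have "s = (\<lambda>_ _. 0, \<lambda>_ _. 0)" by (auto simp: rsk_states_def fun_eq_iff)
  then show ?case by simp
next
  case (Suc k)
  obtain N C where s: "s = (N, C)" by fastforce
  have zN: "\<And>j. \<not> (1 \<le> j \<and> j \<le> Suc k) \<Longrightarrow> N j = (\<lambda>_. 0)" and zC: "\<And>j. \<not> (1 \<le> j \<and> j < Suc k) \<Longrightarrow> C j = (\<lambda>_. 0)"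
    and il: "\<And>j. interlaces (C j) (N j)" "\<And>j. interlaces (C j) (N (Suc j))"
    using Suc.prems unfolding s rsk_states_def by auto
  \<comment> \<open>A reflection is its own inverse, so the earlier antidiagonal is recovered by the
    formula of \<open>local_rule\<close>.\<close>
  define K where "K j i = max (C j (Suc i)) (C (Suc j) (Suc i)) + min (C j i) (C (Suc j) i) - N (Suc j) (Suc i)" for j i
  have n: "N (Suc j) (Suc i) \<le> C j i" "N (Suc j) (Suc i) \<le> C (Suc j) i"
    "C j i \<le> N (Suc j) i" "C (Suc j) i \<le> N (Suc j) i" for j i
    using il[of j] il[of "Suc j"] by (auto simp: interlaces_def)
  have "(C, K) \<in> rsk_states k"
  proof -
    have "K j = (\<lambda>_. 0)" if "\<not> (1 \<le> j \<and> j < k)" for j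
    proof -
      have "C j = (\<lambda>_. 0) \<or> C (Suc j) = (\<lambda>_. 0)" using zC[of j] zC[of "Suc j"] that by auto
      moreover have "max (C j (Suc i)) (C (Suc j) (Suc i)) \<le> N (Suc j) (Suc i)" for i
        using n[of j "Suc i"] by simp
      ultimately show ?thesis by (auto simp: K_def fun_eq_iff)
    qed
    moreover have "interlaces (K j) (C j) \<and> interlaces (K j) (C (Suc j))" for j
    proof -
      have "C j (Suc i) \<le> K j i \<and> K j i \<le> C j i \<and> C (Suc j) (Suc i) \<le> K j i \<and> K j i \<le> C (Suc j) i" for i
        using n[of j i] n[of j "Suc i"] by (auto simp: K_def)
      then show ?thesis by (simp add: interlaces_def)
    qed
    ultimately show ?thesis using zC by (simp add: rsk_states_def less_Suc_eq_le)
  qed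
  then obtain w0 where w0: "rsk k w0 = (C, K)" using Suc.IH by blast
  \<comment> \<open>On the new antidiagonal the weight is the excess of the first part over those of
    the two neighbours.\<close>
  define w where "w i j = (if i + j = k + 2 then N j 0 - max (C (j - 1) 0) (C j 0) else w0 i j)" for i j
  have "rsk k w = (C, K)"
    unfolding w0[symmetric] by (rule rsk_cong) (simp add: w_def)
  moreover have "(if 1 \<le> j \<and> j \<le> Suc k then local_rule (K (j - 1)) (C (j - 1)) (C j) (w (k + 2 - j) j) else (\<lambda>_. 0)) = N j" for j
  proof (cases "1 \<le> j \<and> j \<le> Suc k")
    case True
    then obtain l where l: "j = Suc l" by (cases j) auto
    have "local_rule (K l) (C l) (C j) (w (k + 2 - j) j) i = N j i" for i
    proof (cases i)
      case 0
      then show ?thesis using True n[of l 0] by (simp add: l local_rule_simps w_def)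
    next
      case (Suc i')
      then show ?thesis using n[of l i'] n[of l "Suc i'"] by (simp add: l local_rule_simps K_def)
    qed
    then show ?thesis using True l by auto
  next
    case False
    then show ?thesis using zN by auto
  qed
  ultimately have "rsk (Suc k) w = (N, C)" by (simp only: rsk_Suc)
  then show ?case unfolding s by blast
qed

definition staircase_arrays :: "nat \<Rightarrow> (nat \<Rightarrow> nat \<Rightarrow> nat) set" where
  "staircase_arrays k = {w. \<forall>i j. \<not> (1 \<le> i \<and> 1 \<le> j \<and> i + j \<le> k + 1) \<longrightarrow> w i j = 0}"

lemma bij_betw_rsk: "bij_betw (rsk k) (staircase_arrays k) (rsk_states k)"
proof (rule bij_betw_imageI)
  show "inj_on (rsk k) (staircase_arrays k)"
  proof (rule inj_onI, intro ext)
    fix w w' i j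
    assume "w \<in> staircase_arrays k" "w' \<in> staircase_arrays k" "rsk k w = rsk k w'"
    then show "w i j = w' i j"
      using rsk_inject[of k w w' i j] by (cases "1 \<le> i \<and> 1 \<le> j \<and> i + j \<le> k + 1") (auto simp: staircase_arrays_def)
  qed
  show "rsk k ` staircase_arrays k = rsk_states k"
  proof (intro equalityI subsetI)
    fix s assume "s \<in> rsk_states k"
    then obtain w where w: "rsk k w = s" using rsk_surj by blast
    define w' where "w' i j = (if 1 \<le> i \<and> 1 \<le> j \<and> i + j \<le> k + 1 then w i j else 0)" for i j
    have "rsk k w' = s" unfolding w[symmetric] by (rule rsk_cong) (simp add: w'_def)
    moreover have "w' \<in> staircase_arrays k" by (auto simp: staircase_arrays_def w'_def)
    ultimately show "s \<in> rsk k ` staircase_arrays k" by blast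
  qed (use rsk_in_states in auto)
qed

text \<open>For first parts the local rule is the recursion of \<open>lpp\<close>.\<close>

lemma rsk_corner:
  assumes "j \<le> Suc k"
  shows "fst (rsk k w) j 0 = lpp w (Suc k - j) j"
  using assms
proof (induction k arbitrary: j)
  case 0
  then show ?case by (cases j) auto
next
  case (Suc k)
  obtain C K where CK: "rsk k w = (C, K)" by fastforce
  have IH: "C j 0 = lpp w (Suc k - j) j" if "j \<le> Suc k" for j
    using Suc.IH[OF that] by (simp add: CK)
  show ?case
  proof (cases "1 \<le> j \<and> j \<le> Suc k")
    case True
    then obtain l where l: "j = Suc l" by (cases j) auto
    then have "Suc (Suc k) - j = Suc (k - l)" "k + 2 - j = Suc (k - l)" using True by auto
    moreover have "fst (rsk (Suc k) w) j 0 = max (C l 0) (C j 0) + w (k + 2 - j) j"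
      using True by (simp add: CK local_rule_simps l)
    ultimately show ?thesis using IH[of l] IH[of j] True l by (simp add: Suc_diff_le max.commute)
  next
    case False
    then have "j = 0 \<or> j = Suc (Suc k)" using Suc.prems by auto
    then show ?thesis by (auto simp: CK)
  qed
qed

text \<open>Along the zigzag from the zero partition in column 0, the step up to the next column
  adds at most one nonzero part and the step down adds none.\<close>

lemma rsk_support:
  assumes "(C, K) \<in> rsk_states k" "j \<le> i"
  shows "C j i = 0" "K j i = 0"
proof -
  have il: "interlaces (K j) (C j)" "interlaces (K j) (C (Suc j))" "C 0 = (\<lambda>_. 0)" for j
    using assms(1) by (auto simp: rsk_states_def)
  have "C j i = 0" if "j \<le> i" for i j
    using that
  proof (induction j arbitrary: i)
    case (Suc j)
    then obtain i' where i: "i = Suc i'" "j \<le> i'" by (cases i) auto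
    have "C (Suc j) (Suc i') \<le> K j i'" "K j i' \<le> C j i'" using il(1,2)[of j] by (auto simp: interlaces_def)
    then show ?case using Suc.IH[OF i(2)] i by simp
  qed (simp add: il(3))
  then show "C j i = 0" "K j i = 0"
    using assms(2) il(1)[of j] by (auto simp: interlaces_def) (metis le_zero_eq)
qed

text \<open>By \<open>local_rule_size\<close> the size of the partition at a cell is the total
  weight of the rectangle spanned by the cell and the origin. Sizes at neighbouring cells hence
  differ by a row sum or a column sum of weights. The bound \<open>L\<close> only truncates sums of
  finite support.\<close>

lemma rsk_sizes:
  assumes "k \<le> L" "rsk k w = (C, K)" "1 \<le> j" "j \<le> k"
  shows "(\<Sum>i\<le>L. C j i) = (\<Sum>i\<le>L. K j i) + (\<Sum>l=1..j. w (Suc k - j) l)"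
    and "(\<Sum>i\<le>L. C j i) = (\<Sum>i\<le>L. K (j - 1) i) + (\<Sum>l=1..Suc k - j. w l j)"
proof -
  have "(\<Sum>i\<le>L. C j i) = (\<Sum>i\<le>L. K j i) + (\<Sum>l=1..j. w (Suc k - j) l) \<and>
      (\<Sum>i\<le>L. C j i) = (\<Sum>i\<le>L. K (j - 1) i) + (\<Sum>l=1..Suc k - j. w l j)"
    using assms
  proof (induction k arbitrary: j C K)
    case (Suc k)
    obtain C' K' where CK: "rsk k w = (C', K')" by fastforce
    have C: "K = C'" "C j = local_rule (K' (j - 1)) (C' (j - 1)) (C' j) (w (k + 2 - j) j)"
      using Suc.prems by (auto simp: CK)
    have st: "(C', K') \<in> rsk_states k" using rsk_in_states[of k w] CK by simp
    obtain l where l: "j = Suc l" using Suc.prems by (cases j) auto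
    have z: "C' l L = 0" "C' j L = 0"
      using rsk_support(1)[OF st, of l L] rsk_support(1)[OF st, of j L] Suc.prems l by auto
    have size: "(\<Sum>i\<le>L. C j i) + (\<Sum>i\<le>L. K' l i) = (\<Sum>i\<le>L. C' l i) + (\<Sum>i\<le>L. C' j i) + w (k + 2 - j) j"
    proof -
      have "C j = local_rule (K' l) (C' l) (C' j) (w (k + 2 - j) j)" using C(2) by (simp add: l)
      moreover have "interlaces (K' l) (C' l)" "interlaces (K' l) (C' j)"
        using st l by (auto simp: rsk_states_def)
      ultimately show ?thesis using local_rule_size[of "K' l" "C' l" "C' j" L] z by simp
    qed
    have row: "(\<Sum>i\<le>L. C' l i) = (\<Sum>i\<le>L. K' l i) + (\<Sum>i=1..l. w (Suc k - l) i)"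
    proof (cases "1 \<le> l")
      case True
      then show ?thesis using Suc.IH[of C' K' l] Suc.prems CK l by auto
    next
      case False
      then show ?thesis using st by (auto simp: rsk_states_def)
    qed
    have col: "(\<Sum>i\<le>L. C' j i) = (\<Sum>i\<le>L. K' l i) + (\<Sum>i=1..Suc k - j. w i j)"
    proof (cases "j \<le> k")
      case True
      then show ?thesis using Suc.IH[of C' K' j] Suc.prems CK l by auto
    next
      case False
      then have "C' j = (\<lambda>_. 0)" "K' l = (\<lambda>_. 0)" using st l Suc.prems by (auto simp: rsk_states_def)
      then show ?thesis using False by simp
    qed
    have e: "Suc (Suc k) - j = Suc (Suc k - j)" "k + 2 - j = Suc (Suc k - j)" "Suc k - l = Suc (Suc k - j)"
      using Suc.prems l by auto
    have "(\<Sum>i=1..j. w (Suc (Suc k) - j) i) = (\<Sum>i=1..l. w (Suc k - l) i) + w (k + 2 - j) j"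
      unfolding l by (simp add: e(1,2)[unfolded l] e(3)[unfolded l])
    moreover have "(\<Sum>i=1..Suc (Suc k) - j. w i j) = (\<Sum>i=1..Suc k - j. w i j) + w (k + 2 - j) j"
      unfolding e by simp
    ultimately show ?case
      using size row col C(1) l by simp
  qed simp
  then show "(\<Sum>i\<le>L. C j i) = (\<Sum>i\<le>L. K j i) + (\<Sum>l=1..j. w (Suc k - j) l)"
    "(\<Sum>i\<le>L. C j i) = (\<Sum>i\<le>L. K (j - 1) i) + (\<Sum>l=1..Suc k - j. w l j)" by auto
qed

section \<open>Complements of interlacing chains in a box\<close>

definition rows_above :: "nat \<Rightarrow> nat \<Rightarrow> (nat \<Rightarrow> nat) \<Rightarrow> (nat \<Rightarrow> nat) set" where
  "rows_above u n \<kappa> = {c. (\<forall>i\<ge>n. c i = 0) \<and> interlaces \<kappa> c \<and> c 0 \<le> u}"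

definition rows_below :: "nat \<Rightarrow> (nat \<Rightarrow> nat) \<Rightarrow> (nat \<Rightarrow> nat) set" where
  "rows_below n c = {\<kappa>. (\<forall>i\<ge>n. \<kappa> i = 0) \<and> interlaces \<kappa> c}"

definition complement :: "nat \<Rightarrow> nat \<Rightarrow> (nat \<Rightarrow> nat) \<Rightarrow> nat list" where
  "complement u n \<kappa> = map (\<lambda>i. u - \<kappa> (n - Suc i)) [0..<n]"

lemma length_complement [simp]: "length (complement u n \<kappa>) = n"
  by (simp add: complement_def)

lemma nth_complement: "i < n \<Longrightarrow> complement u n \<kappa> ! i = u - \<kappa> (n - Suc i)"
  by (simp add: complement_def)

lemma nth_complement_rev: "i < n \<Longrightarrow> complement u n \<kappa> ! (n - Suc i) = u - \<kappa> i"
  by (simp add: nth_complement)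

lemma sum_list_complement:
  assumes "\<And>i. \<kappa> i \<le> u" "\<And>i. n \<le> i \<Longrightarrow> \<kappa> i = 0" "n \<le> Suc L"
  shows "int (sum_list (complement u n \<kappa>)) = int n * int u - int (\<Sum>i\<le>L. \<kappa> i)"
proof -
  have "sum_list (complement u n \<kappa>) = (\<Sum>i<n. u - \<kappa> (n - Suc i))"
    by (simp add: sum_list_sum_nth nth_complement lessThan_atLeast0)
  also have "\<dots> = (\<Sum>i<n. u - \<kappa> i)"
    by (rule sum.nat_diff_reindex)
  finally have "int (sum_list (complement u n \<kappa>)) = (\<Sum>i<n. int u - int (\<kappa> i))"
    using assms(1) by (simp add: of_nat_diff)
  moreover have "(\<Sum>i\<le>L. \<kappa> i) = (\<Sum>i<n. \<kappa> i)"
    using assms(2,3) by (intro sum.mono_neutral_right) auto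
  ultimately show ?thesis by (simp add: sum_subtractf)
qed

lemma interlaces_le_first:
  assumes "interlaces \<kappa> c"
  shows "c i \<le> c 0" "\<kappa> i \<le> c 0"
proof -
  have c: "c i \<le> c 0" for i
  proof (induction i)
    case (Suc i)
    have "c (Suc i) \<le> \<kappa> i" "\<kappa> i \<le> c i" using assms by (auto simp: interlaces_def)
    with Suc show ?case by simp
  qed simp
  show "c i \<le> c 0" by (rule c)
  have "\<kappa> i \<le> c i" using assms by (simp add: interlaces_def)
  with c[of i] show "\<kappa> i \<le> c 0" by simp
qed

lemma complement_eqD:
  assumes "complement u n f = complement u n g" "\<And>i. f i \<le> u" "\<And>i. g i \<le> u"
    "\<And>i. n \<le> i \<Longrightarrow> f i = 0" "\<And>i. n \<le> i \<Longrightarrow> g i = 0"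
  shows "f = g"
proof
  fix i
  show "f i = g i"
  proof (cases "i < n")
    case True
    then have "u - f i = u - g i"
      using arg_cong[OF assms(1), of "\<lambda>xs. xs ! (n - Suc i)"] by (simp add: nth_complement_rev)
    then show ?thesis using assms(2)[of i] assms(3)[of i] by simp
  qed (use assms in simp)
qed

lemma complement_surj:
  assumes "length xs = n" "\<And>i. i < n \<Longrightarrow> xs ! i \<le> u"
  shows "complement u n (\<lambda>i. if i < n then u - xs ! (n - Suc i) else 0) = xs"
proof (rule nth_equalityI)
  fix i assume "i < length (complement u n (\<lambda>i. if i < n then u - xs ! (n - Suc i) else 0))"
  then have "i < n" by simp
  then show "complement u n (\<lambda>i. if i < n then u - xs ! (n - Suc i) else 0) ! i = xs ! i"
    using assms(2)[of i] by (simp add: nth_complement)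
qed (use assms in simp)

text \<open>Complementing reverses the inequalities and the order of the parts. The bound
  \<open>c 0 \<le> u\<close> becomes nonnegativity of the last entry, the only lower bound of an odd
  end.\<close>

lemma bij_betw_rows_above:
  assumes \<kappa>: "\<And>i. \<kappa> i \<le> u" "\<And>i. Suc n \<le> i \<Longrightarrow> \<kappa> i = 0"
  shows "bij_betw (complement u (Suc n)) (rows_above u (Suc n) \<kappa>) (odd_rows (complement u (Suc n) \<kappa>))"
proof (rule bij_betw_imageI)
  show "inj_on (complement u (Suc n)) (rows_above u (Suc n) \<kappa>)"
  proof (rule inj_onI)
    fix f g assume fg: "f \<in> rows_above u (Suc n) \<kappa>" "g \<in> rows_above u (Suc n) \<kappa>"
      and eq: "complement u (Suc n) f = complement u (Suc n) g"
    have "f i \<le> u" "g i \<le> u" for i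
      using fg interlaces_le_first(1)[of \<kappa> f i] interlaces_le_first(1)[of \<kappa> g i] by (auto simp: rows_above_def)
    then show "f = g" using fg by (intro complement_eqD[OF eq]) (auto simp: rows_above_def)
  qed
  show "complement u (Suc n) ` rows_above u (Suc n) \<kappa> = odd_rows (complement u (Suc n) \<kappa>)"
  proof (intro equalityI subsetI)
    fix xs assume "xs \<in> complement u (Suc n) ` rows_above u (Suc n) \<kappa>"
    then obtain c where c: "xs = complement u (Suc n) c" "interlaces \<kappa> c" by (auto simp: rows_above_def)
    have "(if Suc i < Suc n then complement u (Suc n) \<kappa> ! Suc i else 0) \<le> xs ! i \<and> xs ! i \<le> complement u (Suc n) \<kappa> ! i"
      if i: "i < Suc n" for i
    proof -
      have "c (Suc (n - Suc i)) \<le> \<kappa> (n - Suc i)" "\<kappa> (n - i) \<le> c (n - i)" using c(2) by (auto simp: interlaces_def)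
      then show ?thesis using i by (auto simp: c(1) nth_complement Suc_diff_Suc)
    qed
    then show "xs \<in> odd_rows (complement u (Suc n) \<kappa>)" using c by (simp add: odd_rows_def)
  next
    fix xs assume "xs \<in> odd_rows (complement u (Suc n) \<kappa>)"
    then have len: "length xs = Suc n"
      and xs: "\<And>i. i < Suc n \<Longrightarrow> xs ! i \<le> complement u (Suc n) \<kappa> ! i"
        "\<And>i. i < n \<Longrightarrow> complement u (Suc n) \<kappa> ! Suc i \<le> xs ! i"
      using odd_rows_nth[OF _ length_complement] by (simp_all add: less_Suc_eq_le)
    have le: "xs ! i \<le> u" if "i < Suc n" for i
      using xs(1)[OF that] that by (simp add: nth_complement)
    define c where "c = (\<lambda>i. if i < Suc n then u - xs ! (Suc n - Suc i) else 0)"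
    have "c (Suc i) \<le> \<kappa> i \<and> \<kappa> i \<le> c i" for i
    proof -
      have "\<kappa> i \<le> c i"
      proof (cases "i < Suc n")
        case True
        then have "n - i < Suc n" by simp
        from xs(1)[OF this] show ?thesis using True \<kappa>(1)[of i] by (simp add: c_def nth_complement)
      qed (use \<kappa>(2) in simp)
      moreover have "c (Suc i) \<le> \<kappa> i"
      proof (cases "Suc i < Suc n")
        case True
        then have "n - Suc i < n" by simp
        from xs(2)[OF this] show ?thesis using True \<kappa>(1)[of i] by (simp add: c_def nth_complement Suc_diff_Suc)
      qed (simp add: c_def)
      ultimately show ?thesis by simp
    qed
    then have "c \<in> rows_above u (Suc n) \<kappa>" by (simp add: rows_above_def interlaces_def c_def)
    moreover have "xs = complement u (Suc n) c"
      unfolding c_def using complement_surj[of xs "Suc n" u] len le by simp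
    ultimately show "xs \<in> complement u (Suc n) ` rows_above u (Suc n) \<kappa>" by blast
  qed
qed

text \<open>Here the two boxes differ: the \<open>n\<close> parts of the smaller partition fill the
  gaps between the \<open>Suc n\<close> complementary entries of \<open>c\<close>, as an even row
  does below an odd one.\<close>

lemma bij_betw_rows_below:
  assumes c: "\<And>i. c i \<le> u" "\<And>i. Suc n \<le> i \<Longrightarrow> c i = 0"
  shows "bij_betw (complement u n) (rows_below n c) (even_rows (complement u (Suc n) c))"
proof (rule bij_betw_imageI)
  show "inj_on (complement u n) (rows_below n c)"
  proof (rule inj_onI)
    fix f g assume fg: "f \<in> rows_below n c" "g \<in> rows_below n c" and eq: "complement u n f = complement u n g"
    have "f i \<le> u" "g i \<le> u" for i
      using fg c(1)[of i] by (auto simp: rows_below_def interlaces_def intro: order.trans)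
    then show "f = g" using fg by (intro complement_eqD[OF eq]) (auto simp: rows_below_def)
  qed
  show "complement u n ` rows_below n c = even_rows (complement u (Suc n) c)"
  proof (intro equalityI subsetI)
    fix xs assume "xs \<in> complement u n ` rows_below n c"
    then obtain f where f: "xs = complement u n f" "interlaces f c" by (auto simp: rows_below_def)
    have "complement u (Suc n) c ! Suc i \<le> xs ! i \<and> xs ! i \<le> complement u (Suc n) c ! i" if i: "i < n" for i
    proof -
      have "c (Suc (n - Suc i)) \<le> f (n - Suc i)" "f (n - Suc i) \<le> c (n - Suc i)" using f(2) by (auto simp: interlaces_def)
      then show ?thesis using i by (auto simp: f(1) nth_complement Suc_diff_Suc)
    qed
    then show "xs \<in> even_rows (complement u (Suc n) c)" using f by (simp add: even_rows_def)
  next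
    fix xs assume "xs \<in> even_rows (complement u (Suc n) c)"
    then have len: "length xs = n"
      and xs: "\<And>i. i < n \<Longrightarrow> xs ! i \<le> complement u (Suc n) c ! i"
        "\<And>i. i < n \<Longrightarrow> complement u (Suc n) c ! Suc i \<le> xs ! i"
      by (auto simp: even_rows_def)
    have le: "xs ! i \<le> u" if "i < n" for i
      using xs(1)[OF that] that by (simp add: nth_complement)
    define f where "f = (\<lambda>i. if i < n then u - xs ! (n - Suc i) else 0)"
    have "c (Suc i) \<le> f i \<and> f i \<le> c i" for i
    proof (cases "i < n")
      case True
      then have "n - Suc i < n" by simp
      from xs[OF this] show ?thesis
        using True c(1)[of i] c(1)[of "Suc i"] by (auto simp: f_def nth_complement Suc_diff_Suc)
    qed (use c(2) in \<open>simp add: f_def\<close>)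
    then have "f \<in> rows_below n c" by (simp add: rows_below_def interlaces_def f_def)
    moreover have "xs = complement u n f"
      unfolding f_def using complement_surj[of xs n u] len le by simp
    ultimately show "xs \<in> complement u n ` rows_below n c" by blast
  qed
qed

text \<open>The support conditions force \<open>K 0\<close> to vanish. The elements are thus chains
  from the zero partition through C 1, K 1, C 2 and so on to K n = \<kappa>, and the free end
  \<kappa> serves the induction on \<open>n\<close>.\<close>

definition row_chains :: "nat \<Rightarrow> nat \<Rightarrow> (nat \<Rightarrow> nat) \<Rightarrow> ((nat \<Rightarrow> nat \<Rightarrow> nat) \<times> (nat \<Rightarrow> nat \<Rightarrow> nat)) set" where
  "row_chains u n \<kappa> = {(C, K). (\<forall>j. \<not> (1 \<le> j \<and> j \<le> n) \<longrightarrow> C j = (\<lambda>_. 0)) \<and>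
     (\<forall>j. \<not> (1 \<le> j \<and> j \<le> n) \<longrightarrow> K j = (\<lambda>_. 0)) \<and> K n = \<kappa> \<and>
     (\<forall>j. 1 \<le> j \<and> j \<le> n \<longrightarrow> interlaces (K (j - 1)) (C j) \<and> interlaces (K j) (C j) \<and> C j 0 \<le> u)}"

lemma row_chains_support:
  assumes "(C, K) \<in> row_chains u n \<kappa>" "n \<le> i"
  shows "\<kappa> i = 0"
proof -
  have "K j i = 0" if "j \<le> n" "j \<le> i" for i j
    using that
  proof (induction j arbitrary: i)
    case 0
    then show ?case using assms(1) by (auto simp: row_chains_def)
  next
    case (Suc j)
    then obtain i' where i: "i = Suc i'" "j \<le> i'" by (cases i) auto
    have "interlaces (K j) (C (Suc j))" "interlaces (K (Suc j)) (C (Suc j))"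
      using assms(1) Suc.prems(1) by (force simp: row_chains_def)+
    then have "C (Suc j) (Suc i') \<le> K j i'" "K (Suc j) (Suc i') \<le> C (Suc j) (Suc i')"
      by (auto simp: interlaces_def)
    then show ?case using Suc.IH[OF _ i(2)] Suc.prems i by simp
  qed
  then show ?thesis using assms by (auto simp: row_chains_def)
qed

lemma row_chains_Suc:
  fixes u :: nat
  assumes \<kappa>: "\<And>i. Suc n \<le> i \<Longrightarrow> \<kappa> i = 0"
  defines "T \<equiv> SIGMA c:rows_above u (Suc n) \<kappa>. SIGMA \<mu>:rows_below n c. row_chains u n \<mu>"
    and "F \<equiv> \<lambda>(c, \<mu>, C, K). (C(Suc n := c), K(Suc n := \<kappa>))"
  shows "bij_betw F T (row_chains u (Suc n) \<kappa>)"
proof (rule bij_betwI[where g = "\<lambda>(C, K). (C (Suc n), K n, C(Suc n := \<lambda>_. 0), K(Suc n := \<lambda>_. 0))"])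
  show "F \<in> T \<rightarrow> row_chains u (Suc n) \<kappa>"
  proof
    fix t assume "t \<in> T"
    then obtain c \<mu> C K where t: "t = (c, \<mu>, C, K)" "c \<in> rows_above u (Suc n) \<kappa>" "\<mu> \<in> rows_below n c" "(C, K) \<in> row_chains u n \<mu>"
      by (auto simp: T_def)
    have "interlaces ((K(Suc n := \<kappa>)) (j - 1)) ((C(Suc n := c)) j) \<and> interlaces ((K(Suc n := \<kappa>)) j) ((C(Suc n := c)) j) \<and> (C(Suc n := c)) j 0 \<le> u"
      if "1 \<le> j \<and> j \<le> Suc n" for j
    proof (cases "j = Suc n")
      case True
      then show ?thesis using t by (auto simp: rows_above_def rows_below_def row_chains_def)
    next
      case False
      then have "j \<le> n" "j - 1 \<noteq> Suc n" using that by auto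
      then show ?thesis using t(4) that by (auto simp: row_chains_def)
    qed
    then show "F t \<in> row_chains u (Suc n) \<kappa>"
      using t by (auto simp: F_def row_chains_def)
  qed
  show "(\<lambda>(C, K). (C (Suc n), K n, C(Suc n := \<lambda>_. 0), K(Suc n := \<lambda>_. 0))) \<in> row_chains u (Suc n) \<kappa> \<rightarrow> T"
  proof
    fix t assume "t \<in> row_chains u (Suc n) \<kappa>"
    then obtain C K where t: "t = (C, K)" "(C, K) \<in> row_chains u (Suc n) \<kappa>" by (cases t) auto
    have il: "interlaces (K (j - 1)) (C j)" "interlaces (K j) (C j)" "C j 0 \<le> u" if "1 \<le> j" "j \<le> Suc n" for j
      using t(2) that by (auto simp: row_chains_def)
    have rest: "(C(Suc n := \<lambda>_. 0), K(Suc n := \<lambda>_. 0)) \<in> row_chains u n (K n)"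
      using t(2) il by (auto simp: row_chains_def)
    have 0: "K n i = 0" if "n \<le> i" for i by (rule row_chains_support[OF rest that])
    have "C (Suc n) i = 0" if i: "Suc n \<le> i" for i
    proof -
      obtain i' where i': "i = Suc i'" "n \<le> i'" using i by (cases i) auto
      have "C (Suc n) (Suc i') \<le> K n i'" using il(1)[of "Suc n"] by (simp add: interlaces_def)
      then show ?thesis using 0[OF i'(2)] i'(1) by simp
    qed
    moreover have "K (Suc n) = \<kappa>" using t(2) by (simp add: row_chains_def)
    ultimately show "(case t of (C, K) \<Rightarrow> (C (Suc n), K n, C(Suc n := \<lambda>_. 0), K(Suc n := \<lambda>_. 0))) \<in> T"
      using il[of "Suc n"] 0 rest by (auto simp: t T_def rows_above_def rows_below_def)
  qed
  show "(case F t of (C, K) \<Rightarrow> (C (Suc n), K n, C(Suc n := \<lambda>_. 0), K(Suc n := \<lambda>_. 0))) = t" if "t \<in> T" for t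
    using that by (auto simp: T_def F_def row_chains_def fun_eq_iff)
  show "F (case t of (C, K) \<Rightarrow> (C (Suc n), K n, C(Suc n := \<lambda>_. 0), K(Suc n := \<lambda>_. 0))) = t" if "t \<in> row_chains u (Suc n) \<kappa>" for t
    using that by (auto simp: F_def row_chains_def)
qed

text \<open>The weight of one step of \<open>cb\<close> before complementing. The condition
  \<open>c 0 < u\<close> says that the complementary odd end is positive.\<close>

definition chain_weight :: "real \<Rightarrow> nat \<Rightarrow> nat \<Rightarrow> (nat \<Rightarrow> real) \<Rightarrow> nat \<Rightarrow> (nat \<Rightarrow> nat) \<Rightarrow> (nat \<Rightarrow> nat) \<Rightarrow> (nat \<Rightarrow> nat) \<Rightarrow> real" where
  "chain_weight b u L x j \<mu> c \<kappa> = (if c 0 < u then 1 + b * x j else 1) *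
     x j powi (2 * int (\<Sum>i\<le>L. c i) - int (\<Sum>i\<le>L. \<mu> i) - int (\<Sum>i\<le>L. \<kappa> i))"

text \<open>Removing the last two partitions before the end \<kappa> corresponds to one unfolding of
  \<open>cb\<close> for the complementary rows.\<close>

theorem sum_row_chains_eq_cb:
  assumes "\<And>i. \<kappa> i \<le> u" "\<And>i. n \<le> i \<Longrightarrow> \<kappa> i = 0" "n \<le> L" "\<And>j. j < n \<Longrightarrow> x j \<noteq> 0"
  shows "finite (row_chains u n \<kappa>)"
    and "(\<Sum>(C, K)\<in>row_chains u n \<kappa>. \<Prod>j<n. chain_weight b u L x j (K j) (C (Suc j)) (K (Suc j))) =
      (\<Prod>j<n. x j ^ u) * cb b x n (complement u n \<kappa>)"
proof -
  have "finite (row_chains u n \<kappa>) \<and> (\<Sum>(C, K)\<in>row_chains u n \<kappa>. \<Prod>j<n. chain_weight b u L x j (K j) (C (Suc j)) (K (Suc j))) =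
    (\<Prod>j<n. x j ^ u) * cb b x n (complement u n \<kappa>)"
    using assms
  proof (induction n arbitrary: \<kappa>)
    case 0
    then have "\<kappa> = (\<lambda>_. 0)" by auto
    then have "row_chains u 0 \<kappa> = {(\<lambda>_ _. 0, \<lambda>_ _. 0)}" by (auto simp: row_chains_def fun_eq_iff)
    then show ?case by simp
  next
    case (Suc n)
    note bij1 = bij_betw_rows_above[OF Suc.prems(1,2)]
    have c: "c i \<le> u" "Suc n \<le> i \<Longrightarrow> c i = 0" if "c \<in> rows_above u (Suc n) \<kappa>" for c i
      using that interlaces_le_first(1)[of \<kappa> c i] by (auto simp: rows_above_def)
    have \<mu>: "\<mu> i \<le> u" "n \<le> i \<Longrightarrow> \<mu> i = 0" if "c \<in> rows_above u (Suc n) \<kappa>" "\<mu> \<in> rows_below n c" for c \<mu> i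
      using that c(1)[of c i] by (auto simp: rows_below_def interlaces_def intro: order.trans)
    have bij2: "bij_betw (complement u n) (rows_below n c) (even_rows (complement u (Suc n) c))"
      if "c \<in> rows_above u (Suc n) \<kappa>" for c
      using c[OF that] by (intro bij_betw_rows_below)
    have fin1: "finite (rows_above u (Suc n) \<kappa>)"
      using bij_betw_finite[OF bij1] by simp
    have fin2: "finite (rows_below n c)" if "c \<in> rows_above u (Suc n) \<kappa>" for c
      using bij_betw_finite[OF bij2[OF that]] by simp
    have IH: "finite (row_chains u n \<mu>)" "(\<Sum>(C, K)\<in>row_chains u n \<mu>. \<Prod>j<n. chain_weight b u L x j (K j) (C (Suc j)) (K (Suc j))) =
        (\<Prod>j<n. x j ^ u) * cb b x n (complement u n \<mu>)" if "c \<in> rows_above u (Suc n) \<kappa>" "\<mu> \<in> rows_below n c" for c \<mu>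
      using Suc.IH[of \<mu>] \<mu>[OF that] Suc.prems by auto
    define T where "T = (SIGMA c:rows_above u (Suc n) \<kappa>. SIGMA \<mu>:rows_below n c. row_chains u n \<mu>)"
    define F where "F = (\<lambda>(c :: nat \<Rightarrow> nat, \<mu> :: nat \<Rightarrow> nat, C, K). (C(Suc n := c), K(Suc n := \<kappa>)))"
    have bij: "bij_betw F T (row_chains u (Suc n) \<kappa>)"
      unfolding F_def T_def by (rule row_chains_Suc[OF Suc.prems(2)])
    have finT: "finite T"
      unfolding T_def using fin1 fin2 IH(1) by (intro finite_SigmaI)
    have wt: "(\<Prod>j<Suc n. chain_weight b u L x j (K' j) (C' (Suc j)) (K' (Suc j))) =
        (\<Prod>j<n. chain_weight b u L x j (K j) (C (Suc j)) (K (Suc j))) * chain_weight b u L x n \<mu> c \<kappa>"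
      if "(C, K) \<in> row_chains u n \<mu>" "C' = C(Suc n := c)" "K' = K(Suc n := \<kappa>)" for C K c \<mu> C' K'
    proof -
      have "K n = \<mu>" using that(1) by (simp add: row_chains_def)
      then show ?thesis unfolding that(2,3) by simp
    qed
    have "(\<Sum>(C, K)\<in>row_chains u (Suc n) \<kappa>. \<Prod>j<Suc n. chain_weight b u L x j (K j) (C (Suc j)) (K (Suc j))) =
        (\<Sum>t\<in>T. case F t of (C, K) \<Rightarrow> \<Prod>j<Suc n. chain_weight b u L x j (K j) (C (Suc j)) (K (Suc j)))"
      by (rule sum.reindex_bij_betw[OF bij, symmetric])
    also have "\<dots> = (\<Sum>(c, \<mu>, C, K)\<in>T. (\<Prod>j<n. chain_weight b u L x j (K j) (C (Suc j)) (K (Suc j))) *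
        chain_weight b u L x n \<mu> c \<kappa>)"
    proof (rule sum.cong[OF refl], clarify)
      fix c \<mu> C K assume "(c, \<mu>, C, K) \<in> T"
      then have "(C, K) \<in> row_chains u n \<mu>" by (auto simp: T_def)
      from wt[OF this refl refl, of c]
      show "(case F (c, \<mu>, C, K) of (C, K) \<Rightarrow> \<Prod>j<Suc n. chain_weight b u L x j (K j) (C (Suc j)) (K (Suc j))) =
        (\<Prod>j<n. chain_weight b u L x j (K j) (C (Suc j)) (K (Suc j))) * chain_weight b u L x n \<mu> c \<kappa>"
        unfolding F_def prod.case .
    qed
    also have "\<dots> = (\<Sum>c\<in>rows_above u (Suc n) \<kappa>. \<Sum>\<mu>\<in>rows_below n c. \<Sum>(C, K)\<in>row_chains u n \<mu>.
        (\<Prod>j<n. chain_weight b u L x j (K j) (C (Suc j)) (K (Suc j))) * chain_weight b u L x n \<mu> c \<kappa>)"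
    proof -
      have "finite (Sigma (rows_below n c) (row_chains u n))" if "c \<in> rows_above u (Suc n) \<kappa>" for c
        using fin2[OF that] IH(1)[OF that] by (intro finite_SigmaI)
      then show ?thesis
        unfolding T_def using fin1 fin2 IH(1) by (simp add: sum.Sigma case_prod_unfold)
    qed
    also have "\<dots> = (\<Sum>c\<in>rows_above u (Suc n) \<kappa>. \<Sum>\<mu>\<in>rows_below n c.
        (\<Prod>j<n. x j ^ u) * cb b x n (complement u n \<mu>) * chain_weight b u L x n \<mu> c \<kappa>)"
      by (intro sum.cong refl) (simp add: IH(2)[symmetric] sum_distrib_right case_prod_unfold)
    also have "\<dots> = (\<Sum>c\<in>rows_above u (Suc n) \<kappa>. \<Sum>\<mu>\<in>rows_below n c.
        (\<Prod>j<Suc n. x j ^ u) * ((if 0 < complement u (Suc n) c ! n then 1 + b * x n else 1) *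
        x n powi (int (sum_list (complement u (Suc n) \<kappa>)) + int (sum_list (complement u n \<mu>)) -
          2 * int (sum_list (complement u (Suc n) c))) * cb b x n (complement u n \<mu>)))"
    proof (intro sum.cong refl)
      fix c \<mu> assume t: "c \<in> rows_above u (Suc n) \<kappa>" "\<mu> \<in> rows_below n c"
      have xn: "x n \<noteq> 0" using Suc.prems(4) by simp
      have s: "int (sum_list (complement u (Suc n) \<kappa>)) = int (Suc n) * int u - int (\<Sum>i\<le>L. \<kappa> i)"
        "int (sum_list (complement u (Suc n) c)) = int (Suc n) * int u - int (\<Sum>i\<le>L. c i)"
        "int (sum_list (complement u n \<mu>)) = int n * int u - int (\<Sum>i\<le>L. \<mu> i)"
        using Suc.prems c[OF t(1)] \<mu>[OF t] by (intro sum_list_complement; simp)+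
      \<comment> \<open>The boxes have n + 1, n + 1 and n entries, so their areas contribute (n + 1)
        u + n u - 2 (n + 1) u = - u. This is the source of the factor
        \<open>x n ^ u\<close>.\<close>
      have e: "2 * int (\<Sum>i\<le>L. c i) - int (\<Sum>i\<le>L. \<mu> i) - int (\<Sum>i\<le>L. \<kappa> i) = int u +
          (int (sum_list (complement u (Suc n) \<kappa>)) + int (sum_list (complement u n \<mu>)) - 2 * int (sum_list (complement u (Suc n) c)))"
        unfolding s by (simp add: algebra_simps)
      have "x n powi (2 * int (\<Sum>i\<le>L. c i) - int (\<Sum>i\<le>L. \<mu> i) - int (\<Sum>i\<le>L. \<kappa> i)) = x n ^ u *
          x n powi (int (sum_list (complement u (Suc n) \<kappa>)) + int (sum_list (complement u n \<mu>)) - 2 * int (sum_list (complement u (Suc n) c)))"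
        unfolding e power_int_add[OF disjI1[OF xn]] power_int_of_nat ..
      moreover have "c 0 < u \<longleftrightarrow> 0 < complement u (Suc n) c ! n" by (simp add: nth_complement)
      ultimately show "(\<Prod>j<n. x j ^ u) * cb b x n (complement u n \<mu>) * chain_weight b u L x n \<mu> c \<kappa> =
        (\<Prod>j<Suc n. x j ^ u) * ((if 0 < complement u (Suc n) c ! n then 1 + b * x n else 1) *
        x n powi (int (sum_list (complement u (Suc n) \<kappa>)) + int (sum_list (complement u n \<mu>)) -
          2 * int (sum_list (complement u (Suc n) c))) * cb b x n (complement u n \<mu>))"
        unfolding chain_weight_def prod.lessThan_Suc by (simp only: mult_ac)
    qed
    also have "\<dots> = (\<Prod>j<Suc n. x j ^ u) * cb b x (Suc n) (complement u (Suc n) \<kappa>)"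
    proof -
      let ?g = "\<lambda>rho nu. (\<Prod>j<Suc n. x j ^ u) * ((if 0 < rho ! n then 1 + b * x n else 1) *
        x n powi (int (sum_list (complement u (Suc n) \<kappa>)) + int (sum_list nu) - 2 * int (sum_list rho)) * cb b x n nu)"
      have "(\<Sum>c\<in>rows_above u (Suc n) \<kappa>. \<Sum>\<mu>\<in>rows_below n c. ?g (complement u (Suc n) c) (complement u n \<mu>)) =
          (\<Sum>c\<in>rows_above u (Suc n) \<kappa>. \<Sum>nu\<in>even_rows (complement u (Suc n) c). ?g (complement u (Suc n) c) nu)"
        by (intro sum.cong refl) (rule sum.reindex_bij_betw[OF bij2])
      also have "\<dots> = (\<Sum>rho\<in>odd_rows (complement u (Suc n) \<kappa>). \<Sum>nu\<in>even_rows rho. ?g rho nu)"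
        by (rule sum.reindex_bij_betw[OF bij1])
      finally show ?thesis unfolding cb.simps sum_distrib_left .
    qed
    finally show ?case using finT bij_betw_finite[OF bij] by simp
  qed
  then show "finite (row_chains u n \<kappa>)" and "(\<Sum>(C, K)\<in>row_chains u n \<kappa>. \<Prod>j<n. chain_weight b u L x j (K j) (C (Suc j)) (K (Suc j))) =
      (\<Prod>j<n. x j ^ u) * cb b x n (complement u n \<kappa>)" by blast+
qed

lemma rsk_states_eq_row_chains: "{(C, K)\<in>rsk_states n. \<forall>j. C j 0 \<le> u} = row_chains u n (\<lambda>_. 0)"
proof (intro equalityI subsetI)
  fix t assume "t \<in> {(C, K)\<in>rsk_states n. \<forall>j. C j 0 \<le> u}"
  then obtain C K where t: "t = (C, K)" "(C, K) \<in> rsk_states n" "\<forall>j. C j 0 \<le> u" by auto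
  have "interlaces (K (j - 1)) (C j)" if j: "1 \<le> j" for j
  proof -
    obtain i where "j = Suc i" using j by (cases j) auto
    then show ?thesis using t(2) by (auto simp: rsk_states_def)
  qed
  then show "t \<in> row_chains u n (\<lambda>_. 0)" using t by (auto simp: rsk_states_def row_chains_def)
next
  fix t assume "t \<in> row_chains u n (\<lambda>_. 0)"
  then obtain C K where t: "t = (C, K)" "(C, K) \<in> row_chains u n (\<lambda>_. 0)" by (cases t) auto
  have z: "\<And>j. \<not> (1 \<le> j \<and> j \<le> n) \<Longrightarrow> C j = (\<lambda>_. 0)" "\<And>j. \<not> (1 \<le> j \<and> j < n) \<Longrightarrow> K j = (\<lambda>_. 0)"
    using t(2) by (auto simp: row_chains_def) (metis le_neq_implies_less)
  have il: "interlaces (K (j - 1)) (C j)" "interlaces (K j) (C j)" "C j 0 \<le> u" if "1 \<le> j" "j \<le> n" for j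
    using t(2) that by (auto simp: row_chains_def)
  have "interlaces (K j) (C j)" for j
    using il(2)[of j] z(1)[of j] z(2)[of j] by (cases "1 \<le> j \<and> j \<le> n") (auto simp: interlaces_zero)
  moreover have "interlaces (K j) (C (Suc j))" for j
    using il(1)[of "Suc j"] z(1)[of "Suc j"] z(2)[of j] by (cases "j < n") (auto simp: interlaces_zero)
  moreover have "C j 0 \<le> u" for j
    using il(3)[of j] z(1)[of j] by (cases "1 \<le> j \<and> j \<le> n") auto
  ultimately show "t \<in> {(C, K)\<in>rsk_states n. \<forall>j. C j 0 \<le> u}"
    using z by (auto simp: t rsk_states_def)
qed

section \<open>Directed paths\<close>

abbreviation grid_step :: "nat \<times> nat \<Rightarrow> nat \<times> nat \<Rightarrow> bool" where
  "grid_step \<equiv> \<lambda>(i, j) s. s = (i + 1, j) \<or> s = (i, j + 1)"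

lemma lpp_rec:
  assumes "1 \<le> i" "1 \<le> j"
  shows "lpp w i j = max (lpp w (i - 1) j) (lpp w i (j - 1)) + w i j"
  using assms by (cases i; cases j) auto

text \<open>The containment in a rectangle shows that a new cell has not been visited before. Hence
  the sum over the set of cells is the sum along the path.\<close>

lemma directed_path_bounds:
  assumes "\<pi> \<noteq> []" "hd \<pi> = (1, 1)" "successively grid_step \<pi>" "last \<pi> = (i, j)"
  shows "1 \<le> i \<and> 1 \<le> j \<and> Suc (length \<pi>) = i + j \<and> set \<pi> \<subseteq> {..i} \<times> {..j} \<and>
    (\<Sum>(a, b)\<in>set \<pi>. w a b) \<le> lpp w i j"
  using assms
proof (induction \<pi> arbitrary: i j rule: rev_induct)
  case Nil
  then show ?case by simp
next
  case (snoc s \<pi>)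
  show ?case
  proof (cases "\<pi> = []")
    case True
    then have "s = (1, 1)" "i = Suc 0" "j = Suc 0" using snoc.prems by auto
    then show ?thesis by (simp add: True)
  next
    case False
    obtain a b where ab: "last \<pi> = (a, b)" by fastforce
    have "hd \<pi> = (1, 1)" using snoc.prems(2) False by simp
    moreover have st: "successively grid_step \<pi>" "grid_step (a, b) s" and s: "s = (i, j)"
      using snoc.prems(3,4) False by (auto simp: successively_append_iff ab)
    ultimately have IH: "1 \<le> a" "1 \<le> b" "Suc (length \<pi>) = a + b" "set \<pi> \<subseteq> {..a} \<times> {..b}"
      "(\<Sum>(a, b)\<in>set \<pi>. w a b) \<le> lpp w a b"
      using snoc.IH[OF False _ _ ab] by auto
    have ij: "i = a + 1 \<and> j = b \<or> i = a \<and> j = b + 1" using st(2) s by auto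
    then have pos: "1 \<le> i" "1 \<le> j" using IH by auto
    have sub: "set \<pi> \<subseteq> {..i} \<times> {..j}" using ij IH(4) by fastforce
    have "lpp w a b \<le> max (lpp w (i - 1) j) (lpp w i (j - 1))" using ij by auto
    moreover have "s \<notin> set \<pi>" using IH(4) ij s by auto
    then have "(\<Sum>(a, b)\<in>set (\<pi> @ [s]). w a b) = w i j + (\<Sum>(a, b)\<in>set \<pi>. w a b)"
      by (simp add: s)
    ultimately have "(\<Sum>(a, b)\<in>set (\<pi> @ [s]). w a b) \<le> lpp w i j"
      using IH(5) lpp_rec[OF pos, of w] by simp
    then show ?thesis using pos sub ij IH(3) s by auto
  qed
qed

lemma exists_maximal_path:
  assumes "1 \<le> i" "1 \<le> j"
  shows "\<exists>\<pi>. \<pi> \<noteq> [] \<and> hd \<pi> = (1, 1) \<and> last \<pi> = (i, j) \<and> successively grid_step \<pi> \<and>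
    (\<Sum>(a, b)\<in>set \<pi>. w a b) = lpp w i j"
  using assms
proof (induction "i + j" arbitrary: i j)
  case 0
  then show ?case by simp
next
  case (Suc n)
  show ?case
  proof (cases "i = 1 \<and> j = 1")
    case True
    then have "(\<Sum>(a, b)\<in>set [(1, 1)]. w a b) = lpp w i j" by simp
    then show ?thesis using True by (intro exI[of _ "[(1, 1)]"]) simp
  next
    case False
    have "\<exists>a b. 1 \<le> a \<and> 1 \<le> b \<and> grid_step (a, b) (i, j) \<and> lpp w a b = max (lpp w (i - 1) j) (lpp w i (j - 1))"
    proof (cases "i = 1 \<or> j \<noteq> 1 \<and> lpp w (i - 1) j \<le> lpp w i (j - 1)")
      case True
      then show ?thesis using False Suc.prems by (intro exI[of _ i] exI[of _ "j - 1"]) auto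
    next
      case False
      then show ?thesis using Suc.prems by (intro exI[of _ "i - 1"] exI[of _ j]) auto
    qed
    then obtain a b where ab: "1 \<le> a" "1 \<le> b" "grid_step (a, b) (i, j)"
      "lpp w a b = max (lpp w (i - 1) j) (lpp w i (j - 1))" by blast
    have "n = a + b" using ab(3) Suc.hyps(2) by auto
    from Suc.hyps(1)[OF this ab(1,2)] obtain \<pi> where \<pi>: "\<pi> \<noteq> []" "hd \<pi> = (1, 1)" "last \<pi> = (a, b)"
      "successively grid_step \<pi>" "(\<Sum>(a, b)\<in>set \<pi>. w a b) = lpp w a b" by blast
    have "(i, j) \<notin> set \<pi>" using directed_path_bounds[OF \<pi>(1,2,4,3), of w] ab(3) by auto
    then have "(\<Sum>(a, b)\<in>set (\<pi> @ [(i, j)]). w a b) = lpp w i j"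
      using \<pi>(5) ab(4) lpp_rec[OF Suc.prems, of w] by simp
    moreover have "successively grid_step (\<pi> @ [(i, j)])"
      using \<pi>(3,4) ab(3) by (simp add: successively_append_iff)
    ultimately show ?thesis using \<pi>(1,2) by (intro exI[of _ "\<pi> @ [(i, j)]"]) simp
  qed
qed

lemma last_passage_eq_lpp:
  assumes "1 \<le> N"
  shows "last_passage N w = lpp w N N"
  unfolding last_passage_def
proof (rule Max_eqI)
  have bounds: "Suc (length \<pi>) = N + N \<and> set \<pi> \<subseteq> {..N} \<times> {..N} \<and> (\<Sum>(a, b)\<in>set \<pi>. w a b) \<le> lpp w N N"
    if "\<pi> \<in> directed_paths N" for \<pi>
    using that directed_path_bounds[of \<pi> N N w] by (simp add: directed_paths_def)
  have "directed_paths N \<subseteq> {\<pi>. set \<pi> \<subseteq> {..N} \<times> {..N} \<and> length \<pi> \<le> N + N}"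
    using bounds by fastforce
  then show "finite ((\<lambda>\<pi>. \<Sum>(i, j)\<in>set \<pi>. w i j) ` directed_paths N)"
    by (intro finite_imageI finite_subset[OF _ finite_lists_length_le]) auto
  show "y \<le> lpp w N N" if "y \<in> (\<lambda>\<pi>. \<Sum>(i, j)\<in>set \<pi>. w i j) ` directed_paths N" for y
    using that bounds by auto
  from exists_maximal_path[OF assms assms, of w] obtain \<pi> where
    "\<pi> \<in> directed_paths N" "(\<Sum>(a, b)\<in>set \<pi>. w a b) = lpp w N N"
    unfolding directed_paths_def by blast
  then show "lpp w N N \<in> (\<lambda>\<pi>. \<Sum>(i, j)\<in>set \<pi>. w i j) ` directed_paths N"
    by (metis (no_types, lifting) image_eqI)
qed

text \<open>By symmetry, the best continuation from an antidiagonal cell to the far corner weighs as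
  much as the best path from the origin to that cell. The bound is moved from the corner back to the
  antidiagonal, one antidiagonal at a time.\<close>

lemma lpp_symmetric_le_iff:
  assumes N: "1 \<le> N"
    and sym: "\<And>i j. 1 \<le> i \<Longrightarrow> i \<le> N \<Longrightarrow> 1 \<le> j \<Longrightarrow> j \<le> N \<Longrightarrow> w i j = w (N - j + 1) (N - i + 1)"
  shows "lpp w N N \<le> m \<longleftrightarrow>
    (\<forall>j\<in>{1..N}. 2 * max (lpp w (N - j) j) (lpp w (N + 1 - j) (j - 1)) + w (N + 1 - j) j \<le> m)"
proof -
  \<comment> \<open>By reflection this is the maximal weight of a path from (i, j) to (N, N), as the
    recursion proved next shows.\<close>
  define H where "H i j = lpp w (N + 1 - j) (N + 1 - i)" for i j
  have H: "H i j = max (H (i + 1) j) (H i (j + 1)) + w i j" if ij: "1 \<le> i" "i \<le> N" "1 \<le> j" "j \<le> N" for i j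
  proof -
    have "N + 1 - j = N - j + 1" "N + 1 - i = N - i + 1" using ij by auto
    then show ?thesis
      using lpp_rec[of "N + 1 - j" "N + 1 - i" w] sym[OF ij] ij by (simp add: H_def max.commute)
  qed
  have G: "lpp w i j = max (lpp w (i - 1) j) (lpp w i (j - 1)) + w i j" if "1 \<le> i" "1 \<le> j" for i j
    using that by (rule lpp_rec)
  \<comment> \<open>All paths through a cell of antidiagonal \<open>d\<close> have weight at most
    \<open>m\<close>. The cell itself is counted in both summands, hence \<open>w i j\<close> on the
    right.\<close>
  define E where "E d \<longleftrightarrow> (\<forall>i j. 1 \<le> i \<and> i \<le> N \<and> 1 \<le> j \<and> j \<le> N \<and> i + j = d \<longrightarrow>
      lpp w i j + H i j \<le> m + w i j)" for d
  have ED: "lpp w i j + H i j \<le> m + w i j"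
    if "E d" "1 \<le> i" "i \<le> N" "1 \<le> j" "j \<le> N" "i + j = d" for d i j
    using that unfolding E_def by blast
  \<comment> \<open>Both conditions say that the maximal path weight through each edge between two
    consecutive antidiagonals is at most \<open>m\<close>.\<close>
  have step: "E d \<longleftrightarrow> E (Suc d)" if d: "N + 1 \<le> d" "d < 2 * N" for d
  proof
    assume E: "E d"
    show "E (Suc d)"
      unfolding E_def
    proof (intro allI impI, elim conjE)
      fix i j assume ij: "1 \<le> i" "i \<le> N" "1 \<le> j" "j \<le> N" "i + j = Suc d"
      then have i2: "2 \<le> i" "2 \<le> j" using d by auto
      have 1: "lpp w (i - 1) j + H (i - 1) j \<le> m + w (i - 1) j"
        by (rule ED[OF E]) (use ij i2 in auto)
      have 2: "lpp w i (j - 1) + H i (j - 1) \<le> m + w i (j - 1)"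
        by (rule ED[OF E]) (use ij i2 in auto)
      have 3: "H i j + w (i - 1) j \<le> H (i - 1) j" using H[of "i - 1" j] ij i2 by simp
      have 4: "H i j + w i (j - 1) \<le> H i (j - 1)" using H[of i "j - 1"] ij i2 by simp
      show "lpp w i j + H i j \<le> m + w i j" using 1 2 3 4 G[OF ij(1,3)] by linarith
    qed
  next
    assume E: "E (Suc d)"
    show "E d"
      unfolding E_def
    proof (intro allI impI, elim conjE)
      fix i j assume ij: "1 \<le> i" "i \<le> N" "1 \<le> j" "j \<le> N" "i + j = d"
      have 1: "lpp w i j + H (i + 1) j \<le> m" if "i < N"
      proof -
        have "lpp w (i + 1) j + H (i + 1) j \<le> m + w (i + 1) j" by (rule ED[OF E]) (use ij that in auto)
        then show ?thesis using G[of "i + 1" j] ij by simp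
      qed
      have 2: "lpp w i j + H i (j + 1) \<le> m" if "j < N"
      proof -
        have "lpp w i (j + 1) + H i (j + 1) \<le> m + w i (j + 1)" by (rule ED[OF E]) (use ij that in auto)
        then show ?thesis using G[of i "j + 1"] ij by simp
      qed
      have "H (i + 1) j = 0" if "\<not> i < N" using that ij by (simp add: H_def)
      moreover have "H i (j + 1) = 0" if "\<not> j < N" using that ij by (simp add: H_def)
      moreover have "i < N \<or> j < N" using ij d by linarith
      ultimately have "lpp w i j + max (H (i + 1) j) (H i (j + 1)) \<le> m"
        using 1 2 by (cases "i < N"; cases "j < N") auto
      then show "lpp w i j + H i j \<le> m + w i j" using H[OF ij(1-4)] by simp
    qed
  qed
  have "E (N + 1) \<longleftrightarrow> E (N + 1 + k)" if "N + 1 + k \<le> 2 * N" for k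
    using that
  proof (induction k)
    case (Suc k)
    then show ?case using step[of "N + 1 + k"] by simp
  qed simp
  from this[of "N - 1"] have "E (N + 1) \<longleftrightarrow> E (2 * N)" using N by (simp add: mult_2)
  moreover have "E (2 * N) \<longleftrightarrow> lpp w N N + H N N \<le> m + w N N"
  proof
    assume "lpp w N N + H N N \<le> m + w N N"
    moreover have "i = N \<and> j = N" if "i \<le> N" "j \<le> N" "i + j = 2 * N" for i j using that by simp
    ultimately show "E (2 * N)" unfolding E_def by blast
  qed (use N in \<open>simp add: E_def\<close>)
  moreover have "H N N = w N N" using H[of N N] N by (simp add: H_def)
  ultimately have "lpp w N N \<le> m \<longleftrightarrow> E (N + 1)" by simp
  also have "\<dots> \<longleftrightarrow> (\<forall>j\<in>{1..N}. lpp w (N + 1 - j) j + H (N + 1 - j) j \<le> m + w (N + 1 - j) j)"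
  proof
    assume E: "E (N + 1)"
    show "\<forall>j\<in>{1..N}. lpp w (N + 1 - j) j + H (N + 1 - j) j \<le> m + w (N + 1 - j) j"
      by (rule ballI, rule ED[OF E]) auto
  next
    assume R: "\<forall>j\<in>{1..N}. lpp w (N + 1 - j) j + H (N + 1 - j) j \<le> m + w (N + 1 - j) j"
    show "E (N + 1)"
      unfolding E_def
    proof (intro allI impI, elim conjE)
      fix i j assume ij: "1 \<le> j" "j \<le> N" "i + j = N + 1"
      then have "i = N + 1 - j" by simp
      then show "lpp w i j + H i j \<le> m + w i j" using R ij by auto
    qed
  qed
  also have "\<dots> \<longleftrightarrow> (\<forall>j\<in>{1..N}. 2 * max (lpp w (N - j) j) (lpp w (N + 1 - j) (j - 1)) + w (N + 1 - j) j \<le> m)"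
  proof (rule ball_cong[OF refl])
    fix j assume j: "j \<in> {1..N}"
    then have e: "N + 1 - j - 1 = N - j" "N + 1 - (N + 1 - j) = j" by auto
    have "lpp w (N + 1 - j) j = max (lpp w (N - j) j) (lpp w (N + 1 - j) (j - 1)) + w (N + 1 - j) j"
      using G[of "N + 1 - j" j] j unfolding e by auto
    moreover have "H (N + 1 - j) j = lpp w (N + 1 - j) j" unfolding H_def e ..
    ultimately show "(lpp w (N + 1 - j) j + H (N + 1 - j) j \<le> m + w (N + 1 - j) j) \<longleftrightarrow>
      (2 * max (lpp w (N - j) j) (lpp w (N + 1 - j) (j - 1)) + w (N + 1 - j) j \<le> m)" by linarith
  qed
  finally show ?thesis .
qed

section \<open>Summation over arrays\<close>

lemma lpp_cong:
  assumes "\<And>a b. 1 \<le> a \<Longrightarrow> a \<le> i \<Longrightarrow> 1 \<le> b \<Longrightarrow> b \<le> j \<Longrightarrow> w a b = w' a b"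
  shows "lpp w i j = lpp w' i j"
  using assms
proof (induction w i j rule: lpp.induct)
  case (3 w i j)
  have "lpp w i (Suc j) = lpp w' i (Suc j)" by (rule 3(1)) (simp add: 3(3))
  moreover have "lpp w (Suc i) j = lpp w' (Suc i) j" by (rule 3(2)) (simp add: 3(3))
  moreover have "w (Suc i) (Suc j) = w' (Suc i) (Suc j)" by (simp add: 3(3))
  ultimately show ?case by simp
qed auto

definition staircase :: "nat \<Rightarrow> (nat \<times> nat) set" where
  "staircase N = {(i, j). i \<in> {1..N} \<and> j \<in> {1..N} \<and> i + j \<le> N + 1}"

lemma finite_staircase [simp]: "finite (staircase N)"
  by (rule finite_subset[of _ "{1..N} \<times> {1..N}"]) (auto simp: staircase_def)

lemma staircase_arrays_iff: "w \<in> staircase_arrays N \<longleftrightarrow> (\<forall>i j. (i, j) \<notin> staircase N \<longrightarrow> w i j = 0)"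
  unfolding staircase_arrays_def staircase_def mem_Collect_eq case_prod_conv
  by (intro all_cong1 arg_cong2[where f = "(\<longrightarrow>)"] refl) auto

lemma prod_staircase_columns: "(\<Prod>(i, j)\<in>staircase N. f i j) = (\<Prod>j=1..N. \<Prod>i=1..N + 1 - j. f i j)"
proof -
  have "(\<Prod>j=1..N. \<Prod>i=1..N + 1 - j. f i j) = (\<Prod>(j, i)\<in>(SIGMA j:{1..N}. {1..N + 1 - j}). f i j)"
    by (rule prod.Sigma) auto
  also have "\<dots> = (\<Prod>(i, j)\<in>staircase N. f i j)"
    by (rule prod.reindex_bij_witness[of _ "\<lambda>(i, j). (j, i)" "\<lambda>(j, i). (i, j)"])
      (auto simp: staircase_def)
  finally show ?thesis ..
qed

text \<open>Row i is indexed by j = N + 1 - i, so that the parameter of the row is p j.\<close>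

lemma prod_staircase_rows: "(\<Prod>(i, j)\<in>staircase N. f i j) = (\<Prod>j=1..N. \<Prod>l=1..j. f (N + 1 - j) l)"
proof -
  have "(\<Prod>j=1..N. \<Prod>l=1..j. f (N + 1 - j) l) = (\<Prod>(j, l)\<in>(SIGMA j:{1..N}. {1..j}). f (N + 1 - j) l)"
    by (rule prod.Sigma) auto
  also have "\<dots> = (\<Prod>(i, j)\<in>staircase N. f i j)"
    by (rule prod.reindex_bij_witness[of _ "\<lambda>(i, j). (N + 1 - i, j)" "\<lambda>(j, i). (N + 1 - j, i)"])
      (auto simp: staircase_def)
  finally show ?thesis ..
qed

text \<open>The parameter p j belongs to column \<open>j\<close> and to row N + 1 - j, which meet in
  an antidiagonal cell. Its exponent is therefore a row sum plus a column sum, both given by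
  \<open>rsk_sizes\<close>.\<close>

lemma staircase_monomial:
  fixes p :: "nat \<Rightarrow> real"
  assumes p: "\<And>j. 1 \<le> j \<Longrightarrow> j \<le> N \<Longrightarrow> p j \<noteq> 0" and CK: "rsk N w = (C, K)"
  shows "(\<Prod>(i, j)\<in>staircase N. (p (N - i + 1) * p j) ^ w i j) =
    (\<Prod>j<N. p (Suc j) powi (2 * int (\<Sum>i\<le>N. C (Suc j) i) - int (\<Sum>i\<le>N. K j i) - int (\<Sum>i\<le>N. K (Suc j) i)))"
proof -
  have "(\<Prod>(i, j)\<in>staircase N. (p (N - i + 1) * p j) ^ w i j) =
      (\<Prod>(i, j)\<in>staircase N. p (N - i + 1) ^ w i j) * (\<Prod>(i, j)\<in>staircase N. p j ^ w i j)"
    by (simp add: case_prod_unfold power_mult_distrib prod.distrib)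
  also have "(\<Prod>(i, j)\<in>staircase N. p (N - i + 1) ^ w i j) = (\<Prod>j=1..N. p j ^ (\<Sum>l=1..j. w (Suc N - j) l))"
    unfolding prod_staircase_rows by (intro prod.cong refl) (auto simp: power_sum)
  also have "(\<Prod>(i, j)\<in>staircase N. p j ^ w i j) = (\<Prod>j=1..N. p j ^ (\<Sum>l=1..Suc N - j. w l j))"
    unfolding prod_staircase_columns by (intro prod.cong refl) (auto simp: power_sum)
  also have "(\<Prod>j=1..N. p j ^ (\<Sum>l=1..j. w (Suc N - j) l)) * (\<Prod>j=1..N. p j ^ (\<Sum>l=1..Suc N - j. w l j)) =
      (\<Prod>j=1..N. p j powi (2 * int (\<Sum>i\<le>N. C j i) - int (\<Sum>i\<le>N. K (j - 1) i) - int (\<Sum>i\<le>N. K j i)))"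
    unfolding prod.distrib[symmetric]
  proof (rule prod.cong[OF refl])
    fix j assume j: "j \<in> {1..N}"
    then have j': "1 \<le> j" "j \<le> N" by auto
    have "2 * int (\<Sum>i\<le>N. C j i) - int (\<Sum>i\<le>N. K (j - 1) i) - int (\<Sum>i\<le>N. K j i) =
        int ((\<Sum>l=1..j. w (Suc N - j) l) + (\<Sum>l=1..Suc N - j. w l j))"
      using rsk_sizes[OF order.refl CK j'] by linarith
    then show "p j ^ (\<Sum>l=1..j. w (Suc N - j) l) * p j ^ (\<Sum>l=1..Suc N - j. w l j) =
        p j powi (2 * int (\<Sum>i\<le>N. C j i) - int (\<Sum>i\<le>N. K (j - 1) i) - int (\<Sum>i\<le>N. K j i))"
      by (simp only: power_int_of_nat power_add)
  qed
  also have "\<dots> = (\<Prod>j<N. p (Suc j) powi (2 * int (\<Sum>i\<le>N. C (Suc j) i) - int (\<Sum>i\<le>N. K j i) - int (\<Sum>i\<le>N. K (Suc j) i)))"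
    by (rule prod.reindex_bij_witness[of _ Suc "\<lambda>j. j - 1"]) auto
  finally show ?thesis .
qed

definition bounded_arrays :: "nat \<Rightarrow> nat \<Rightarrow> (nat \<Rightarrow> nat \<Rightarrow> nat) set" where
  "bounded_arrays u N = {w \<in> staircase_arrays N. \<forall>j\<in>{1..N}. lpp w (N + 1 - j) j \<le> u}"

lemma complement_zero: "complement u n (\<lambda>_. 0) = replicate n u"
  by (rule nth_equalityI) (simp_all add: nth_complement)

text \<open>\<open>rsk\<close> maps these arrays onto the chains that end in the zero partition,
  whose complement is the rectangle, and the bounds on last passage times become bounds on first
  parts.\<close>

lemma bounded_arrays_sum:
  fixes p :: "nat \<Rightarrow> real"
  assumes p: "\<And>j. 1 \<le> j \<Longrightarrow> j \<le> N \<Longrightarrow> p j \<noteq> 0"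
  shows "finite (bounded_arrays u N)"
    and "(\<Sum>w\<in>bounded_arrays u N. (\<Prod>j=1..N. if lpp w (N + 1 - j) j < u then 1 + b * p j else 1) *
        (\<Prod>(i, j)\<in>staircase N. (p (N - i + 1) * p j) ^ w i j)) =
      (\<Prod>j=1..N. p j ^ u) * cb b (\<lambda>j. p (Suc j)) N (replicate N u)"
proof -
  have corner: "fst (rsk N w) j 0 = lpp w (N + 1 - j) j" if "1 \<le> j" "j \<le> N" for w j
    using rsk_corner[of j N w] that by simp
  have zero: "C j = (\<lambda>_. 0)" if "(C, K) \<in> rsk_states N" "j \<notin> {1..N}" for C K j
    using that by (auto simp: rsk_states_def)
  have mem: "w \<in> bounded_arrays u N \<longleftrightarrow> w \<in> staircase_arrays N \<and> rsk N w \<in> row_chains u N (\<lambda>_. 0)" for w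
  proof -
    obtain C K where CK: "rsk N w = (C, K)" by fastforce
    then have st: "(C, K) \<in> rsk_states N" using rsk_in_states[of N w] by simp
    have "(\<forall>j. C j 0 \<le> u) \<longleftrightarrow> (\<forall>j\<in>{1..N}. lpp w (N + 1 - j) j \<le> u)"
    proof
      assume R: "\<forall>j. C j 0 \<le> u"
      show "\<forall>j\<in>{1..N}. lpp w (N + 1 - j) j \<le> u"
      proof
        fix j assume "j \<in> {1..N}"
        then show "lpp w (N + 1 - j) j \<le> u" using R[rule_format, of j] corner[of j w] by (simp add: CK)
      qed
    next
      assume R: "\<forall>j\<in>{1..N}. lpp w (N + 1 - j) j \<le> u"
      show "\<forall>j. C j 0 \<le> u"
      proof
        fix j show "C j 0 \<le> u"
          using R corner[of j w] zero[OF st, of j] by (cases "j \<in> {1..N}") (auto simp: CK)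
      qed
    qed
    then show ?thesis using st by (simp add: bounded_arrays_def rsk_states_eq_row_chains[symmetric] CK)
  qed
  have bij: "bij_betw (rsk N) (bounded_arrays u N) (row_chains u N (\<lambda>_. 0))"
  proof (rule bij_betw_subset[OF bij_betw_rsk])
    show "bounded_arrays u N \<subseteq> staircase_arrays N" using mem by blast
    show "rsk N ` bounded_arrays u N = row_chains u N (\<lambda>_. 0)"
    proof (intro equalityI subsetI)
      fix t assume t: "t \<in> row_chains u N (\<lambda>_. 0)"
      then have "t \<in> rsk_states N" by (auto simp: rsk_states_eq_row_chains[symmetric])
      then obtain w where "w \<in> staircase_arrays N" "t = rsk N w"
        using bij_betw_imp_surj_on[OF bij_betw_rsk] by blast
      then show "t \<in> rsk N ` bounded_arrays u N" using t mem by blast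
    qed (use mem in blast)
  qed
  have p': "p (Suc j) \<noteq> 0" if "j < N" for j using p that by simp
  have ch: "finite (row_chains u N (\<lambda>_. 0))"
    "(\<Sum>(C, K)\<in>row_chains u N (\<lambda>_. 0). \<Prod>j<N. chain_weight b u N (\<lambda>j. p (Suc j)) j (K j) (C (Suc j)) (K (Suc j))) =
      (\<Prod>j<N. p (Suc j) ^ u) * cb b (\<lambda>j. p (Suc j)) N (complement u N (\<lambda>_. 0))"
    by (rule sum_row_chains_eq_cb[where L = N and x = "\<lambda>j. p (Suc j)"]; simp add: p')+
  show "finite (bounded_arrays u N)" using ch(1) bij_betw_finite[OF bij] by simp
  have "(\<Sum>w\<in>bounded_arrays u N. (\<Prod>j=1..N. if lpp w (N + 1 - j) j < u then 1 + b * p j else 1) *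
        (\<Prod>(i, j)\<in>staircase N. (p (N - i + 1) * p j) ^ w i j)) =
      (\<Sum>w\<in>bounded_arrays u N. case rsk N w of (C, K) \<Rightarrow>
        \<Prod>j<N. chain_weight b u N (\<lambda>j. p (Suc j)) j (K j) (C (Suc j)) (K (Suc j)))"
  proof (rule sum.cong[OF refl])
    fix w
    obtain C K where CK: "rsk N w = (C, K)" by fastforce
    have mono: "(\<Prod>(i, j)\<in>staircase N. (p (N - i + 1) * p j) ^ w i j) =
        (\<Prod>j<N. p (Suc j) powi (2 * int (\<Sum>i\<le>N. C (Suc j) i) - int (\<Sum>i\<le>N. K j i) - int (\<Sum>i\<le>N. K (Suc j) i)))"
      using p CK by (rule staircase_monomial)
    have "(\<Prod>j=1..N. if lpp w (N + 1 - j) j < u then 1 + b * p j else 1) =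
        (\<Prod>j<N. if C (Suc j) 0 < u then 1 + b * p (Suc j) else 1)"
      using corner[of _ w] by (intro prod.reindex_bij_witness[of _ Suc "\<lambda>j. j - 1"]) (auto simp: CK)
    then show "(\<Prod>j=1..N. if lpp w (N + 1 - j) j < u then 1 + b * p j else 1) *
        (\<Prod>(i, j)\<in>staircase N. (p (N - i + 1) * p j) ^ w i j) = (case rsk N w of (C, K) \<Rightarrow>
        \<Prod>j<N. chain_weight b u N (\<lambda>j. p (Suc j)) j (K j) (C (Suc j)) (K (Suc j)))"
      unfolding CK prod.case chain_weight_def prod.distrib mono by (rule arg_cong)
  qed
  also have "\<dots> = (\<Sum>(C, K)\<in>row_chains u N (\<lambda>_. 0). \<Prod>j<N. chain_weight b u N (\<lambda>j. p (Suc j)) j (K j) (C (Suc j)) (K (Suc j)))"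
    by (rule sum.reindex_bij_betw[OF bij])
  also have "\<dots> = (\<Prod>j<N. p (Suc j) ^ u) * cb b (\<lambda>j. p (Suc j)) N (replicate N u)"
    unfolding ch(2) complement_zero ..
  also have "(\<Prod>j<N. p (Suc j) ^ u) = (\<Prod>j=1..N. p j ^ u)"
    by (rule prod.reindex_bij_witness[of _ "\<lambda>j. j - 1" Suc]) auto
  finally show "(\<Sum>w\<in>bounded_arrays u N. (\<Prod>j=1..N. if lpp w (N + 1 - j) j < u then 1 + b * p j else 1) *
      (\<Prod>(i, j)\<in>staircase N. (p (N - i + 1) * p j) ^ w i j)) =
    (\<Prod>j=1..N. p j ^ u) * cb b (\<lambda>j. p (Suc j)) N (replicate N u)" .
qed

section \<open>Even and odd parts of the antidiagonal weights\<close>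

definition antidiagonal_arrays :: "nat \<Rightarrow> nat \<Rightarrow> (nat \<Rightarrow> nat \<Rightarrow> nat) set" where
  "antidiagonal_arrays m N = {w \<in> staircase_arrays N.
     \<forall>j\<in>{1..N}. 2 * max (lpp w (N - j) j) (lpp w (N + 1 - j) (j - 1)) + w (N + 1 - j) j \<le> m}"

definition half_antidiagonal :: "nat \<Rightarrow> (nat \<Rightarrow> nat \<Rightarrow> nat) \<Rightarrow> nat \<Rightarrow> nat \<Rightarrow> nat" where
  "half_antidiagonal N w i j = (if i + j = N + 1 then w i j div 2 else w i j)"

definition double_antidiagonal :: "nat \<Rightarrow> (nat \<Rightarrow> nat \<Rightarrow> nat) \<Rightarrow> nat set \<Rightarrow> nat \<Rightarrow> nat \<Rightarrow> nat" where
  "double_antidiagonal N w J i j = (if i + j = N + 1 then 2 * w i j + of_bool (j \<in> J) else w i j)"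

text \<open>An odd weight needs one more unit than its even part. An odd bound has that unit to
  spare, an even bound only if the halved quantity is strictly below \<open>u\<close>.\<close>

lemma antidiagonal_le_iff:
  fixes M a e u :: nat
  assumes "e \<le> 1"
  shows "2 * M + (2 * a + e) \<le> 2 * u + (if half then 1 else 0) \<longleftrightarrow> M + a \<le> u \<and> (e = 1 \<longrightarrow> half \<or> M + a < u)"
  using assms by (cases half; cases "e = 0") auto

lemma bij_betw_double_antidiagonal:
  "bij_betw (\<lambda>(w, J). double_antidiagonal N w J)
    (SIGMA w:bounded_arrays u N. Pow {j \<in> {1..N}. half \<or> lpp w (N + 1 - j) j < u})
    (antidiagonal_arrays (2 * u + (if half then 1 else 0)) N)"
proof -
  have corner: "lpp w (N + 1 - j) j = max (lpp w (N - j) j) (lpp w (N + 1 - j) (j - 1)) + w (N + 1 - j) j"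
    if "1 \<le> j" "j \<le> N" for w j
    using lpp_rec[of "N + 1 - j" j w] that by (auto simp: Suc_diff_le)
  \<comment> \<open>Doubling changes antidiagonal cells only, so passage times strictly before the
    antidiagonal are unaffected.\<close>
  have same: "lpp (double_antidiagonal N w J) i j = lpp w i j" if "i + j \<le> N" for w J i j
    by (rule lpp_cong) (use that in \<open>auto simp: double_antidiagonal_def\<close>)
  have mem: "double_antidiagonal N w J \<in> antidiagonal_arrays (2 * u + (if half then 1 else 0)) N \<longleftrightarrow>
      (w, J) \<in> (SIGMA w:bounded_arrays u N. Pow {j \<in> {1..N}. half \<or> lpp w (N + 1 - j) j < u})"
    if w: "w \<in> staircase_arrays N" and J: "J \<subseteq> {1..N}" for w J
  proof -
    let ?w = "double_antidiagonal N w J"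
    have "?w \<in> staircase_arrays N"
      using w J by (force simp: staircase_arrays_iff double_antidiagonal_def staircase_def)
    moreover have "2 * max (lpp ?w (N - j) j) (lpp ?w (N + 1 - j) (j - 1)) + ?w (N + 1 - j) j \<le> 2 * u + (if half then 1 else 0)
        \<longleftrightarrow> lpp w (N + 1 - j) j \<le> u \<and> (j \<in> J \<longrightarrow> half \<or> lpp w (N + 1 - j) j < u)" if j: "j \<in> {1..N}" for j
    proof -
      define M where "M = max (lpp w (N - j) j) (lpp w (N + 1 - j) (j - 1))"
      have "lpp ?w (N - j) j = lpp w (N - j) j" "lpp ?w (N + 1 - j) (j - 1) = lpp w (N + 1 - j) (j - 1)"
        by (rule same; use j in simp)+
      then have M: "max (lpp ?w (N - j) j) (lpp ?w (N + 1 - j) (j - 1)) = M" by (simp add: M_def)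
      have e: "?w (N + 1 - j) j = 2 * w (N + 1 - j) j + of_bool (j \<in> J)"
        using j by (simp add: double_antidiagonal_def)
      have c: "lpp w (N + 1 - j) j = M + w (N + 1 - j) j"
        unfolding M_def by (rule corner) (use j in auto)
      have "of_bool (j \<in> J) \<le> (1 :: nat)" by simp
      from antidiagonal_le_iff[OF this] show ?thesis unfolding M e c by simp
    qed
    ultimately have "?w \<in> antidiagonal_arrays (2 * u + (if half then 1 else 0)) N \<longleftrightarrow>
        (\<forall>j\<in>{1..N}. lpp w (N + 1 - j) j \<le> u \<and> (j \<in> J \<longrightarrow> half \<or> lpp w (N + 1 - j) j < u))"
      unfolding antidiagonal_arrays_def by simp
    then show ?thesis using w J unfolding bounded_arrays_def mem_Sigma_iff mem_Collect_eq Pow_iff by blast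
  qed
  show ?thesis
  proof (rule bij_betwI[where g = "\<lambda>w. (half_antidiagonal N w, {j \<in> {1..N}. odd (w (N + 1 - j) j)})"])
    show "(\<lambda>(w, J). double_antidiagonal N w J) \<in> (SIGMA w:bounded_arrays u N. Pow {j \<in> {1..N}. half \<or> lpp w (N + 1 - j) j < u}) \<rightarrow>
      antidiagonal_arrays (2 * u + (if half then 1 else 0)) N"
    proof
      fix t assume t: "t \<in> (SIGMA w:bounded_arrays u N. Pow {j \<in> {1..N}. half \<or> lpp w (N + 1 - j) j < u})"
      obtain w J where wJ: "t = (w, J)" by fastforce
      have "w \<in> staircase_arrays N" "J \<subseteq> {1..N}" using t by (auto simp: wJ bounded_arrays_def)
      then show "(case t of (w, J) \<Rightarrow> double_antidiagonal N w J) \<in> antidiagonal_arrays (2 * u + (if half then 1 else 0)) N"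
        using mem t unfolding wJ prod.case by blast
    qed
    have recover: "double_antidiagonal N (half_antidiagonal N w) {j \<in> {1..N}. odd (w (N + 1 - j) j)} = w"
      if "w \<in> staircase_arrays N" for w
    proof (intro ext)
      fix i j
      show "double_antidiagonal N (half_antidiagonal N w) {j \<in> {1..N}. odd (w (N + 1 - j) j)} i j = w i j"
      proof (cases "i + j = N + 1 \<and> j \<in> {1..N}")
        case True
        then have "N + 1 - j = i" by auto
        then show ?thesis using True by (auto simp: double_antidiagonal_def half_antidiagonal_def)
      next
        case False
        then have "i + j = N + 1 \<Longrightarrow> w i j = 0" using that by (auto simp: staircase_arrays_iff staircase_def)
        then show ?thesis using False by (auto simp: double_antidiagonal_def half_antidiagonal_def)
      qed
    qed
    have hst: "half_antidiagonal N w \<in> staircase_arrays N" if "w \<in> staircase_arrays N" for w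
      using that by (auto simp: staircase_arrays_iff half_antidiagonal_def)
    show "(\<lambda>w. (half_antidiagonal N w, {j \<in> {1..N}. odd (w (N + 1 - j) j)})) \<in> antidiagonal_arrays (2 * u + (if half then 1 else 0)) N \<rightarrow>
      (SIGMA w:bounded_arrays u N. Pow {j \<in> {1..N}. half \<or> lpp w (N + 1 - j) j < u})"
    proof
      fix w assume w: "w \<in> antidiagonal_arrays (2 * u + (if half then 1 else 0)) N"
      then have st: "w \<in> staircase_arrays N" by (simp add: antidiagonal_arrays_def)
      show "(half_antidiagonal N w, {j \<in> {1..N}. odd (w (N + 1 - j) j)}) \<in>
          (SIGMA w:bounded_arrays u N. Pow {j \<in> {1..N}. half \<or> lpp w (N + 1 - j) j < u})"
      proof (rule mem[THEN iffD1])
        show "double_antidiagonal N (half_antidiagonal N w) {j \<in> {1..N}. odd (w (N + 1 - j) j)} \<in>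
            antidiagonal_arrays (2 * u + (if half then 1 else 0)) N"
          unfolding recover[OF st] by (rule w)
      qed (use hst[OF st] in auto)
    qed
    show "(case (half_antidiagonal N w, {j \<in> {1..N}. odd (w (N + 1 - j) j)}) of (w, J) \<Rightarrow> double_antidiagonal N w J) = w"
      if "w \<in> antidiagonal_arrays (2 * u + (if half then 1 else 0)) N" for w
      using that recover[of w] by (simp add: antidiagonal_arrays_def)
    show "(half_antidiagonal N (case t of (w, J) \<Rightarrow> double_antidiagonal N w J), {j \<in> {1..N}. odd ((case t of (w, J) \<Rightarrow> double_antidiagonal N w J) (N + 1 - j) j)}) = t"
      if "t \<in> (SIGMA w:bounded_arrays u N. Pow {j \<in> {1..N}. half \<or> lpp w (N + 1 - j) j < u})" for t
    proof -
      obtain w J where wJ: "t = (w, J)" by fastforce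
      have J: "J \<subseteq> {1..N}" using that by (auto simp: wJ)
      have "half_antidiagonal N (double_antidiagonal N w J) = w"
        by (intro ext) (simp add: half_antidiagonal_def double_antidiagonal_def)
      moreover have "odd (double_antidiagonal N w J (N + 1 - j) j) \<longleftrightarrow> j \<in> J" if "j \<in> {1..N}" for j
        using that by (simp add: double_antidiagonal_def)
      then have "{j \<in> {1..N}. odd (double_antidiagonal N w J (N + 1 - j) j)} = J"
        using J by blast
      ultimately show ?thesis by (simp add: wJ)
    qed
  qed
qed

definition array_weight :: "nat \<Rightarrow> (nat \<Rightarrow> real) \<Rightarrow> real \<Rightarrow> (nat \<Rightarrow> nat \<Rightarrow> nat) \<Rightarrow> real" where
  "array_weight N p \<beta> w = (\<Prod>(i, j)\<in>staircase N. if i + j = N + 1 then \<beta> ^ (w i j mod 2) * p j ^ w i j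
     else (p (N - i + 1) * p j) ^ w i j)"

lemma prod_staircase_antidiagonal:
  "(\<Prod>(i, j)\<in>staircase N. if i + j = N + 1 then f j else 1) = (\<Prod>j=1..N. f j)"
proof -
  have "(\<Prod>(i, j)\<in>staircase N. if i + j = N + 1 then f j else 1) = (\<Prod>j=1..N. \<Prod>i=1..N + 1 - j. if i + j = N + 1 then f j else 1)"
    by (rule prod_staircase_columns)
  also have "\<dots> = (\<Prod>j=1..N. f j)"
  proof (rule prod.cong[OF refl])
    fix j assume j: "j \<in> {1..N}"
    have "(\<Prod>i=1..N + 1 - j. if i + j = N + 1 then f j else 1) = (\<Prod>i=1..N + 1 - j. if i = N + 1 - j then f j else 1)"
      by (intro prod.cong refl) (use j in auto)
    also have "\<dots> = f j" using j by (subst prod.delta) auto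
    finally show "(\<Prod>i=1..N + 1 - j. if i + j = N + 1 then f j else 1) = f j" .
  qed
  finally show ?thesis .
qed

lemma array_weight_double_antidiagonal:
  assumes "J \<subseteq> {1..N}"
  shows "array_weight N p \<beta> (double_antidiagonal N w J) =
    (\<Prod>j\<in>J. \<beta> * p j) * (\<Prod>(i, j)\<in>staircase N. (p (N - i + 1) * p j) ^ w i j)"
proof -
  have "array_weight N p \<beta> (double_antidiagonal N w J) = (\<Prod>(i, j)\<in>staircase N.
      (if i + j = N + 1 then if j \<in> J then \<beta> * p j else 1 else 1) * (p (N - i + 1) * p j) ^ w i j)"
    unfolding array_weight_def
  proof (rule prod.cong[OF refl], clarify)
    fix i j assume ij: "(i, j) \<in> staircase N"
    show "(if i + j = N + 1 then \<beta> ^ (double_antidiagonal N w J i j mod 2) * p j ^ double_antidiagonal N w J i j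
       else (p (N - i + 1) * p j) ^ double_antidiagonal N w J i j) =
      (if i + j = N + 1 then if j \<in> J then \<beta> * p j else 1 else 1) * (p (N - i + 1) * p j) ^ w i j"
    proof (cases "i + j = N + 1")
      case True
      then have "N - i + 1 = j" using ij by (auto simp: staircase_def)
      then show ?thesis using True
        by (cases "j \<in> J") (simp_all add: double_antidiagonal_def power_add power_mult power2_eq_square)
    qed (simp add: double_antidiagonal_def)
  qed
  also have "\<dots> = (\<Prod>(i, j)\<in>staircase N. if i + j = N + 1 then if j \<in> J then \<beta> * p j else 1 else 1) *
      (\<Prod>(i, j)\<in>staircase N. (p (N - i + 1) * p j) ^ w i j)"
    by (simp add: case_prod_unfold prod.distrib)
  also have "(\<Prod>(i, j)\<in>staircase N. if i + j = N + 1 then if j \<in> J then \<beta> * p j else 1 else 1) = (\<Prod>j\<in>J. \<beta> * p j)"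
    unfolding prod_staircase_antidiagonal using assms by (simp add: prod.inter_restrict[symmetric] Int_absorb1)
  finally show ?thesis .
qed

theorem antidiagonal_arrays_sum:
  fixes p :: "nat \<Rightarrow> real"
  assumes p: "\<And>j. 1 \<le> j \<Longrightarrow> j \<le> N \<Longrightarrow> p j \<noteq> 0"
  shows "finite (antidiagonal_arrays (2 * u + (if half then 1 else 0)) N)"
    and "(\<Sum>w\<in>antidiagonal_arrays (2 * u + (if half then 1 else 0)) N. array_weight N p \<beta> w) =
      (if half then \<Prod>j=1..N. 1 + \<beta> * p j else 1) * ((\<Prod>j=1..N. p j ^ u) *
        cb (if half then 0 else \<beta>) (\<lambda>j. p (Suc j)) N (replicate N u))"
proof -
  define S where "S w = {j \<in> {1..N}. half \<or> lpp w (N + 1 - j) j < u}" for w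
  define Q where "Q w = (\<Prod>(i, j)\<in>staircase N. (p (N - i + 1) * p j) ^ w i j)" for w
  note bij = bij_betw_double_antidiagonal[of N u half, folded S_def]
  have fin: "finite (bounded_arrays u N)" using p by (rule bounded_arrays_sum(1))
  have finS: "finite (S w)" for w by (simp add: S_def)
  have "finite (SIGMA w:bounded_arrays u N. Pow (S w))" using fin finS by (intro finite_SigmaI) auto
  then show "finite (antidiagonal_arrays (2 * u + (if half then 1 else 0)) N)"
    using bij_betw_finite[OF bij] by simp
  have "(\<Sum>w\<in>antidiagonal_arrays (2 * u + (if half then 1 else 0)) N. array_weight N p \<beta> w) =
      (\<Sum>(w, J)\<in>(SIGMA w:bounded_arrays u N. Pow (S w)). array_weight N p \<beta> (double_antidiagonal N w J))"
    unfolding sum.reindex_bij_betw[OF bij, symmetric] by (simp add: case_prod_unfold)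
  also have "\<dots> = (\<Sum>w\<in>bounded_arrays u N. \<Sum>J\<in>Pow (S w). array_weight N p \<beta> (double_antidiagonal N w J))"
    using fin finS by (subst sum.Sigma) auto
  also have "\<dots> = (\<Sum>w\<in>bounded_arrays u N. (if half then \<Prod>j=1..N. 1 + \<beta> * p j else 1) *
      ((\<Prod>j=1..N. if lpp w (N + 1 - j) j < u then 1 + (if half then 0 else \<beta>) * p j else 1) * Q w))"
  proof (rule sum.cong[OF refl])
    fix w
    have "(\<Sum>J\<in>Pow (S w). array_weight N p \<beta> (double_antidiagonal N w J)) = (\<Sum>J\<in>Pow (S w). (\<Prod>j\<in>J. \<beta> * p j) * (\<Prod>j\<in>S w - J. 1)) * Q w"
      unfolding sum_distrib_right
    proof (rule sum.cong[OF refl])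
      fix J assume "J \<in> Pow (S w)"
      then have "J \<subseteq> {1..N}" by (auto simp: S_def)
      then show "array_weight N p \<beta> (double_antidiagonal N w J) = (\<Prod>j\<in>J. \<beta> * p j) * (\<Prod>j\<in>S w - J. 1) * Q w"
        unfolding Q_def by (simp add: array_weight_double_antidiagonal)
    qed
    also have "\<dots> = (\<Prod>j\<in>S w. \<beta> * p j + 1) * Q w"
      unfolding prod_add[OF finS] ..
    also have "(\<Prod>j\<in>S w. \<beta> * p j + 1) = (\<Prod>j=1..N. if half \<or> lpp w (N + 1 - j) j < u then 1 + \<beta> * p j else 1)"
      unfolding S_def prod.inter_filter[OF finite_atLeastAtMost] by (intro prod.cong refl) simp
    \<comment> \<open>For a half-integer shape the set \<open>S w\<close> is all of {1..N}, so its
      product does not depend on \<open>w\<close> and leaves the sum. This is the global factor with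
      parameter 0.\<close>
    also have "\<dots> = (if half then \<Prod>j=1..N. 1 + \<beta> * p j else 1) *
        (\<Prod>j=1..N. if lpp w (N + 1 - j) j < u then 1 + (if half then 0 else \<beta>) * p j else 1)"
      by (cases half) (simp_all cong: if_cong)
    finally show "(\<Sum>J\<in>Pow (S w). array_weight N p \<beta> (double_antidiagonal N w J)) =
        (if half then \<Prod>j=1..N. 1 + \<beta> * p j else 1) *
        ((\<Prod>j=1..N. if lpp w (N + 1 - j) j < u then 1 + (if half then 0 else \<beta>) * p j else 1) * Q w)"
      by (simp only: mult.assoc)
  qed
  also have "\<dots> = (if half then \<Prod>j=1..N. 1 + \<beta> * p j else 1) * ((\<Prod>j=1..N. p j ^ u) *
        cb (if half then 0 else \<beta>) (\<lambda>j. p (Suc j)) N (replicate N u))"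
    unfolding sum_distrib_left[symmetric] Q_def using p by (subst bounded_arrays_sum(2)) simp_all
  finally show "(\<Sum>w\<in>antidiagonal_arrays (2 * u + (if half then 1 else 0)) N. array_weight N p \<beta> w) =
      (if half then \<Prod>j=1..N. 1 + \<beta> * p j else 1) * ((\<Prod>j=1..N. p j ^ u) *
        cb (if half then 0 else \<beta>) (\<lambda>j. p (Suc j)) N (replicate N u))" .
qed

section \<open>Probabilities and the main theorem\<close>

text \<open>By symmetry the weights outside the staircase are determined by those in it, so the
  event is a finite disjoint union of events that fix all staircase weights, and independence
  applies to each of them.\<close>

lemma prob_last_passage_le:
  assumes W: "antidiag_sym_weights M N p \<beta> W" and N: "1 \<le> N" and fin: "finite (antidiagonal_arrays m N)"
  shows "measure M {\<omega> \<in> space M. last_passage N (\<lambda>i j. W i j \<omega>) \<le> m} =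
    (\<Sum>w\<in>antidiagonal_arrays m N. \<Prod>(i, j)\<in>staircase N. measure M {\<omega> \<in> space M. W i j \<omega> = w i j})"
proof -
  interpret prob_space M using W by (simp add: antidiag_sym_weights_def)
  have sym: "W i j \<omega> = W (N - j + 1) (N - i + 1) \<omega>" if "i \<in> {1..N}" "j \<in> {1..N}" "\<omega> \<in> space M" for i j \<omega>
    using W that unfolding antidiag_sym_weights_def by blast
  have indep: "indep_vars (\<lambda>_. count_space UNIV) (\<lambda>(i, j). W i j) (staircase N)"
    using W unfolding antidiag_sym_weights_def staircase_def by blast
  have meas: "{\<omega> \<in> space M. W i j \<omega> = k} \<in> sets M" if "(i, j) \<in> staircase N" for i j k
  proof -
    have "W i j \<in> measurable M (count_space UNIV)"
      using indep that unfolding indep_vars_def by fastforce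
    then have "W i j -` {k} \<inter> space M \<in> sets M" by (rule measurable_sets) simp
    moreover have "W i j -` {k} \<inter> space M = {\<omega> \<in> space M. W i j \<omega> = k}" by auto
    ultimately show ?thesis by simp
  qed
  have "(1, 1) \<in> staircase N" using N by (simp add: staircase_def)
  then have ne: "staircase N \<noteq> {}" by blast
  define E where "E w = (\<Inter>(i, j)\<in>staircase N. {\<omega> \<in> space M. W i j \<omega> = w i j})" for w
  have E: "\<omega> \<in> E w \<longleftrightarrow> \<omega> \<in> space M \<and> (\<forall>i j. (i, j) \<in> staircase N \<longrightarrow> W i j \<omega> = w i j)" for \<omega> w
    using ne by (auto simp: E_def)
  have E_sets: "E w \<in> sets M" for w
    unfolding E_def using ne meas by (intro sets.finite_INT) auto
  have "prob (E w) = (\<Prod>(i, j)\<in>staircase N. prob {\<omega> \<in> space M. W i j \<omega> = w i j})" for w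
  proof -
    have "(case t of (i, j) \<Rightarrow> W i j) -` {case t of (i, j) \<Rightarrow> w i j} \<inter> space M =
        (case t of (i, j) \<Rightarrow> {\<omega> \<in> space M. W i j \<omega> = w i j})" for t
      by (cases t) auto
    then show ?thesis
      using indep_varsD_finite[OF indep ne finite_staircase, of "\<lambda>t. {case t of (i, j) \<Rightarrow> w i j}"]
      by (simp add: E_def case_prod_unfold)
  qed
  moreover have "{\<omega> \<in> space M. last_passage N (\<lambda>i j. W i j \<omega>) \<le> m} = (\<Union>w\<in>antidiagonal_arrays m N. E w)"
  proof -
    have "last_passage N (\<lambda>i j. W i j \<omega>) \<le> m \<longleftrightarrow> (\<exists>w\<in>antidiagonal_arrays m N. \<omega> \<in> E w)" if \<omega>: "\<omega> \<in> space M" for \<omega>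
    proof -
      let ?W = "\<lambda>i j. W i j \<omega>"
      have iff: "last_passage N ?W \<le> m \<longleftrightarrow> w \<in> antidiagonal_arrays m N"
        if w: "w \<in> staircase_arrays N" "\<omega> \<in> E w" for w
      proof -
        have eq: "W i j \<omega> = w i j" if "1 \<le> i" "1 \<le> j" "i + j \<le> N + 1" for i j
        proof -
          have "(i, j) \<in> staircase N" using that by (auto simp: staircase_def)
          then show ?thesis using w(2) by (simp add: E)
        qed
        have lpp: "lpp ?W i j = lpp w i j" if "i + j \<le> N + 1" for i j
        proof (rule lpp_cong)
          fix a b assume ab: "1 \<le> a" "a \<le> i" "1 \<le> b" "b \<le> j"
          show "W a b \<omega> = w a b"
            by (rule eq[OF ab(1,3)]) (use ab that in linarith)
        qed
        have "last_passage N ?W \<le> m \<longleftrightarrow> lpp ?W N N \<le> m" by (simp add: last_passage_eq_lpp[OF N])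
        also have "\<dots> \<longleftrightarrow> (\<forall>j\<in>{1..N}. 2 * max (lpp ?W (N - j) j) (lpp ?W (N + 1 - j) (j - 1)) + W (N + 1 - j) j \<omega> \<le> m)"
        proof (rule lpp_symmetric_le_iff[OF N])
          fix i j assume "1 \<le> i" "i \<le> N" "1 \<le> j" "j \<le> N"
          then show "W i j \<omega> = W (N - j + 1) (N - i + 1) \<omega>" by (intro sym \<omega>) auto
        qed
        also have "\<dots> \<longleftrightarrow> (\<forall>j\<in>{1..N}. 2 * max (lpp w (N - j) j) (lpp w (N + 1 - j) (j - 1)) + w (N + 1 - j) j \<le> m)"
        proof (rule ball_cong[OF refl])
          fix j assume j: "j \<in> {1..N}"
          have "lpp ?W (N - j) j = lpp w (N - j) j" by (rule lpp) (use j in auto)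
          moreover have "lpp ?W (N + 1 - j) (j - 1) = lpp w (N + 1 - j) (j - 1)" by (rule lpp) (use j in auto)
          moreover have "W (N + 1 - j) j \<omega> = w (N + 1 - j) j" by (rule eq) (use j in auto)
          ultimately show "2 * max (lpp ?W (N - j) j) (lpp ?W (N + 1 - j) (j - 1)) + W (N + 1 - j) j \<omega> \<le> m \<longleftrightarrow>
            2 * max (lpp w (N - j) j) (lpp w (N + 1 - j) (j - 1)) + w (N + 1 - j) j \<le> m" by (simp only:)
        qed
        finally show ?thesis using w(1) by (simp add: antidiagonal_arrays_def)
      qed
      \<comment> \<open>The realized weights, set to zero outside the staircase, are the array
        witnessing membership in the union.\<close>
      define R where "R i j = (if (i, j) \<in> staircase N then W i j \<omega> else 0)" for i j
      have "R \<in> staircase_arrays N" "\<omega> \<in> E R" using \<omega> by (auto simp: R_def staircase_arrays_iff E)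
      moreover have "w \<in> staircase_arrays N" if "w \<in> antidiagonal_arrays m N" for w
        using that by (simp add: antidiagonal_arrays_def)
      ultimately show ?thesis using iff by blast
    qed
    moreover have "E w \<subseteq> space M" for w by (auto simp: E)
    ultimately show ?thesis by blast
  qed
  moreover have "disjoint_family_on E (antidiagonal_arrays m N)"
    unfolding disjoint_family_on_def
  proof (intro ballI impI)
    fix w w' assume w: "w \<in> antidiagonal_arrays m N" "w' \<in> antidiagonal_arrays m N" "w \<noteq> w'"
    then obtain i j where ij: "w i j \<noteq> w' i j" by (auto simp: fun_eq_iff)
    have "w \<in> staircase_arrays N" "w' \<in> staircase_arrays N"
      using w(1,2) by (simp_all add: antidiagonal_arrays_def)
    then have "(i, j) \<in> staircase N"
      using ij by (cases "(i, j) \<in> staircase N") (simp_all add: staircase_arrays_iff)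
    then have "w i j = w' i j" if "\<omega> \<in> E w" "\<omega> \<in> E w'" for \<omega>
      using that by (simp add: E)
    then show "E w \<inter> E w' = {}" using ij by blast
  qed
  ultimately show ?thesis
    using finite_measure_finite_Union[OF fin, of E] E_sets by auto
qed

lemma prob_weights:
  assumes W: "antidiag_sym_weights M N p \<beta> W"
  shows "(\<Prod>(i, j)\<in>staircase N. measure M {\<omega> \<in> space M. W i j \<omega> = w i j}) =
    (\<Prod>(i, j)\<in>staircase N. if i + j = N + 1 then (1 - (p j)\<^sup>2) / (1 + \<beta> * p j) else 1 - p (N - i + 1) * p j) *
    array_weight N p \<beta> w"
  unfolding array_weight_def prod.distrib[symmetric]
proof (rule prod.cong[OF refl], clarify)
  fix i j assume ij: "(i, j) \<in> staircase N"
  have r: "i + j < N + 1 \<Longrightarrow> measure M {\<omega> \<in> space M. W i j \<omega> = k} = (1 - p (N - i + 1) * p j) * (p (N - i + 1) * p j) ^ k"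
    "i + j = N + 1 \<Longrightarrow> measure M {\<omega> \<in> space M. W i j \<omega> = k} = (1 - (p j)\<^sup>2) / (1 + \<beta> * p j) * \<beta> ^ (k mod 2) * p j ^ k" for k
    using W ij unfolding antidiag_sym_weights_def staircase_def by blast+
  show "measure M {\<omega> \<in> space M. W i j \<omega> = w i j} =
    (if i + j = N + 1 then (1 - (p j)\<^sup>2) / (1 + \<beta> * p j) else 1 - p (N - i + 1) * p j) *
    (if i + j = N + 1 then \<beta> ^ (w i j mod 2) * p j ^ w i j else (p (N - i + 1) * p j) ^ w i j)"
  proof (cases "i + j = N + 1")
    case False
    then have "i + j < N + 1" using ij by (auto simp: staircase_def)
    from r(1)[OF this] show ?thesis using False by simp
  qed (simp add: r(2))
qed

lemma normalization_constant:
  assumes p: "\<And>i. i \<in> {1..N} \<Longrightarrow> 0 < p i \<and> p i < 1" and \<beta>: "0 \<le> \<beta>"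
  shows "(\<Prod>(i, j)\<in>{(i, j). 1 \<le> i \<and> i < j \<and> j \<le> N}. 1 / (1 - p i * p j)) * (\<Prod>j=1..N. (1 + \<beta> * p j) / (1 - (p j)\<^sup>2)) *
    (\<Prod>(i, j)\<in>staircase N. if i + j = N + 1 then (1 - (p j)\<^sup>2) / (1 + \<beta> * p j) else 1 - p (N - i + 1) * p j) = (1 :: real)"
proof -
  let ?P = "{(i, j). 1 \<le> i \<and> i < j \<and> j \<le> N}"
  have less: "p i * p j < 1" if "i \<in> {1..N}" "j \<in> {1..N}" for i j
    using p[OF that(1)] p[OF that(2)] mult_strict_mono[of "p i" 1 "p j" 1] by simp
  have "(\<Prod>(i, j)\<in>staircase N. if i + j = N + 1 then (1 - (p j)\<^sup>2) / (1 + \<beta> * p j) else 1 - p (N - i + 1) * p j) =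
      (\<Prod>(i, j)\<in>staircase N. if i + j = N + 1 then (1 - (p j)\<^sup>2) / (1 + \<beta> * p j) else 1) *
      (\<Prod>(i, j)\<in>staircase N. if i + j \<noteq> N + 1 then 1 - p (N - i + 1) * p j else 1)"
    unfolding prod.distrib[symmetric] by (intro prod.cong refl) auto
  also have "(\<Prod>(i, j)\<in>staircase N. if i + j = N + 1 then (1 - (p j)\<^sup>2) / (1 + \<beta> * p j) else 1) =
      (\<Prod>j=1..N. (1 - (p j)\<^sup>2) / (1 + \<beta> * p j))"
    by (rule prod_staircase_antidiagonal)
  also have "(\<Prod>(i, j)\<in>staircase N. if i + j \<noteq> N + 1 then 1 - p (N - i + 1) * p j else 1) =
      (\<Prod>(i, j)\<in>{(i, j) \<in> staircase N. i + j \<noteq> N + 1}. 1 - p (N - i + 1) * p j)"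
    by (rule prod.mono_neutral_cong_right) auto
  \<comment> \<open>The cell (i, j) strictly before the antidiagonal corresponds to the pair j < N -
    i + 1 of parameter indices.\<close>
  also have "\<dots> = (\<Prod>(i, j)\<in>?P. 1 - p i * p j)"
    by (rule prod.reindex_bij_witness[of _ "\<lambda>(i, j). (N + 1 - j, i)" "\<lambda>(i, j). (j, N - i + 1)"])
      (auto simp: staircase_def mult.commute)
  finally have "(\<Prod>(i, j)\<in>?P. 1 / (1 - p i * p j)) * (\<Prod>j=1..N. (1 + \<beta> * p j) / (1 - (p j)\<^sup>2)) *
      (\<Prod>(i, j)\<in>staircase N. if i + j = N + 1 then (1 - (p j)\<^sup>2) / (1 + \<beta> * p j) else 1 - p (N - i + 1) * p j) =
      (\<Prod>(i, j)\<in>?P. 1 / (1 - p i * p j) * (1 - p i * p j)) *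
      (\<Prod>j=1..N. (1 + \<beta> * p j) / (1 - (p j)\<^sup>2) * ((1 - (p j)\<^sup>2) / (1 + \<beta> * p j)))"
    by (simp only: prod.distrib case_prod_unfold mult_ac)
  also have "(\<Prod>(i, j)\<in>?P. 1 / (1 - p i * p j) * (1 - p i * p j)) = 1"
  proof (rule prod.neutral, clarify)
    fix i j assume ij: "1 \<le> i" "i < j" "j \<le> N"
    have "p i * p j < 1" by (rule less) (use ij in auto)
    then show "1 / (1 - p i * p j) * (1 - p i * p j) = 1" by simp
  qed
  also have "(\<Prod>j=1..N. (1 + \<beta> * p j) / (1 - (p j)\<^sup>2) * ((1 - (p j)\<^sup>2) / (1 + \<beta> * p j))) = 1"
  proof (rule prod.neutral, rule ballI)
    fix j assume j: "j \<in> {1..N}"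
    have "0 < 1 + \<beta> * p j" using p[OF j] \<beta> by (simp add: add_pos_nonneg)
    moreover have "1 - (p j)\<^sup>2 \<noteq> 0" using less[OF j j] by (simp add: power2_eq_square)
    ultimately show "(1 + \<beta> * p j) / (1 - (p j)\<^sup>2) * ((1 - (p j)\<^sup>2) / (1 + \<beta> * p j)) = 1" by simp
  qed
  finally show ?thesis by simp
qed

section \<open>Half-integer boxes as shifted integer boxes\<close>

lemma sorted_wrt_shifted: "sorted_wrt (\<ge>) (shifted half l) \<longleftrightarrow> sorted_wrt (\<ge>) l"
  by (simp add: shifted_def sorted_wrt_map)

lemma shifted_in_box_partitions_iff:
  "shifted half l \<in> box_partitions (real u + half_shift half) n \<longleftrightarrow> l \<in> partitions_below u n"
proof -
  have "\<forall>a\<in>set (shifted half l). 0 \<le> a" by (auto simp: shifted_def half_shift_def)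
  moreover have "\<forall>a\<in>set (shifted half l). a \<in> \<int> \<longleftrightarrow> \<not> half" by (auto simp: shifted_def Ints_shift_iff)
  moreover have "\<forall>a\<in>set (shifted half l). is_half_integer a \<longleftrightarrow> half"
    by (auto simp: shifted_def half_integer_shift_iff)
  moreover have "(shifted half l \<noteq> [] \<longrightarrow> hd (shifted half l) \<le> real u + half_shift half) \<longleftrightarrow> (l \<noteq> [] \<longrightarrow> hd l \<le> u)"
    by (cases l) (auto simp: shifted_def)
  ultimately show ?thesis
    unfolding box_partitions_def is_partition_def is_half_partition_def partitions_below_iff
    by (cases half) (auto simp: Ints_shift_iff half_integer_shift_iff sorted_wrt_shifted)
qed

lemma box_partitions_eq: "box_partitions (real u + half_shift half) n = shifted half ` partitions_below u n"
proof (intro equalityI subsetI)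
  fix lam assume lam: "lam \<in> box_partitions (real u + half_shift half) n"
  have "lam = shifted half (map (\<lambda>a. nat \<lfloor>a\<rfloor>) lam)"
    unfolding shifted_def map_map
  proof (rule map_idI[symmetric])
    fix a assume a: "a \<in> set lam"
    have "0 \<le> a" "a - half_shift half \<in> \<int>"
      using lam a unfolding box_partitions_def is_partition_def is_half_partition_def mem_Collect_eq
        Ints_shift_iff half_integer_shift_iff by (auto simp: half_shift_def is_half_integer_def)
    moreover from this(2) obtain z where "a - half_shift half = of_int z" by (elim Ints_cases)
    ultimately have z: "a = of_int z + half_shift half" "0 \<le> of_int z + half_shift half" by auto
    have "0 \<le> z" "\<lfloor>a\<rfloor> = z" using z(2) by (auto simp: z(1) half_shift_def floor_eq_iff split: if_splits)
    then show "((\<lambda>k. real k + half_shift half) \<circ> (\<lambda>a. nat \<lfloor>a\<rfloor>)) a = a" by (simp add: z(1))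
  qed
  then show "lam \<in> shifted half ` partitions_below u n"
    using lam shifted_in_box_partitions_iff by (metis imageI)
qed (auto simp: shifted_in_box_partitions_iff)

lemma half_integer_cases:
  assumes "0 \<le> u" "2 * u \<in> \<int>"
  obtains half k where "u = real k + half_shift half"
proof -
  obtain z where z: "2 * u = of_int z" using assms(2) by (elim Ints_cases)
  then have "0 \<le> z" using assms(1) by linarith
  then have z: "2 * u = real (nat z)" using z by simp
  show thesis
  proof (cases "even (nat z)")
    case True
    then obtain k where "nat z = 2 * k" by (elim evenE)
    with z have "u = real k + half_shift False" by (simp add: half_shift_def)
    then show thesis by (rule that)
  next
    case False
    then obtain k where "nat z = 2 * k + 1" by (elim oddE)
    with z have "u = real k + half_shift True" by (simp add: half_shift_def)
    then show thesis by (rule that)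
  qed
qed

theorem theorem4p1:
  fixes M :: "'a measure" and W :: "nat \<Rightarrow> nat \<Rightarrow> 'a \<Rightarrow> nat"
    and N :: nat and p :: "nat \<Rightarrow> real" and \<beta> u c :: real
    and A B C :: real and D :: "nat \<Rightarrow> real"
  assumes "N \<ge> 1"
    and "\<And>i. i \<in> {1..N} \<Longrightarrow> 0 < p i \<and> p i < 1"
    and "\<beta> \<ge> 0"
    and "antidiag_sym_weights M N p \<beta> W"
    and "u \<ge> 0" and "2 * u \<in> \<int>"
  defines "c \<equiv> (\<Prod>(i, j)\<in>{(i, j). 1 \<le> i \<and> i < j \<and> j \<le> N}. 1 / (1 - p i * p j)) *
                 (\<Prod>j=1..N. (1 + \<beta> * p j) / (1 - (p j)\<^sup>2))"
    and "A \<equiv> c * measure M {\<omega> \<in> space M. real (last_passage N (\<lambda>i j. W i j \<omega>)) \<le> 2 * u}"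
    and "B \<equiv> (\<Sum>\<mu> | map real \<mu> \<in> box_partitions (2 * u) N. \<beta> ^ oddrows \<mu> * schur N \<mu> p)"
    and "C \<equiv> (\<Prod>i=1..N. p i) powr u * schur_CB N (replicate N u) p \<beta>"
    and "D \<equiv> (\<lambda>n. (\<Prod>i=1..N. p i) powr u *
                 (\<Sum>lam\<in>box_partitions u (N - n).
                    schur_CB n (replicate (2 * n - N) u @ lam) p \<beta> *
                    schur_CB (N - n) lam (\<lambda>i. p (n + i)) \<beta>))"
  shows "A = B \<and> B = C \<and> (\<forall>n. \<lceil>real N / 2\<rceil> \<le> int n \<and> n \<le> N \<longrightarrow> C = D n)"
proof -
  note p = assms(2)
  obtain half U where u: "u = real U + half_shift half" using half_integer_cases[OF assms(5,6)] .
  let ?m = "2 * U + (if half then 1 else 0)"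
  let ?b = "if half then 0 else \<beta>"
  let ?x = "\<lambda>j. p (Suc j)"
  have u2: "2 * u = real ?m" by (simp add: u half_shift_def)
  \<comment> \<open>The common value of all four quantities, expressed by the recursion for integer
    tuples.\<close>
  define V where "V = (if half then \<Prod>i=1..N. 1 + \<beta> * p i else 1) * ((\<Prod>i=1..N. p i ^ U) * cb ?b ?x N (replicate N U))"
  have p0: "p j \<noteq> 0" if "1 \<le> j" "j \<le> N" for j using p[of j] that by auto

  have A: "A = V"
  proof -
    let ?K = "\<Prod>(i, j)\<in>staircase N. if i + j = N + 1 then (1 - (p j)\<^sup>2) / (1 + \<beta> * p j) else 1 - p (N - i + 1) * p j"
    have fin: "finite (antidiagonal_arrays ?m N)" using p0 by (rule antidiagonal_arrays_sum(1))
    have sum: "(\<Sum>w\<in>antidiagonal_arrays ?m N. array_weight N p \<beta> w) = V"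
      unfolding V_def using p0 by (rule antidiagonal_arrays_sum(2))
    have "measure M {\<omega> \<in> space M. real (last_passage N (\<lambda>i j. W i j \<omega>)) \<le> 2 * u} =
        measure M {\<omega> \<in> space M. last_passage N (\<lambda>i j. W i j \<omega>) \<le> ?m}"
      unfolding u2 of_nat_le_iff ..
    also have "\<dots> = (\<Sum>w\<in>antidiagonal_arrays ?m N. ?K * array_weight N p \<beta> w)"
      unfolding prob_last_passage_le[OF assms(4,1) fin] prob_weights[OF assms(4)] ..
    also have "\<dots> = ?K * V" unfolding sum_distrib_left[symmetric] sum ..
    finally have "A = c * ?K * V" unfolding A_def by simp
    moreover have "c * ?K = 1" unfolding c_def using p assms(3) by (rule normalization_constant)
    ultimately show ?thesis by simp
  qed

  have B: "B = V"
  proof -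
    have "map real \<mu> \<in> box_partitions (2 * u) N \<longleftrightarrow> \<mu> \<in> partitions_below ?m N" for \<mu>
      using shifted_in_box_partitions_iff[of False \<mu> ?m N] by (simp add: u2 shifted_def half_shift_def)
    then have "B = (\<Sum>\<mu>\<in>partitions_below ?m N. \<beta> ^ oddrows \<mu> * schur N \<mu> p)" unfolding B_def by simp
    also have "\<dots> = (if half then \<Prod>j<N. 1 + \<beta> * ?x j else 1) * (\<Prod>j<N. ?x j ^ U) * cb ?b ?x N (replicate N U)"
      by (rule bounded_littlewood_cb) (use p in auto)
    also have "(\<Prod>j<N. ?x j ^ U) = (\<Prod>i=1..N. p i ^ U)"
      by (rule prod.reindex_bij_witness[of _ "\<lambda>j. j - 1" Suc]) auto
    also have "(\<Prod>j<N. 1 + \<beta> * ?x j) = (\<Prod>i=1..N. 1 + \<beta> * p i)"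
      by (rule prod.reindex_bij_witness[of _ "\<lambda>j. j - 1" Suc]) auto
    finally show ?thesis by (simp add: V_def mult.assoc)
  qed

  \<comment> \<open>\<open>schur_CB\<close> and \<open>cb\<close> differ by one factor per variable,
    whatever the shape. In D the factors of the two blocks of variables therefore combine to those
    of C.\<close>
  define G where "G y = y powr (- half_shift half) * (if half then 1 + \<beta> * y else 1)" for y
  have CB: "schur_CB n (shifted half lam) x \<beta> = (\<Prod>i=1..n. G (x i)) * cb ?b (\<lambda>i. x (Suc i)) n lam"
    if "length lam = n" "\<And>i. i \<in> {1..n} \<Longrightarrow> 0 < x i" for n lam x
  proof -
    have "schur_CB n (shifted half lam) x \<beta> = (\<Prod>i=1..n. x i powr (- half_shift half)) *
        (if half then \<Prod>i=1..n. 1 + \<beta> * x i else 1) * cb ?b (\<lambda>i. x (Suc i)) n lam"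
      using that by (rule schur_CB_eq_cb)
    then show ?thesis unfolding G_def by (cases half) (simp_all add: prod.distrib)
  qed
  have rep: "replicate n u = shifted half (replicate n U)" for n by (simp add: u shifted_def)
  have pu: "(\<Prod>i=1..N. p i) powr u * (\<Prod>i=1..N. G (p i)) = (if half then \<Prod>i=1..N. 1 + \<beta> * p i else 1) * (\<Prod>i=1..N. p i ^ U)"
  proof -
    have "(\<Prod>i=1..N. p i) powr u = (\<Prod>i=1..N. p i powr u)"
      by (rule prod_powr_distrib)
    then have "(\<Prod>i=1..N. p i) powr u * (\<Prod>i=1..N. G (p i)) = (\<Prod>i=1..N. p i powr u * G (p i))"
      by (simp add: prod.distrib)
    also have "\<dots> = (\<Prod>i=1..N. (if half then 1 + \<beta> * p i else 1) * p i ^ U)"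
    proof (rule prod.cong[OF refl])
      fix i assume i: "i \<in> {1..N}"
      have "p i powr u * p i powr (- half_shift half) = p i ^ U"
        using p[OF i] by (simp add: powr_add[symmetric] u powr_realpow)
      then show "p i powr u * G (p i) = (if half then 1 + \<beta> * p i else 1) * p i ^ U"
        unfolding G_def by (simp add: mult.assoc[symmetric] mult.commute)
    qed
    also have "\<dots> = (if half then \<Prod>i=1..N. 1 + \<beta> * p i else 1) * (\<Prod>i=1..N. p i ^ U)"
      by (simp add: prod.distrib)
    finally show ?thesis .
  qed
  have C: "C = V"
  proof -
    have "schur_CB N (replicate N u) p \<beta> = (\<Prod>i=1..N. G (p i)) * cb ?b ?x N (replicate N U)"
      unfolding rep using p by (intro CB) auto
    then show ?thesis unfolding C_def V_def mult.assoc[symmetric] pu[symmetric] by simp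
  qed

  have D: "D n = V" if n: "\<lceil>real N / 2\<rceil> \<le> int n" "n \<le> N" for n
  proof -
    define k where "k = N - n"
    have "real N / 2 \<le> real n" using n(1) by (simp add: ceiling_le_iff)
    then have "N \<le> 2 * n" by linarith
    then have k: "2 * k \<le> N" "N - k = n" "N - 2 * k = 2 * n - N" "n + k = N" using n(2) by (auto simp: k_def)
    have prodG: "(\<Prod>i=1..n. G (p i)) * (\<Prod>i=1..k. G (p (n + i))) = (\<Prod>i=1..N. G (p i))"
    proof -
      have "(\<Prod>i=1..k. G (p (n + i))) = (\<Prod>i=n+1..n+k. G (p i))"
        by (rule prod.reindex_bij_witness[of _ "\<lambda>i. i - n" "\<lambda>i. n + i"]) auto
      then show ?thesis using prod.ub_add_nat[of 1 n "\<lambda>i. G (p i)" k] by (simp add: k(4))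
    qed
    have "(\<Sum>lam\<in>box_partitions u k. schur_CB n (replicate (2 * n - N) u @ lam) p \<beta> * schur_CB k lam (\<lambda>i. p (n + i)) \<beta>) =
        (\<Sum>lam\<in>partitions_below U k. schur_CB n (replicate (2 * n - N) u @ shifted half lam) p \<beta> *
          schur_CB k (shifted half lam) (\<lambda>i. p (n + i)) \<beta>)"
      unfolding u box_partitions_eq
      by (subst sum.reindex) (auto intro: inj_on_subset[OF inj_shifted])
    also have "\<dots> = (\<Sum>lam\<in>partitions_below U k. (\<Prod>i=1..N. G (p i)) *
        (cb ?b ?x (N - k) (replicate (N - 2 * k) U @ lam) * cb ?b (\<lambda>i. ?x (N - Suc i)) k lam))"
    proof (rule sum.cong[OF refl])
      fix lam assume lam: "lam \<in> partitions_below U k"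
      then have len: "length lam = k" by (simp add: partitions_below_def)
      have "replicate (2 * n - N) u @ shifted half lam = shifted half (replicate (2 * n - N) U @ lam)"
        unfolding rep by (simp add: shifted_def)
      moreover have "schur_CB n (shifted half (replicate (2 * n - N) U @ lam)) p \<beta> =
          (\<Prod>i=1..n. G (p i)) * cb ?b ?x n (replicate (2 * n - N) U @ lam)"
        using p n(2) len k by (intro CB) auto
      moreover have "schur_CB k (shifted half lam) (\<lambda>i. p (n + i)) \<beta> =
          (\<Prod>i=1..k. G (p (n + i))) * cb ?b (\<lambda>i. p (n + Suc i)) k lam"
        using p len k by (intro CB) auto
      moreover have "cb ?b (\<lambda>i. p (n + Suc i)) k lam = cb ?b (\<lambda>i. ?x (N - Suc i)) k lam"
      proof -
        \<comment> \<open>Peeling from the top presents the variables as p N, p (N - 1) and so on,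
          whereas D takes them in increasing order.\<close>
        have "cb ?b (\<lambda>i. ?x (N - Suc i)) k lam = cb ?b (\<lambda>i. p (n + Suc (k - Suc i))) k lam"
        proof (rule cb_cong)
          fix i assume "i < k"
          then have "Suc (N - Suc i) = n + Suc (k - Suc i)" using k(4) by auto
          then show "?x (N - Suc i) = p (n + Suc (k - Suc i))" by simp
        qed
        also have "\<dots> = cb ?b (\<lambda>i. p (n + Suc i)) k lam"
          using lam by (rule cb_reverse_variables[rotated]) (use p k(4) in auto)
        finally show ?thesis ..
      qed
      ultimately show "schur_CB n (replicate (2 * n - N) u @ shifted half lam) p \<beta> * schur_CB k (shifted half lam) (\<lambda>i. p (n + i)) \<beta> =
          (\<Prod>i=1..N. G (p i)) * (cb ?b ?x (N - k) (replicate (N - 2 * k) U @ lam) * cb ?b (\<lambda>i. ?x (N - Suc i)) k lam)"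
        unfolding prodG[symmetric] k(2,3) by (simp only: mult_ac)
    qed
    also have "\<dots> = (\<Prod>i=1..N. G (p i)) * cb ?b ?x N (replicate N U)"
      unfolding sum_distrib_left[symmetric] by (rule arg_cong[OF cb_rectangle_split[OF k(1), symmetric]])
    finally show ?thesis
      unfolding D_def k_def[symmetric] V_def mult.assoc[symmetric] pu[symmetric] by simp
  qed
  show ?thesis using A B C D by simp
qed

end
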